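(* Let $\alpha,\beta$ be integers different from $1$ with $v_2(\alpha-1)=1$ and $n=v_2(\beta-1)>2$. Then $|G_2|=2^{n+4}$, the nilpotency class of $G_2$ is $3$, $o(a)=o(c)=4$ and $o(b)=2^{n+1}$.
   Context: $G(\alpha,\beta)=\langle A,B\mid A^{[A,B]}=A^{\alpha},\ B^{[B,A]}=B^{\beta}\rangle$ with $[x,y]=x^{-1}y^{-1}xy$, $y^x=x^{-1}yx$, and $C=[A,B]$. The group $G(\alpha,\beta)$ is finite and nilpotent, hence the direct product of its Sylow subgroups; $G_2$ denotes its Sylow $2$-subgroup and $a,b,c$ denote the images of $A,B,C$ under the canonical projection $G(\alpha,\beta)\to G_2$. $v_2$ is the $2$-adic valuation and $o(x)$ the order of $x$. *)

theory Defs
  imports "HOL-Algebra.Algebra" "HOL-Computational_Algebra.Primes"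
begin

text \<open>A letter is a pair (g, e): g = False means generator A, g = True means B;
  e = True means the inverse of the generator.  Words are lists of letters.\<close>

type_synonym letter = "bool \<times> bool"
type_synonym word = "letter list"

definition inv_word :: "word \<Rightarrow> word" where
  "inv_word w = rev (map (\<lambda>(g, e). (g, \<not> e)) w)"

definition wpow :: "word \<Rightarrow> int \<Rightarrow> word" where
  "wpow w k = (if 0 \<le> k then concat (replicate (nat k) w)
               else concat (replicate (nat (- k)) (inv_word w)))"

text \<open>Conventions of the paper: [x,y] = x^-1 y^-1 x y and y^x = x^-1 y x.\<close>
definition wcomm :: "word \<Rightarrow> word \<Rightarrow> word" where
  "wcomm x y = inv_word x @ inv_word y @ x @ y"

definition wconj :: "word \<Rightarrow> word \<Rightarrow> word" where
  "wconj y x = inv_word x @ y @ x"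

definition wA :: word where "wA = [(False, False)]"
definition wB :: word where "wB = [(True, False)]"

inductive word_eqv :: "word set \<Rightarrow> word \<Rightarrow> word \<Rightarrow> bool" for R where
  refl: "word_eqv R w w"
| sym: "word_eqv R u v \<Longrightarrow> word_eqv R v u"
| trans: "word_eqv R u v \<Longrightarrow> word_eqv R v w \<Longrightarrow> word_eqv R u w"
| cancel: "word_eqv R (u @ [(g, e), (g, \<not> e)] @ v) (u @ v)"
| relator: "r \<in> R \<Longrightarrow> word_eqv R (u @ r @ v) (u @ v)"

definition wclass :: "word set \<Rightarrow> word \<Rightarrow> word set" where
  "wclass R w = {v. word_eqv R w v}"

definition pres_mult :: "word set \<Rightarrow> word set \<Rightarrow> word set \<Rightarrow> word set" where
  "pres_mult R S T = {z. \<exists>u\<in>S. \<exists>v\<in>T. word_eqv R (u @ v) z}"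

definition pres_group :: "word set \<Rightarrow> word set monoid" where
  "pres_group R = \<lparr>carrier = range (wclass R), monoid.mult = pres_mult R, one = wclass R []\<rparr>"

definition relG :: "int \<Rightarrow> int \<Rightarrow> word set" where
  "relG \<alpha> \<beta> = { wconj wA (wcomm wA wB) @ inv_word (wpow wA \<alpha>),
                 wconj wB (wcomm wB wA) @ inv_word (wpow wB \<beta>) }"

definition Gab :: "int \<Rightarrow> int \<Rightarrow> word set monoid" where
  "Gab \<alpha> \<beta> = pres_group (relG \<alpha> \<beta>)"

definition elA :: "int \<Rightarrow> int \<Rightarrow> word set" where "elA \<alpha> \<beta> = wclass (relG \<alpha> \<beta>) wA"
definition elB :: "int \<Rightarrow> int \<Rightarrow> word set" where "elB \<alpha> \<beta> = wclass (relG \<alpha> \<beta>) wB"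
definition elC :: "int \<Rightarrow> int \<Rightarrow> word set" where
  "elC \<alpha> \<beta> = wclass (relG \<alpha> \<beta>) (wcomm wA wB)"

text \<open>P is a Sylow 2-subgroup of the finite group G and pi is a homomorphism
  G -> P restricting to the identity on P.  For finite nilpotent G = G_2 x G_2',
  this pi is exactly the canonical projection onto G_2.\<close>
definition sylow2_proj :: "('a, 'b) monoid_scheme \<Rightarrow> 'a set \<Rightarrow> ('a \<Rightarrow> 'a) \<Rightarrow> bool" where
  "sylow2_proj G P \<pi> \<longleftrightarrow> subgroup P G \<and> card P = 2 ^ multiplicity (2::nat) (order G)
     \<and> \<pi> \<in> hom G (G\<lparr>carrier := P\<rparr>) \<and> (\<forall>x\<in>P. \<pi> x = x)"

definition gcomm :: "('a, 'b) monoid_scheme \<Rightarrow> 'a \<Rightarrow> 'a \<Rightarrow> 'a" where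
  "gcomm H x y = inv\<^bsub>H\<^esub> x \<otimes>\<^bsub>H\<^esub> inv\<^bsub>H\<^esub> y \<otimes>\<^bsub>H\<^esub> x \<otimes>\<^bsub>H\<^esub> y"

text \<open>Lower central series: lcs H 0 = gamma_1 = H, lcs H (k+1) = [lcs H k, H].\<close>
fun lcs :: "('a, 'b) monoid_scheme \<Rightarrow> nat \<Rightarrow> 'a set" where
  "lcs H 0 = carrier H"
| "lcs H (Suc k) = generate H {gcomm H x y | x y. x \<in> lcs H k \<and> y \<in> carrier H}"

definition nilpotent_grp :: "('a, 'b) monoid_scheme \<Rightarrow> bool" where
  "nilpotent_grp H \<longleftrightarrow> (\<exists>c. lcs H c = {\<one>\<^bsub>H\<^esub>})"

definition nil_class :: "('a, 'b) monoid_scheme \<Rightarrow> nat" where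
  "nil_class H = (LEAST c. lcs H c = {\<one>\<^bsub>H\<^esub>})"

end

theory Submission
  imports Defs
begin

text \<open>
  Put \<open>C = [A,B]\<close>, so that \<open>AB = BAC\<close>, \<open>AC = CA\<^sup>\<alpha>\<close> and \<open>CB = B\<^sup>\<beta>C\<close>. Expanding \<open>[A\<^sup>a, B]\<close> with \<open>a = \<alpha>\<^sup>i\<close> and
  \<open>[A, B\<^sup>b]\<close> with \<open>b = \<beta>\<^sup>i\<close>, which are conjugate under \<open>C\<^sup>i\<close>, yields a relation
  \<open>C\<^sup>r = B\<^sup>f C\<^sup>s A\<^sup>e\<close>. For \<open>i = 2\<close>, comparing it with its conjugate by \<open>B\<close> (or by \<open>A\<close>) puts a nontrivial
  power of \<open>B\<close> into \<open>\<langle>A\<rangle>\<close> (or conversely); such a power is central, hence of finite order. So \<open>A\<close>, \<open>B\<close>, \<open>C\<close>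
  have finite order, and the group, being \<open>\<langle>B\<rangle>\<langle>C\<rangle>\<langle>A\<rangle>\<close>, is finite.

  As \<open>\<alpha>\<close> and \<open>\<beta>\<close> are odd, the elements \<open>B\<^sup>x C\<^sup>y A\<^sup>z\<close> whose exponents are all divisible by \<open>2\<^sup>s\<close> form a normal
  subgroup; for large \<open>s\<close> it has odd order and its index is a power of 2. This is the kernel of the projection.

  In a 2-group quotient, induction over a central involution gives \<open>a\<^sup>4 = 1\<close>, \<open>c\<^sup>2 = a\<^sup>2\<close> and \<open>b\<close> of order
  dividing \<open>2\<^sup>n\<^sup>+\<^sup>1\<close>, so there are at most \<open>2\<^sup>n\<^sup>+\<^sup>4\<close> elements \<open>b\<^sup>x c\<^sup>y a\<^sup>z\<close>. A transitive permutation model on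
  \<open>2\<^sup>n\<^sup>+\<^sup>4\<close> points shows that this bound is attained.
\<close>

section \<open>The Macdonald relations\<close>

text \<open>The presentation bounds no order by itself. All information is squeezed out of one
  product, \<open>A \<otimes> C^i \<otimes> B\<close>, evaluated by moving \<open>A\<close> to the
  right or \<open>B\<close> to the left past \<open>C^i\<close>. The resulting relation is used
  twice. With i = 2 the exponents \<alpha>^2 and \<beta>^2 are non-negative whatever the signs of
  \<alpha> and \<beta>, so they can count repeated factors; this gives torsion. With i = 1, inside a
  2-group where exponents may be reduced modulo known orders, it removes the last unknown factor v
  from \<open>C^2 = A^2 v\<close>.

  Exponents of \<open>C\<close> are kept natural throughout: \<open>C^-1 A C\<close> is a power of
  \<open>A\<close>, but as long as \<open>A\<close> may have infinite order, \<open>C A C^-1\<close>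
  need not be one. Exchanging the generators replaces \<open>C\<close> by its inverse and preserves
  the relations, so every fact about \<open>B\<close> has a twin about \<open>A\<close>.

  The lower bound enters as the length of an orbit, which divides the order of the group. Once it
  meets the number of normal forms, distinct normal forms are distinct elements, and the orders and
  the class can be read off from them.\<close>

definition gsum :: "int \<Rightarrow> nat \<Rightarrow> int" where
  "gsum q k = (\<Sum>i<k. q ^ i)"

lemma gsum_0 [simp]: "gsum q 0 = 0"
  and gsum_Suc: "gsum q (Suc k) = gsum q k + q ^ k"
  by (simp_all add: gsum_def)

lemma gsum_mult: "(q - 1) * gsum q k = q ^ k - 1"
  by (induction k) (simp_all add: gsum_Suc algebra_simps)

section \<open>Integer powers and conjugation\<close>

context group
begin

lemma int_pow_add: "x \<in> carrier G \<Longrightarrow> x [^] (i::int) \<otimes> x [^] (j::int) = x [^] (i + j)"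
  by (simp add: int_pow_mult)

lemma int_pow_add_left:
  "\<lbrakk>x \<in> carrier G; t \<in> carrier G\<rbrakk> \<Longrightarrow> x [^] (i::int) \<otimes> (x [^] (j::int) \<otimes> t) = x [^] (i + j) \<otimes> t"
  by (simp add: int_pow_mult m_assoc[symmetric])

lemma nat_pow_add_left:
  "\<lbrakk>x \<in> carrier G; t \<in> carrier G\<rbrakk> \<Longrightarrow> x [^] (i::nat) \<otimes> (x [^] (j::nat) \<otimes> t) = x [^] (i + j) \<otimes> t"
  by (simp add: nat_pow_mult m_assoc[symmetric])

text \<open>Conjugation by \<open>x\<close> respects powers. Written without inverses, the lemma
  takes relations such as \<open>C_B\<close> as they stand, where \<open>z\<close> is itself a
  power.\<close>

lemma int_pow_commute_gen:
  assumes "x \<in> carrier G" "y \<in> carrier G" "z \<in> carrier G" "x \<otimes> y = z \<otimes> x"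
  shows "x \<otimes> y [^] (k::int) = z [^] k \<otimes> x"
proof -
  have n: "x \<otimes> y [^] (j::nat) = z [^] j \<otimes> x" for j
  proof (induction j)
    case (Suc j)
    have "x \<otimes> y [^] Suc j = (x \<otimes> y [^] j) \<otimes> y"
      using assms by (simp add: m_assoc)
    also have "\<dots> = z [^] j \<otimes> (x \<otimes> y)"
      using assms by (simp only: Suc m_assoc nat_pow_closed)
    also have "\<dots> = z [^] Suc j \<otimes> x"
      using assms by (simp add: m_assoc)
    finally show ?case .
  qed (use assms in simp)
  show ?thesis
  proof (cases k rule: int_cases)
    case (nonneg j)
    then show ?thesis using n[of j] by (simp only: int_pow_int)
  next
    case (neg j)
    let ?j = "Suc j"
    have "inv (z [^] ?j) \<otimes> (x \<otimes> y [^] ?j) = x"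
      using inv_solve_left'[of x "z [^] ?j" "x \<otimes> y [^] ?j"] n[of ?j] assms(1-3)
      by (simp only: nat_pow_closed m_closed)
    then have "(inv (z [^] ?j) \<otimes> x) \<otimes> y [^] ?j = x"
      using assms(1-3) by (simp only: m_assoc nat_pow_closed m_closed inv_closed)
    then have "x \<otimes> inv (y [^] ?j) = inv (z [^] ?j) \<otimes> x"
      using inv_solve_right'[of "inv (z [^] ?j) \<otimes> x" x "y [^] ?j"] assms(1-3)
      by (simp only: nat_pow_closed m_closed inv_closed)
    then show ?thesis
      by (simp only: neg int_pow_neg_int assms)
  qed
qed

end

locale macdonald = group G for G (structure) +
  fixes A B :: 'a and \<alpha> \<beta> :: int
  assumes A_closed [simp, intro]: "A \<in> carrier G"
    and B_closed [simp, intro]: "B \<in> carrier G"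
    and rel_A: "inv (gcomm G A B) \<otimes> A \<otimes> gcomm G A B = A [^] \<alpha>"
    and rel_B: "inv (gcomm G B A) \<otimes> B \<otimes> gcomm G B A = B [^] \<beta>"
begin

definition C :: 'a where "C = gcomm G A B"

lemma C_closed [simp, intro]: "C \<in> carrier G"
  by (simp add: C_def gcomm_def)

lemma gcomm_swap: "gcomm G B A = inv C"
  by (simp add: C_def gcomm_def inv_mult_group m_assoc)

text \<open>Together with \<open>swap_C\<close>, this symmetry turns each lemma about
  \<open>B\<close> into one about \<open>A\<close>.\<close>

lemma swap: "macdonald G B A \<beta> \<alpha>"
  by unfold_locales (auto simp: rel_A rel_B)

lemma swap_C: "macdonald.C G B A = inv C"
  using gcomm_swap by (simp add: macdonald.C_def[OF swap])

lemma A_B: "A \<otimes> B = B \<otimes> (A \<otimes> C)"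
proof -
  have "C = inv (B \<otimes> A) \<otimes> (A \<otimes> B)"
    by (simp add: C_def gcomm_def inv_mult_group m_assoc)
  then have "A \<otimes> B = B \<otimes> A \<otimes> C"
    using inv_solve_left[of C "B \<otimes> A" "A \<otimes> B"] by simp
  then show ?thesis by (simp add: m_assoc)
qed

lemma A_C: "A \<otimes> C = C \<otimes> A [^] \<alpha>"
proof -
  have "A [^] \<alpha> = inv C \<otimes> (A \<otimes> C)"
    using rel_A by (simp add: C_def[symmetric] m_assoc)
  then show ?thesis
    using inv_solve_left[of "A [^] \<alpha>" C "A \<otimes> C"] by simp
qed

lemma C_B: "C \<otimes> B = B [^] \<beta> \<otimes> C"
proof -
  have "C \<otimes> B \<otimes> inv C = B [^] \<beta>"
    using rel_B by (simp add: gcomm_swap)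
  then show ?thesis
    using inv_solve_right[of "B [^] \<beta>" "C \<otimes> B" C] by simp
qed

lemma C_Bi: "C \<otimes> B [^] (x::int) = B [^] (x * \<beta>) \<otimes> C"
  using int_pow_commute_gen[OF _ _ _ C_B, of x] by (simp add: int_pow_pow mult.commute)

text \<open>The exponent of \<open>C\<close> is natural because \<alpha> is not assumed to be
  invertible modulo the order of \<open>A\<close>, which may still be infinite.\<close>

lemma A_C_pow: "A [^] (z::int) \<otimes> C [^] (y::nat) = C [^] y \<otimes> A [^] (z * \<alpha> ^ y)"
proof (induction y arbitrary: z)
  case (Suc y)
  have 1: "A [^] z \<otimes> C = C \<otimes> A [^] (z * \<alpha>)" for z
    using int_pow_commute_gen[OF C_closed int_pow_closed[OF A_closed] A_closed A_C[symmetric], of z]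
    by (simp add: int_pow_pow mult.commute)
  have "A [^] z \<otimes> C [^] Suc y = (A [^] z \<otimes> C [^] y) \<otimes> C"
    by (simp add: m_assoc)
  also have "\<dots> = C [^] y \<otimes> (A [^] (z * \<alpha> ^ y) \<otimes> C)"
    by (simp add: Suc m_assoc)
  also have "\<dots> = C [^] Suc y \<otimes> A [^] (z * \<alpha> ^ Suc y)"
    by (simp add: 1 m_assoc ac_simps)
  finally show ?case .
qed simp

lemma C_B_pow: "C [^] (y::nat) \<otimes> B [^] (x::int) = B [^] (x * \<beta> ^ y) \<otimes> C [^] y"
proof (induction y arbitrary: x)
  case (Suc y)
  have "C [^] Suc y \<otimes> B [^] x = C [^] y \<otimes> (C \<otimes> B [^] x)"
    by (simp add: m_assoc)
  also have "\<dots> = (C [^] y \<otimes> B [^] (x * \<beta>)) \<otimes> C"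
    by (simp add: C_Bi m_assoc)
  also have "\<dots> = B [^] (x * \<beta> ^ Suc y) \<otimes> C [^] Suc y"
    by (simp add: Suc m_assoc ac_simps)
  finally show ?case .
qed simp

lemma A_C_pow_left:
  "t \<in> carrier G \<Longrightarrow> A [^] (z::int) \<otimes> (C [^] (y::nat) \<otimes> t) = C [^] y \<otimes> (A [^] (z * \<alpha> ^ y) \<otimes> t)"
  using A_C_pow[of z y] by (simp add: m_assoc[symmetric])

lemma C_B_pow_left:
  "t \<in> carrier G \<Longrightarrow> C [^] (y::nat) \<otimes> (B [^] (x::int) \<otimes> t) = B [^] (x * \<beta> ^ y) \<otimes> (C [^] y \<otimes> t)"
  using C_B_pow[of y x] by (simp add: m_assoc[symmetric])

text \<open>Oriented so that \<open>B\<close> moves to the left and \<open>A\<close> to the right.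
  The crossing of \<open>A\<close> and \<open>B\<close> is left out: it creates powers of
  \<open>C\<close> and is done by hand with \<open>A_pow_B\<close> or
  \<open>B_pow_A\<close>.\<close>

lemmas collect = m_assoc A_C_pow A_C_pow_left C_B_pow C_B_pow_left
  int_pow_add int_pow_add_left nat_pow_mult nat_pow_add_left

text \<open>Each further \<open>C\<close> pulled to the left multiplies the exponent of
  \<open>A\<close> collected so far by \<alpha>; as in Horner's scheme the exponents add up to
  \<alpha> + ... + \<alpha>^k.\<close>

lemma AC_pow: "(A \<otimes> C) [^] (k::nat) = C [^] k \<otimes> A [^] (\<alpha> * gsum \<alpha> k)"
proof (induction k)
  case (Suc k)
  have "(A \<otimes> C) [^] Suc k = C [^] k \<otimes> A [^] (\<alpha> * gsum \<alpha> k) \<otimes> (C [^] (1::nat) \<otimes> A [^] \<alpha>)"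
    by (simp add: Suc flip: A_C)
  also have "\<dots> = C [^] (k + 1) \<otimes> A [^] (\<alpha> * gsum \<alpha> k * \<alpha> ^ 1 + \<alpha>)"
    by (simp only: collect A_closed C_closed int_pow_closed nat_pow_closed m_closed)
  also have "\<alpha> * gsum \<alpha> k * \<alpha> ^ 1 + \<alpha> = \<alpha> * gsum \<alpha> (Suc k)"
  proof -
    have "\<alpha> * gsum \<alpha> k + 1 = gsum \<alpha> (Suc k)"
      using gsum_mult[of \<alpha> k] by (simp add: gsum_Suc algebra_simps)
    then show ?thesis by (simp flip: \<open>\<alpha> * gsum \<alpha> k + 1 = gsum \<alpha> (Suc k)\<close> add: algebra_simps)
  qed
  finally show ?case by simp
qed simp

text \<open>Conjugation by \<open>B\<close> sends \<open>A\<close> to \<open>A \<otimes> C\<close>,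
  hence \<open>A^k\<close> to \<open>(A \<otimes> C)^k\<close>.\<close>

lemma A_pow_B: "A [^] (int k) \<otimes> B = B \<otimes> (C [^] k \<otimes> A [^] (\<alpha> * gsum \<alpha> k))"
proof -
  have "B \<otimes> (A \<otimes> C) [^] int k = A [^] int k \<otimes> B"
    by (rule int_pow_commute_gen) (auto simp: A_B)
  then show ?thesis by (simp add: int_pow_int AC_pow)
qed

lemma B_pow_A: "B [^] (int k) \<otimes> A = A \<otimes> (inv C [^] k \<otimes> B [^] (\<beta> * gsum \<beta> k))"
  using macdonald.A_pow_B[OF swap, of k] by (simp add: swap_C)

lemma C_pow_inv: "C [^] (k::nat) \<otimes> inv C [^] k = \<one>"
  by (simp add: nat_pow_inv)

text \<open>The source of all order bounds. The assumptions ask only for equal powers, not for a =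
  \<alpha>^i and b = \<beta>^i, so that exponents may first be reduced modulo the orders of
  \<open>A\<close> and \<open>B\<close>.\<close>

lemma C_power_relation:
  fixes a b i :: nat
  assumes a: "A [^] (int a) = A [^] (\<alpha> ^ i)" and b: "B [^] (int b) = B [^] (\<beta> ^ i)"
  shows "C [^] (a + i) = B [^] (int b * \<beta> ^ b - \<beta> * gsum \<beta> b) \<otimes> (C [^] (b + i)
     \<otimes> A [^] (\<alpha> ^ (a + i) - \<alpha> * gsum \<alpha> a))"
proof -
  let ?e = "\<alpha> ^ (a + i) - \<alpha> * gsum \<alpha> a" and ?ga = "\<alpha> * gsum \<alpha> a" and ?gb = "\<beta> * gsum \<beta> b"
  have cb: "C [^] i \<otimes> B = B [^] (int b) \<otimes> C [^] i"
    using C_B_pow[of i 1] unfolding b int_pow_1[OF B_closed] mult_1_left .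
  have ca: "C [^] i \<otimes> A [^] (int a) = A \<otimes> C [^] i"
    using A_C_pow[of 1 i, symmetric] unfolding a int_pow_1[OF A_closed] mult_1_left .
  \<comment> \<open>This is the product \<open>A \<otimes> C^i \<otimes> B\<close>; here
    \<open>A\<close> is moved to the right through \<open>C^i\<close> and then expanded against
    \<open>B\<close>.\<close>
  have "A \<otimes> (B [^] (int b) \<otimes> C [^] i) = (A \<otimes> C [^] i) \<otimes> B"
    by (simp add: cb[symmetric] m_assoc)
  also have "\<dots> = C [^] i \<otimes> (A [^] (int a) \<otimes> B)"
    by (simp add: ca[symmetric] m_assoc)
  also have "\<dots> = (C [^] i \<otimes> B) \<otimes> (C [^] a \<otimes> A [^] ?ga)"
    by (simp add: A_pow_B m_assoc)
  also have "\<dots> = B [^] (int b) \<otimes> (C [^] (a + i) \<otimes> A [^] ?ga)"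
    by (simp add: cb m_assoc nat_pow_add_left ac_simps)
  finally have 1: "A \<otimes> (B [^] (int b) \<otimes> C [^] i) = B [^] (int b) \<otimes> (C [^] (a + i) \<otimes> A [^] ?ga)" .
  \<comment> \<open>The exponent \<open>?e\<close> is chosen so that a single \<open>A\<close> can
    be split off on the left: crossing \<open>C^(a+i)\<close>, it contributes \<alpha>^(a+i). Both
    sides then start with \<open>A\<close>, which cancels.\<close>
  have 2: "A \<otimes> (C [^] (a + i) \<otimes> A [^] (- ?e)) = C [^] (a + i) \<otimes> A [^] ?ga"
    using A_C_pow_left[of "A [^] (- ?e)" 1 "a + i"] by (simp add: int_pow_add)
  have "A \<otimes> (B [^] (int b) \<otimes> C [^] i) = (B [^] (int b) \<otimes> A) \<otimes> (C [^] (a + i) \<otimes> A [^] (- ?e))"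
    unfolding 1 2[symmetric] by (simp add: m_assoc)
  then have "A \<otimes> (B [^] (int b) \<otimes> C [^] i) =
     A \<otimes> (inv C [^] b \<otimes> (B [^] ?gb \<otimes> (C [^] (a + i) \<otimes> A [^] (- ?e))))"
    unfolding B_pow_A by (simp add: m_assoc)
  then have "B [^] (int b) \<otimes> C [^] i = inv C [^] b \<otimes> (B [^] ?gb \<otimes> (C [^] (a + i) \<otimes> A [^] (- ?e)))"
    by simp
  then have "C [^] b \<otimes> (B [^] (int b) \<otimes> C [^] i) =
      C [^] b \<otimes> (inv C [^] b \<otimes> (B [^] ?gb \<otimes> (C [^] (a + i) \<otimes> A [^] (- ?e))))"
    by simp
  also have "\<dots> = B [^] ?gb \<otimes> (C [^] (a + i) \<otimes> A [^] (- ?e))"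
    by (subst m_assoc[symmetric]) (auto simp: C_pow_inv)
  finally have "B [^] (int b * \<beta> ^ b) \<otimes> C [^] (b + i) = B [^] ?gb \<otimes> (C [^] (a + i) \<otimes> A [^] (- ?e))"
    by (simp add: collect)
  then have "B [^] (- ?gb) \<otimes> (B [^] (int b * \<beta> ^ b) \<otimes> (C [^] (b + i) \<otimes> A [^] ?e)) =
     B [^] (- ?gb) \<otimes> ((B [^] ?gb \<otimes> (C [^] (a + i) \<otimes> A [^] (- ?e))) \<otimes> A [^] ?e)"
    by (simp add: m_assoc[symmetric])
  then show ?thesis
    by (simp add: m_assoc int_pow_add int_pow_add_left)
qed

end

section \<open>Finiteness of the orders of the generators\<close>

lemma gsum_Suc2: "gsum q (Suc k) = 1 + q * gsum q k"
  using gsum_mult[of q k] by (simp add: gsum_Suc algebra_simps)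

text \<open>After division by q, a zero would say q^(k+1) = \<open>gsum q k\<close>; but for k > 0
  the sum is 1 modulo q.\<close>

lemma pow_minus_gsum_nonzero:
  assumes "\<bar>q\<bar> \<ge> 2" "k > 0"
  shows "q ^ (k + 2) - q * gsum q k \<noteq> 0"
proof
  assume "q ^ (k + 2) - q * gsum q k = 0"
  then have "q * (q * q ^ k) = q * gsum q k" by (simp add: algebra_simps)
  then have "q * q ^ k = gsum q k" using assms by auto
  then have "q dvd gsum q k" by (metis dvd_triv_left)
  moreover obtain j where "k = Suc j" using assms by (cases k) auto
  ultimately have "q dvd 1"
    using dvd_add_left_iff[of q "q * gsum q j" 1] by (simp add: gsum_Suc2)
  then show False using assms by auto
qed

text \<open>An even gap b - a makes the sign of p irrelevant: the difference is p^a times |p|^(b-a)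
  - 1, and both factors grow in absolute value with |p|.\<close>

lemma power_diff_less:
  fixes p q :: int and a b :: nat
  assumes "odd p" "odd q" "1 < \<bar>p\<bar>" "\<bar>p\<bar> < \<bar>q\<bar>" "a < b" "even (b - a)"
  shows "\<bar>p ^ b - p ^ a\<bar> < \<bar>q ^ b - q ^ a\<bar>"
proof -
  have *: "\<bar>x ^ b - x ^ a\<bar> = \<bar>x\<bar> ^ a * (\<bar>x\<bar> ^ (b - a) - 1)" if "1 < \<bar>x\<bar>" for x :: int
  proof -
    have "x ^ b - x ^ a = x ^ a * (\<bar>x\<bar> ^ (b - a) - 1)"
      using assms by (simp add: algebra_simps power_even_abs flip: power_add)
    moreover have "1 \<le> \<bar>x\<bar> ^ (b - a)" using that by (intro one_le_power) simp
    then have "\<bar>\<bar>x\<bar> ^ (b - a) - 1\<bar> = \<bar>x\<bar> ^ (b - a) - 1" by linarith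
    ultimately show ?thesis by (simp add: abs_mult power_abs)
  qed
  have "\<bar>p\<bar> ^ (b - a) < \<bar>q\<bar> ^ (b - a)" using assms by (intro power_strict_mono) auto
  moreover have "\<bar>p\<bar> ^ a \<le> \<bar>q\<bar> ^ a" using assms by (intro power_mono) auto
  moreover have "1 \<le> \<bar>p\<bar> ^ (b - a)" using assms by (intro one_le_power) simp
  moreover have "0 < \<bar>p\<bar> ^ a" using assms by simp
  ultimately have "\<bar>p\<bar> ^ a * (\<bar>p\<bar> ^ (b - a) - 1) < \<bar>q\<bar> ^ a * (\<bar>q\<bar> ^ (b - a) - 1)"
    by (intro mult_le_less_imp_less) (use assms in auto)
  then show ?thesis using * assms by simp
qed

text \<open>The two numbers are the exponents, up to a non-zero factor, that kill \<open>B\<close>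
  and \<open>A\<close> respectively. If both vanished, their difference would force q^(a+2) -
  q^(b+2) = p^(a+2) - p^(b+2), against strict growth in |p|; a and b are odd squares, so the gap is
  even. For a = b the first number is just f e.\<close>

lemma exponents_not_both_zero:
  fixes p q e f :: int and a b :: nat
  assumes "odd p" "odd q" "1 < \<bar>p\<bar>" "1 < \<bar>q\<bar>" "int a = p\<^sup>2" "int b = q\<^sup>2" "e \<noteq> 0" "f \<noteq> 0"
  shows "f * e - (q ^ (a + 2) - q ^ (b + 2)) * (int a - int b) \<noteq> 0 \<or>
         e * f - (p ^ (b + 2) - p ^ (a + 2)) * (int b - int a) \<noteq> 0"
proof (cases "a = b")
  case False
  have "odd (int a)" "odd (int b)" using assms by simp_all
  then have ab: "odd a" "odd b" by simp_all
  show ?thesis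
  proof (rule ccontr)
    assume "\<not> ?thesis"
    then have "(q ^ (a + 2) - q ^ (b + 2)) * (int a - int b) = (p ^ (b + 2) - p ^ (a + 2)) * (int b - int a)"
      by (simp add: mult.commute)
    also have "\<dots> = (p ^ (a + 2) - p ^ (b + 2)) * (int a - int b)" by (simp add: algebra_simps)
    finally have eq: "q ^ (a + 2) - q ^ (b + 2) = p ^ (a + 2) - p ^ (b + 2)" using False by simp
    consider "a < b" | "b < a" using False by linarith
    then show False
    proof cases
      case 1
      then have "p\<^sup>2 < q\<^sup>2" using assms by linarith
      then have "\<bar>p\<bar> < \<bar>q\<bar>" by (simp add: abs_le_square_iff flip: not_le)
      then have "\<bar>p ^ (b + 2) - p ^ (a + 2)\<bar> < \<bar>q ^ (b + 2) - q ^ (a + 2)\<bar>"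
        using 1 ab assms by (intro power_diff_less) auto
      then show False using eq by linarith
    next
      case 2
      then have "q\<^sup>2 < p\<^sup>2" using assms by linarith
      then have "\<bar>q\<bar> < \<bar>p\<bar>" by (simp add: abs_le_square_iff flip: not_le)
      then have "\<bar>q ^ (a + 2) - q ^ (b + 2)\<bar> < \<bar>p ^ (a + 2) - p ^ (b + 2)\<bar>"
        using 2 ab assms by (intro power_diff_less) auto
      then show False using eq by linarith
    qed
  qed
qed (use assms in simp)

section \<open>Powers of \<open>B\<close> in cosets of the conjugates of powers of
  \<open>A\<close>\<close>

context macdonald
begin

text \<open>\<open>coset_C k\<close> is \<open>C\<^sup>kD\<close>, where \<open>D\<close> is the ascending union of the groups \<open>C\<^sup>q\<langle>A\<rangle>C\<^sup>-\<^sup>q\<close>; these need not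
  coincide while \<open>A\<close> may have infinite order. The equation is multiplied out to avoid negative powers of \<open>C\<close>.\<close>

definition coset_C :: "int \<Rightarrow> 'a set" where
  "coset_C k = {g \<in> carrier G. \<exists>(p::nat) (q::nat) (x::int).
     g \<otimes> C [^] q = C [^] p \<otimes> A [^] x \<and> int p - int q = k}"

lemma coset_C_I:
  "\<lbrakk>g \<in> carrier G; g \<otimes> C [^] (q::nat) = C [^] (p::nat) \<otimes> A [^] (x::int); int p - int q = k\<rbrakk>
    \<Longrightarrow> g \<in> coset_C k"
  unfolding coset_C_def by blast

text \<open>Extends a representation of \<open>g\<close> to a larger denominator, so that two
  representations can be matched in a product.\<close>

lemma coset_C_shift:
  assumes "g \<in> carrier G" "g \<otimes> C [^] (q::nat) = C [^] (p::nat) \<otimes> A [^] (x::int)"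
  shows "g \<otimes> C [^] (q + j) = C [^] (p + j) \<otimes> A [^] (x * \<alpha> ^ j)"
proof -
  have "g \<otimes> C [^] (q + j) = (g \<otimes> C [^] q) \<otimes> C [^] j"
    using assms(1) by (simp add: m_assoc nat_pow_mult)
  then show ?thesis unfolding assms(2) by (simp add: collect)
qed

lemma coset_C_mult:
  assumes "g \<in> coset_C k" "h \<in> coset_C l"
  shows "g \<otimes> h \<in> coset_C (k + l)"
proof -
  obtain p q :: nat and x :: int where g: "g \<in> carrier G" "g \<otimes> C [^] q = C [^] p \<otimes> A [^] x" "int p - int q = k"
    using assms by (auto simp: coset_C_def)
  obtain p' q' :: nat and x' :: int where h: "h \<in> carrier G" "h \<otimes> C [^] q' = C [^] p' \<otimes> A [^] x'" "int p' - int q' = l"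
    using assms by (auto simp: coset_C_def)
  have "(g \<otimes> h) \<otimes> C [^] (q' + q) = g \<otimes> (h \<otimes> C [^] (q' + q))"
    using g(1) h(1) by (simp add: m_assoc)
  also have "\<dots> = (g \<otimes> C [^] (q + p')) \<otimes> A [^] (x' * \<alpha> ^ q)"
    unfolding coset_C_shift[OF h(1,2)] using g(1) by (simp add: m_assoc add.commute)
  also have "\<dots> = C [^] (p + p') \<otimes> A [^] (x * \<alpha> ^ p' + x' * \<alpha> ^ q)"
    unfolding coset_C_shift[OF g(1,2)] by (simp add: m_assoc int_pow_add)
  finally have "(g \<otimes> h) \<otimes> C [^] (q' + q) = C [^] (p + p') \<otimes> A [^] (x * \<alpha> ^ p' + x' * \<alpha> ^ q)" .
  moreover have "int (p + p') - int (q' + q) = k + l" using g(3) h(3) by simp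
  ultimately show ?thesis using g(1) h(1) unfolding coset_C_def by blast
qed

lemma coset_C_inv:
  assumes "g \<in> coset_C k"
  shows "inv g \<in> coset_C (- k)"
proof -
  obtain p q :: nat and x :: int where g: "g \<in> carrier G" "g \<otimes> C [^] q = C [^] p \<otimes> A [^] x" "int p - int q = k"
    using assms by (auto simp: coset_C_def)
  have "C [^] p = g \<otimes> C [^] q \<otimes> A [^] (- x)"
    unfolding g(2) by (simp add: m_assoc int_pow_add)
  then have "C [^] p = g \<otimes> (C [^] q \<otimes> A [^] (- x))"
    using g(1) by (simp add: m_assoc)
  then have "inv g \<otimes> C [^] p = C [^] q \<otimes> A [^] (- x)"
    using inv_solve_left'[of "C [^] q \<otimes> A [^] (- x)" g "C [^] p"] g(1) by simp
  moreover have "int q - int p = - k" using g(3) by simp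
  ultimately show ?thesis using g(1) unfolding coset_C_def by blast
qed

lemma coset_C_one: "\<one> \<in> coset_C 0"
  by (rule coset_C_I[of _ 0 0 0]) auto

lemma coset_C_pow:
  assumes "g \<in> coset_C k"
  shows "g [^] (j::int) \<in> coset_C (k * j)"
proof -
  have g: "g \<in> carrier G" using assms by (simp add: coset_C_def)
  have n: "g [^] (i::nat) \<in> coset_C (k * int i)" for i
  proof (induction i)
    case (Suc i)
    then show ?case using coset_C_mult[OF Suc assms] by (simp add: algebra_simps)
  qed (simp add: coset_C_one)
  show ?thesis
  proof (cases j rule: int_cases)
    case (nonneg i)
    then show ?thesis using n[of i] by (simp add: int_pow_int)
  next
    case (neg i)
    then show ?thesis using coset_C_inv[OF n[of "Suc i"]] g by (simp only: int_pow_neg_int mult_minus_right)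
  qed
qed

text \<open>\<open>C\<close> is a word in \<open>A\<close> and \<open>B\<close>; the proof moves
  \<open>g\<close> once through both sides of \<open>A_B\<close>.\<close>

lemma commute_C:
  assumes "g \<in> carrier G" "g \<otimes> A = A \<otimes> g" "g \<otimes> B = B \<otimes> g"
  shows "g \<otimes> C = C \<otimes> g"
proof -
  have "(B \<otimes> A) \<otimes> (g \<otimes> C) = B \<otimes> (A \<otimes> g) \<otimes> C" using assms(1) by (simp add: m_assoc)
  also have "\<dots> = (B \<otimes> g) \<otimes> (A \<otimes> C)" unfolding assms(2)[symmetric] using assms(1) by (simp add: m_assoc)
  also have "\<dots> = g \<otimes> (A \<otimes> B)" unfolding assms(3)[symmetric] A_B using assms(1) by (simp add: m_assoc)
  also have "\<dots> = (g \<otimes> A) \<otimes> B" using assms(1) by (simp add: m_assoc)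
  also have "\<dots> = A \<otimes> (g \<otimes> B)" unfolding assms(2) using assms(1) by (simp add: m_assoc)
  also have "\<dots> = (A \<otimes> B) \<otimes> g" unfolding assms(3) using assms(1) by (simp add: m_assoc)
  also have "\<dots> = (B \<otimes> A) \<otimes> (C \<otimes> g)" unfolding A_B using assms(1) by (simp add: m_assoc)
  finally show ?thesis using assms(1) by simp
qed

text \<open>Such a power of \<open>B\<close> commutes with \<open>A\<close> and \<open>B\<close>,
  hence with \<open>C\<close>; but \<open>C\<close> conjugates \<open>B^y\<close> to
  \<open>B^(y \<beta>)\<close>.\<close>

lemma B_pow_commute_A:
  assumes "B [^] (y::int) \<otimes> A = A \<otimes> B [^] y"
  shows "B [^] (y * (\<beta> - 1)) = \<one>"
proof -
  have "B [^] y \<otimes> B = B \<otimes> B [^] y"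
    using int_pow_add[of B y 1] int_pow_add[of B 1 y] by (simp add: add.commute)
  then have "B [^] y \<otimes> C = C \<otimes> B [^] y"
    using assms by (intro commute_C) auto
  then have "B [^] y = B [^] (y * \<beta>)"
    unfolding C_Bi by simp
  then have "B [^] (- y) \<otimes> B [^] (y * \<beta>) = B [^] (- y) \<otimes> B [^] y" by simp
  then show ?thesis by (simp add: int_pow_add algebra_simps)
qed

lemma A_pow_commute_B:
  "A [^] (x::int) \<otimes> B = B \<otimes> A [^] x \<Longrightarrow> A [^] (x * (\<alpha> - 1)) = \<one>"
  by (rule macdonald.B_pow_commute_A[OF swap])

text \<open>Membership says that \<open>C^q\<close> conjugates some \<open>A^x\<close> to
  \<open>B^y\<close>. Raised to the power \<beta>^q the right side becomes the conjugate of
  \<open>B^y\<close> by the same \<open>C^q\<close>, so \<open>B^y\<close> itself is a power of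
  \<open>A\<close> and commutes with \<open>A\<close>.\<close>

lemma B_pow_coset_C_0:
  assumes "B [^] (y::int) \<in> coset_C 0"
  shows "B [^] (y * (\<beta> - 1)) = \<one>"
proof -
  obtain q :: nat and x :: int where q: "B [^] y \<otimes> C [^] q = C [^] q \<otimes> A [^] x"
    using assms unfolding coset_C_def by auto
  have "C [^] q \<otimes> (A [^] x) [^] (\<beta> ^ q) = (B [^] y) [^] (\<beta> ^ q) \<otimes> C [^] q"
    using q[symmetric] by (intro int_pow_commute_gen) auto
  then have "C [^] q \<otimes> A [^] (x * \<beta> ^ q) = C [^] q \<otimes> B [^] y"
    by (simp add: int_pow_pow C_B_pow)
  then have e: "A [^] (x * \<beta> ^ q) = B [^] y" by simp
  have "A [^] (x * \<beta> ^ q) \<otimes> A = A \<otimes> A [^] (x * \<beta> ^ q)"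
    using int_pow_add[of A "x * \<beta> ^ q" 1] int_pow_add[of A 1 "x * \<beta> ^ q"] by (simp add: add.commute)
  then show ?thesis unfolding e by (rule B_pow_commute_A)
qed

text \<open>The relation for i = 2 reads \<open>C^(a+2) = B^f C^(b+2) A^e\<close>, which places
  \<open>B^f\<close>. Multiplying it by \<open>B\<close> on the right and collecting again places
  the second power: crossing \<open>A^e\<close> with \<open>B\<close> creates \<open>C^e\<close>,
  hence the index e.\<close>

lemma B_pow_in_coset_C:
  fixes a b :: nat
  defines "e \<equiv> \<alpha> ^ (a + 2) - \<alpha> * gsum \<alpha> a" and "f \<equiv> \<beta> ^ (b + 2) - \<beta> * gsum \<beta> b"
  assumes a: "int a = \<alpha>\<^sup>2" and b: "int b = \<beta>\<^sup>2"
  shows "B [^] f \<in> coset_C (int a - int b)"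
    and "B [^] (\<beta> ^ (a + 2) - \<beta> ^ (b + 2)) \<in> coset_C e"
proof -
  have f: "int b * \<beta> ^ b - \<beta> * gsum \<beta> b = f" by (simp add: f_def b power_add power2_eq_square)
  have X: "C [^] (a + 2) = B [^] f \<otimes> (C [^] (b + 2) \<otimes> A [^] e)"
    using C_power_relation[of a 2 b] unfolding f e_def[symmetric] by (simp add: a b)
  have X': "B [^] f \<otimes> C [^] (b + 2) = C [^] (a + 2) \<otimes> A [^] (- e)"
    unfolding X by (simp add: m_assoc int_pow_add)
  then show "B [^] f \<in> coset_C (int a - int b)" by (rule coset_C_I[rotated]) auto
  let ?p = "\<beta> ^ (a + 2)" and ?q = "\<beta> ^ (b + 2)"
  have CB: "C [^] (k::nat) \<otimes> (B \<otimes> t) = B [^] (\<beta> ^ k) \<otimes> (C [^] k \<otimes> t)" if "t \<in> carrier G" for k t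
    using C_B_pow_left[of t k 1] that by simp
  have CB': "C [^] (k::nat) \<otimes> B = B [^] (\<beta> ^ k) \<otimes> C [^] k" for k
    using C_B_pow[of k 1] by simp
  \<comment> \<open>\<open>A_pow_B\<close> needs a natural exponent, so for negative e the relation
    is used with \<open>A^(-e)\<close> on the other side.\<close>
  show "B [^] (?p - ?q) \<in> coset_C e"
  proof (cases e rule: int_cases)
    case (nonneg k)
    have "B [^] ?p \<otimes> C [^] (a + 2) = C [^] (a + 2) \<otimes> B" by (rule CB'[symmetric])
    also have "\<dots> = B [^] f \<otimes> (C [^] (b + 2) \<otimes> (A [^] (int k) \<otimes> B))"
      unfolding X nonneg by (simp add: m_assoc)
    also have "\<dots> = B [^] (f + ?q) \<otimes> (C [^] (b + 2 + k) \<otimes> A [^] (\<alpha> * gsum \<alpha> k))"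
      unfolding A_pow_B by (simp add: CB int_pow_add_left nat_pow_add_left del: add_2_eq_Suc add_2_eq_Suc')
    finally have 1: "B [^] ?p \<otimes> (B [^] f \<otimes> (C [^] (b + 2) \<otimes> A [^] e)) =
       B [^] (f + ?q) \<otimes> (C [^] (b + 2 + k) \<otimes> A [^] (\<alpha> * gsum \<alpha> k))" unfolding X .
    have "B [^] (- f - ?q) \<otimes> (B [^] ?p \<otimes> (B [^] f \<otimes> (C [^] (b + 2) \<otimes> A [^] e))) \<otimes> A [^] (- e) =
      B [^] (?p - ?q) \<otimes> C [^] (b + 2)"
      by (simp add: m_assoc int_pow_add int_pow_add_left del: add_2_eq_Suc add_2_eq_Suc')
    then have "B [^] (?p - ?q) \<otimes> C [^] (b + 2) = C [^] (b + 2 + k) \<otimes> A [^] (\<alpha> * gsum \<alpha> k - e)"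
      unfolding 1 by (simp add: m_assoc int_pow_add int_pow_add_left del: add_2_eq_Suc add_2_eq_Suc')
    moreover have "int (b + 2 + k) - int (b + 2) = e" using nonneg by simp
    ultimately show ?thesis unfolding coset_C_def by blast
  next
    case (neg k')
    define k where "k = Suc k'"
    have e: "- e = int k" using neg by (simp add: k_def)
    have "B [^] ?q \<otimes> (C [^] (a + 2) \<otimes> A [^] (- e)) = B [^] ?q \<otimes> (B [^] f \<otimes> C [^] (b + 2))"
      by (simp only: X')
    also have "\<dots> = B [^] f \<otimes> (C [^] (b + 2) \<otimes> B)"
      unfolding CB' by (simp add: int_pow_add_left add.commute del: add_2_eq_Suc add_2_eq_Suc')
    also have "\<dots> = (C [^] (a + 2) \<otimes> A [^] (- e)) \<otimes> B"
      unfolding X'[symmetric] by (simp add: m_assoc)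
    also have "\<dots> = C [^] (a + 2) \<otimes> (A [^] (int k) \<otimes> B)"
      unfolding e by (simp add: m_assoc)
    also have "\<dots> = B [^] ?p \<otimes> (C [^] (a + 2 + k) \<otimes> A [^] (\<alpha> * gsum \<alpha> k))"
      unfolding A_pow_B by (simp add: CB nat_pow_add_left del: add_2_eq_Suc add_2_eq_Suc')
    finally have 1: "B [^] ?q \<otimes> (C [^] (a + 2) \<otimes> A [^] (- e)) = B [^] ?p \<otimes> (C [^] (a + 2 + k) \<otimes> A [^] (\<alpha> * gsum \<alpha> k))" .
    have "B [^] (- ?q) \<otimes> (B [^] ?q \<otimes> (C [^] (a + 2) \<otimes> A [^] (- e))) \<otimes> A [^] (- (\<alpha> * gsum \<alpha> k)) =
      C [^] (a + 2) \<otimes> A [^] (- e - \<alpha> * gsum \<alpha> k)"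
      by (simp add: m_assoc int_pow_add int_pow_add_left del: add_2_eq_Suc add_2_eq_Suc')
    then have "B [^] (?p - ?q) \<otimes> C [^] (a + 2 + k) = C [^] (a + 2) \<otimes> A [^] (- e - \<alpha> * gsum \<alpha> k)"
      unfolding 1 by (simp add: m_assoc int_pow_add int_pow_add_left del: add_2_eq_Suc add_2_eq_Suc')
    moreover have "int (a + 2) - int (a + 2 + k) = e" using e by simp
    ultimately show ?thesis unfolding coset_C_def by blast
  qed
qed

text \<open>The indices of the cosets are additive. Combining the powers of index a - b and e with
  weights e and -(a - b) gives index 0.\<close>

lemma B_pow_trivial:
  fixes a b :: nat
  defines "e \<equiv> \<alpha> ^ (a + 2) - \<alpha> * gsum \<alpha> a" and "f \<equiv> \<beta> ^ (b + 2) - \<beta> * gsum \<beta> b"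
  assumes a: "int a = \<alpha>\<^sup>2" and b: "int b = \<beta>\<^sup>2"
  shows "B [^] ((f * e - (\<beta> ^ (a + 2) - \<beta> ^ (b + 2)) * (int a - int b)) * (\<beta> - 1)) = \<one>"
proof (rule B_pow_coset_C_0)
  let ?y = "\<beta> ^ (a + 2) - \<beta> ^ (b + 2)"
  have 1: "(B [^] f) [^] e \<in> coset_C ((int a - int b) * e)"
    unfolding e_def f_def by (rule coset_C_pow) (rule B_pow_in_coset_C[OF a b])
  have 2: "(B [^] ?y) [^] (- (int a - int b)) \<in> coset_C (e * (- (int a - int b)))"
    unfolding e_def f_def by (rule coset_C_pow) (rule B_pow_in_coset_C[OF a b])
  have 3: "(int a - int b) * e + e * (- (int a - int b)) = 0" by (simp add: algebra_simps)
  have "(B [^] f) [^] e \<otimes> (B [^] ?y) [^] (- (int a - int b)) = B [^] (f * e - ?y * (int a - int b))"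
    unfolding int_pow_pow[OF B_closed] int_pow_add[OF B_closed] mult_minus_right diff_conv_add_uminus ..
  with coset_C_mult[OF 1 2] show "B [^] (f * e - ?y * (int a - int b)) \<in> coset_C 0"
    unfolding 3 by simp
qed

text \<open>Conjugation by \<open>C^i\<close> fixes \<open>B\<close> and \<open>C\<close> and sends
  \<open>A\<close> to \<open>A^(\<alpha>^i)\<close>. So \<open>A\<close> and
  \<open>A^(\<alpha>^i)\<close> both conjugate \<open>B\<close> to \<open>B C^-1\<close>, and their
  quotient commutes with \<open>B\<close>.\<close>

lemma C_pow_commute_B:
  assumes "C [^] (i::nat) \<otimes> B = B \<otimes> C [^] i"
  shows "A [^] (\<alpha> ^ i - 1) \<otimes> B = B \<otimes> A [^] (\<alpha> ^ i - 1)"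
proof -
  let ?a = "A [^] (\<alpha> ^ i)" and ?g = "A [^] (\<alpha> ^ i - 1)"
  have a: "C [^] i \<otimes> ?a = A \<otimes> C [^] i"
    using A_C_pow[of 1 i] by simp
  have BA: "B \<otimes> A = A \<otimes> (B \<otimes> inv C)"
    using macdonald.A_B[OF swap] by (simp add: swap_C)
  have iC: "inv C \<otimes> C [^] i = C [^] i \<otimes> inv C"
  proof -
    have "C \<otimes> C [^] i = C [^] i \<otimes> C"
      using nat_pow_Suc2[of C i] by simp
    then show ?thesis
      by (metis C_closed inv_closed inv_solve_left' inv_solve_right m_assoc m_closed nat_pow_closed)
  qed
  have "C [^] i \<otimes> (B \<otimes> ?a) = (C [^] i \<otimes> B) \<otimes> ?a" by (simp add: m_assoc)
  also have "\<dots> = B \<otimes> (C [^] i \<otimes> ?a)" unfolding assms by (simp add: m_assoc)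
  also have "\<dots> = (B \<otimes> A) \<otimes> C [^] i" unfolding a by (simp add: m_assoc)
  also have "\<dots> = A \<otimes> (B \<otimes> (inv C \<otimes> C [^] i))" unfolding BA by (simp add: m_assoc)
  also have "\<dots> = A \<otimes> ((B \<otimes> C [^] i) \<otimes> inv C)" unfolding iC by (simp add: m_assoc)
  also have "\<dots> = (A \<otimes> C [^] i) \<otimes> (B \<otimes> inv C)" unfolding assms[symmetric] by (simp add: m_assoc)
  also have "\<dots> = C [^] i \<otimes> (?a \<otimes> (B \<otimes> inv C))" unfolding a[symmetric] by (simp add: m_assoc)
  finally have 1: "B \<otimes> ?a = ?a \<otimes> (B \<otimes> inv C)" by simp
  have gA: "?g \<otimes> A = ?a" using int_pow_add[of A "\<alpha> ^ i - 1" 1] by simp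
  have "(B \<otimes> ?g) \<otimes> A = B \<otimes> (?g \<otimes> A)" by (simp add: m_assoc)
  also have "\<dots> = (?g \<otimes> A) \<otimes> (B \<otimes> inv C)" unfolding gA by (rule 1)
  also have "\<dots> = ?g \<otimes> (B \<otimes> A)" unfolding BA by (simp add: m_assoc)
  also have "\<dots> = (?g \<otimes> B) \<otimes> A" by (simp add: m_assoc)
  finally show ?thesis by simp
qed

lemma C_pow_commute_A:
  assumes "C [^] (i::nat) \<otimes> A = A \<otimes> C [^] i"
  shows "B [^] (\<beta> ^ i - 1) \<otimes> A = A \<otimes> B [^] (\<beta> ^ i - 1)"
proof (rule macdonald.C_pow_commute_B[OF swap])
  have "inv (C [^] i) \<otimes> A = A \<otimes> inv (C [^] i)"
    using assms
    by (metis A_closed C_closed inv_closed inv_solve_left' inv_solve_right m_assoc m_closed nat_pow_closed)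
  then show "macdonald.C G B A [^] i \<otimes> A = A \<otimes> macdonald.C G B A [^] i"
    by (simp add: swap_C nat_pow_inv)
qed

section \<open>Passing finite order between the generators\<close>

lemma int_pow_one_imp_finite:
  assumes "g \<in> carrier G" "g [^] (k::int) = \<one>" "k \<noteq> 0"
  shows "\<exists>m>0. g [^] (m::nat) = \<one>"
  using assms int_pow_eq_id[of g k] pow_ord_eq_1[of g] by (metis dvd_0_left gr0I of_nat_0)

text \<open>Some \<open>C^i\<close> with i > 0 commutes with \<open>B\<close>, so
  \<open>A^((\<alpha>^i - 1)(\<alpha> - 1))\<close> is trivial; |\<alpha>| > 1 keeps this exponent
  away from 0.\<close>

lemma A_finite_if_B_finite:
  assumes "\<bar>\<alpha>\<bar> > 1" "m > 0" "B [^] (m::nat) = \<one>"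
  shows "\<exists>m>0. A [^] (m::nat) = \<one>"
proof -
  \<comment> \<open>Pigeonhole for the powers of \<beta> modulo m. As \<beta> need not be a unit
    modulo m, one gets two equal powers rather than a power equal to 1; the common part
    \<open>C^k\<close> is cancelled in the group instead.\<close>
  have "\<not> inj (\<lambda>k::nat. \<beta> ^ k mod int m)"
  proof
    assume "inj (\<lambda>k::nat. \<beta> ^ k mod int m)"
    moreover have "range (\<lambda>k::nat. \<beta> ^ k mod int m) \<subseteq> {0..<int m}"
      using assms(2) by auto
    ultimately show False
      using finite_imageD finite_subset infinite_UNIV_nat by blast
  qed
  then obtain k0 l0 :: nat where kl0: "k0 \<noteq> l0" "\<beta> ^ k0 mod int m = \<beta> ^ l0 mod int m"
    by (auto simp: inj_def)
  obtain k l :: nat where kl: "k < l" "\<beta> ^ k mod int m = \<beta> ^ l mod int m"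
    using kl0 by (metis linorder_neqE_nat)
  define i where "i = l - k"
  have l: "l = k + i" and i: "i > 0" using kl by (auto simp: i_def)
  have "int (ord B) dvd int m"
    using assms(3) pow_eq_id[of B m] by simp
  moreover have "int m dvd \<beta> ^ l - \<beta> ^ k" using kl(2) by (metis mod_eq_dvd_iff)
  ultimately have "B [^] (\<beta> ^ l) = B [^] (\<beta> ^ k)"
    using int_pow_eq[of B "\<beta> ^ l" "\<beta> ^ k"] dvd_trans by (metis B_closed dvd_diff_commute)
  then have "C [^] l \<otimes> B = (C [^] k \<otimes> B) \<otimes> C [^] i"
    using C_B_pow[of l 1] C_B_pow[of k 1] by (simp add: l m_assoc nat_pow_mult)
  then have "C [^] k \<otimes> (C [^] i \<otimes> B) = C [^] k \<otimes> (B \<otimes> C [^] i)"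
    unfolding l by (simp add: nat_pow_mult[symmetric] m_assoc)
  then have "C [^] i \<otimes> B = B \<otimes> C [^] i" by simp
  then have "A [^] ((\<alpha> ^ i - 1) * (\<alpha> - 1)) = \<one>"
    by (intro A_pow_commute_B C_pow_commute_B)
  moreover have "\<alpha> ^ i \<noteq> 1"
    using assms(1) i by (metis abs_1 less_irrefl one_less_power power_abs)
  ultimately show ?thesis using assms(1) by (intro int_pow_one_imp_finite) auto
qed

text \<open>If \<open>A^m\<close> is trivial, crossing it with \<open>B\<close> shows that
  \<open>C^m\<close> is a power of \<open>A\<close>, whose m-th power is trivial.\<close>

lemma C_finite_if_A_finite:
  assumes "m > 0" "A [^] (m::nat) = \<one>"
  shows "\<exists>m>0. C [^] (m::nat) = \<one>"
proof -
  have m: "A [^] int m = \<one>" using assms by (simp add: int_pow_int)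
  have "B \<otimes> (C [^] m \<otimes> A [^] (\<alpha> * gsum \<alpha> m)) = B"
    using A_pow_B[of m] by (simp add: m)
  then have "C [^] m \<otimes> A [^] (\<alpha> * gsum \<alpha> m) = \<one>" by simp
  then have "C [^] m = A [^] (- (\<alpha> * gsum \<alpha> m))"
    by (metis A_closed C_closed int_pow_closed int_pow_neg inv_equality nat_pow_closed inv_inv inv_closed)
  then have "C [^] (m * m) = (A [^] (- (\<alpha> * gsum \<alpha> m))) [^] int m"
    by (simp add: nat_pow_pow[symmetric] int_pow_int)
  also have "\<dots> = (A [^] int m) [^] (- (\<alpha> * gsum \<alpha> m))"
    unfolding int_pow_pow[OF A_closed] by (simp add: mult.commute)
  finally show ?thesis using assms(1) by (auto simp: m intro: exI[of _ "m * m"])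
qed

text \<open>For \<open>\<alpha> = -1\<close> the exponent \<open>\<alpha>\<^sup>i - 1\<close> may vanish, so this case needs its own argument.\<close>

lemma finite_if_alpha_minus_one:
  assumes "\<alpha> = - 1" "\<bar>\<beta>\<bar> > 1"
  shows "A [^] (4::nat) = \<one>" "\<exists>m>0. B [^] (m::nat) = \<one>"
proof -
  let ?w = "B [^] (\<beta>\<^sup>2 - 1)" and ?c = "C [^] (2::nat)"
  have "C [^] (2::nat) \<otimes> A = A \<otimes> C [^] (2::nat)"
    using A_C_pow[of 1 2] by (simp add: assms)
  then have wA: "?w \<otimes> A = A \<otimes> ?w" by (rule C_pow_commute_A)
  then have w1: "B [^] ((\<beta>\<^sup>2 - 1) * (\<beta> - 1)) = \<one>" by (rule B_pow_commute_A)
  have "\<beta>\<^sup>2 \<noteq> 1" using assms(2) by (metis abs_1 less_irrefl one_less_power power_abs zero_less_numeral)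
  then show "\<exists>m>0. B [^] (m::nat) = \<one>"
    using w1 assms(2) by (intro int_pow_one_imp_finite) auto
  have wB: "?w \<otimes> B = B \<otimes> ?w"
    using int_pow_add[of B "\<beta>\<^sup>2 - 1" 1] int_pow_add[of B 1 "\<beta>\<^sup>2 - 1"] by (simp add: add.commute)
  have wC: "?w \<otimes> C = C \<otimes> ?w" using wA wB by (intro commute_C) auto
  have a2: "A [^] (2::int) \<otimes> B = B \<otimes> ?c"
    using A_pow_B[of 2] by (simp add: assms numeral_2_eq_2 gsum_Suc)
  have wc: "?w \<otimes> ?c = ?c \<otimes> ?w"
  proof -
    have "?w \<otimes> C [^] (2::int) = C [^] (2::int) \<otimes> ?w"
      using wC by (intro int_pow_commute_gen) auto
    then show ?thesis using int_pow_int[of G C 2] by simp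
  qed
  have "?c \<otimes> B = B [^] (1 + (\<beta>\<^sup>2 - 1)) \<otimes> ?c" using C_B_pow[of 2 1] by simp
  also have "\<dots> = B \<otimes> (?w \<otimes> ?c)" using int_pow_add_left[of B ?c 1 "\<beta>\<^sup>2 - 1"] by simp
  also have "\<dots> = (B \<otimes> ?c) \<otimes> ?w" unfolding wc by (simp add: m_assoc)
  also have "\<dots> = (A [^] (2::int) \<otimes> ?w) \<otimes> B" unfolding a2[symmetric] using wB by (simp add: m_assoc)
  finally have c: "?c = A [^] (2::int) \<otimes> ?w" by simp
  \<comment> \<open>\<open>C\<close> commutes with \<open>?c\<close>, the product of
    \<open>A^2\<close> and \<open>?w\<close>, and with \<open>?w\<close>, hence with
    \<open>A^2\<close>. But it also inverts \<open>A^2\<close>.\<close>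
  have "(C \<otimes> A [^] (2::int)) \<otimes> ?w = C \<otimes> ?c" unfolding c by (simp add: m_assoc)
  also have "\<dots> = ?c \<otimes> C" by (simp add: numeral_2_eq_2 m_assoc)
  also have "\<dots> = (A [^] (2::int) \<otimes> C) \<otimes> ?w" unfolding c using wC by (simp add: m_assoc)
  also have "A [^] (2::int) \<otimes> C = C \<otimes> A [^] (-2::int)"
    using A_C_pow[of 2 1] by (simp add: assms)
  finally have "A [^] (2::int) = A [^] (-2::int)" by simp
  then have "A [^] (2::int) \<otimes> A [^] (2::int) = A [^] (2::int) \<otimes> A [^] (-2::int)" by simp
  then have "A [^] (4::int) = \<one>" by (simp add: int_pow_add)
  then show "A [^] (4::nat) = \<one>" using int_pow_int[of G A 4] by simp
qed

lemma finite_orders: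
  assumes "odd \<alpha>" "odd \<beta>" "\<alpha> \<noteq> 1" "\<bar>\<beta>\<bar> > 1"
  shows "\<exists>m>0. A [^] (m::nat) = \<one>" "\<exists>m>0. B [^] (m::nat) = \<one>" "\<exists>m>0. C [^] (m::nat) = \<one>"
proof -
  have "(\<exists>m>0. A [^] (m::nat) = \<one>) \<and> (\<exists>m>0. B [^] (m::nat) = \<one>)"
  proof (cases "\<alpha> = - 1")
    case True
    then show ?thesis using finite_if_alpha_minus_one assms(4)
      by (auto intro: exI[of _ "4::nat"])
  next
    case False
    then have al: "\<bar>\<alpha>\<bar> > 1" using assms(1,3) by (auto simp: abs_if split: if_splits) presburger+
    \<comment> \<open>With i = 1 these exponents could be negative; squares turn into natural
      numbers without loss.\<close>
    define a b where "a = nat (\<alpha>\<^sup>2)" and "b = nat (\<beta>\<^sup>2)"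
    have ab: "int a = \<alpha>\<^sup>2" "int b = \<beta>\<^sup>2" by (simp_all add: a_def b_def)
    then have pos: "a > 0" "b > 0" using al assms(4) by (auto simp: a_def b_def)
    define e f where "e = \<alpha> ^ (a + 2) - \<alpha> * gsum \<alpha> a" and "f = \<beta> ^ (b + 2) - \<beta> * gsum \<beta> b"
    have ef: "e \<noteq> 0" "f \<noteq> 0"
      unfolding e_def f_def using al assms(4) pos by (intro pow_minus_gsum_nonzero; simp)+
    consider "f * e - (\<beta> ^ (a + 2) - \<beta> ^ (b + 2)) * (int a - int b) \<noteq> 0" |
       "e * f - (\<alpha> ^ (b + 2) - \<alpha> ^ (a + 2)) * (int b - int a) \<noteq> 0"
      using exponents_not_both_zero[OF assms(1,2) al assms(4) ab ef] by blast
    then show ?thesis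
    proof cases
      case 1
      have "\<exists>m>0. B [^] (m::nat) = \<one>"
        using B_pow_trivial[OF ab] 1 assms(4) unfolding e_def f_def
        by (intro int_pow_one_imp_finite) auto
      then show ?thesis using A_finite_if_B_finite[OF al] by blast
    next
      case 2
      have "\<exists>m>0. A [^] (m::nat) = \<one>"
        using macdonald.B_pow_trivial[OF swap ab(2,1)] 2 al unfolding e_def f_def
        by (intro int_pow_one_imp_finite) auto
      then show ?thesis using macdonald.A_finite_if_B_finite[OF swap assms(4)] by blast
    qed
  qed
  then show "\<exists>m>0. A [^] (m::nat) = \<one>" "\<exists>m>0. B [^] (m::nat) = \<one>" "\<exists>m>0. C [^] (m::nat) = \<one>"
    using C_finite_if_A_finite by blast+
qed

end

section \<open>The normal 2-complement\<close>

lemma gsum_add: "gsum q (i + j) = gsum q i + q ^ i * gsum q j"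
  by (induction j) (simp_all add: gsum_Suc algebra_simps power_add)

text \<open>Halving k = 2j gives \<open>gsum q k = gsum q j\<close> times 1 + q^j, and the second
  factor is even for odd q.\<close>

lemma two_power_dvd_gsum:
  assumes "odd q" "2 ^ s dvd k"
  shows "2 ^ s dvd gsum q k"
  using assms(2)
proof (induction s arbitrary: k)
  case (Suc s)
  then obtain j where j: "k = j + j" "2 ^ s dvd j"
    by (auto elim!: dvdE simp: mult_2[symmetric])
  have "gsum q k = gsum q j * (1 + q ^ j)"
    by (simp add: j(1) gsum_add algebra_simps)
  moreover have "2 dvd 1 + q ^ j" using assms(1) by simp
  ultimately show ?case using mult_dvd_mono[OF Suc.IH[OF j(2)]] by (metis mult.commute power_Suc)
qed simp

lemma two_power_dvd_power_minus_one:
  "odd q \<Longrightarrow> 2 ^ s dvd k \<Longrightarrow> 2 ^ s dvd q ^ k - (1::int)"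
  by (metis dvd_mult gsum_mult two_power_dvd_gsum)

section \<open>Product sets and normality from generators\<close>

context group
begin

text \<open>The product formula: every fibre of multiplication on \<open>H \<times> K\<close> has as
  many elements as \<open>H \<inter> K\<close>. The product set is not assumed to be a
  subgroup.\<close>

lemma card_set_mult_dvd:
  assumes "subgroup H G" "subgroup K G" "finite H" "finite K"
  shows "card (H <#> K) dvd card H * card K"
proof -
  have Hc: "x \<in> carrier G" if "x \<in> H" for x using that subgroup.mem_carrier[OF assms(1)] by blast
  have Kc: "x \<in> carrier G" if "x \<in> K" for x using that subgroup.mem_carrier[OF assms(2)] by blast
  note cl = subgroup.m_closed[OF assms(1)] subgroup.m_closed[OF assms(2)]
    subgroup.m_inv_closed[OF assms(1)] subgroup.m_inv_closed[OF assms(2)]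
  let ?f = "\<lambda>(h, k). h \<otimes> k"
  have HK: "H <#> K = ?f ` (H \<times> K)" by (auto simp: set_mult_def)
  have fin: "finite (H \<times> K)" using assms by simp
  have fibre: "card {p \<in> H \<times> K. ?f p = g} = card (H \<inter> K)" if g: "g \<in> H <#> K" for g
  proof -
    obtain h k where hk: "h \<in> H" "k \<in> K" "g = h \<otimes> k"
      using g unfolding HK by auto
    have hkc: "h \<in> carrier G" "k \<in> carrier G" using hk Hc Kc by auto
    \<comment> \<open>The intersection acts simply transitively on a fibre, by moving d from one
      factor to the other.\<close>
    have "bij_betw (\<lambda>d. (h \<otimes> d, inv d \<otimes> k)) (H \<inter> K) {p \<in> H \<times> K. ?f p = g}"
    proof (intro bij_betwI[where g = "\<lambda>p. inv h \<otimes> fst p"] funcsetI)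
      fix d assume d: "d \<in> H \<inter> K"
      then have dc: "d \<in> carrier G" using Hc by blast
      have "h \<otimes> d \<otimes> (inv d \<otimes> k) = h \<otimes> (d \<otimes> inv d) \<otimes> k"
        using dc hkc by (simp only: m_assoc m_closed inv_closed)
      then show "(h \<otimes> d, inv d \<otimes> k) \<in> {p \<in> H \<times> K. ?f p = g}"
        using d dc hk hkc by (simp add: cl)
      have "inv h \<otimes> (h \<otimes> d) = (inv h \<otimes> h) \<otimes> d"
        using dc hkc by (simp only: m_assoc m_closed inv_closed)
      then show "inv h \<otimes> fst (h \<otimes> d, inv d \<otimes> k) = d"
        using dc hkc by simp
    next
      fix p assume "p \<in> {p \<in> H \<times> K. ?f p = g}"
      then obtain h' k' where p: "p = (h', k')" "h' \<in> H" "k' \<in> K" "h' \<otimes> k' = h \<otimes> k"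
        using hk by auto
      have pc: "h' \<in> carrier G" "k' \<in> carrier G" using p Hc Kc by auto
      have 1: "(inv h \<otimes> h') \<otimes> k' = k"
        using inv_solve_left'[of k h "h' \<otimes> k'"] p(4) pc hkc by (simp add: m_assoc)
      then have 2: "inv h \<otimes> h' = k \<otimes> inv k'"
        using inv_solve_right[of "inv h \<otimes> h'" k k'] pc hkc by simp
      have "inv h \<otimes> h' \<in> H" using hk p by (simp add: cl)
      moreover have "inv h \<otimes> h' \<in> K" unfolding 2 using hk p by (simp add: cl)
      ultimately show "inv h \<otimes> fst p \<in> H \<inter> K" using p by simp
      have "inv (inv h \<otimes> h') \<otimes> k = k'"
        using inv_solve_left'[of k' "inv h \<otimes> h'" k] 1 pc hkc by simp
      moreover have "h \<otimes> (inv h \<otimes> h') = h'"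
        using inv_solve_left[of "inv h \<otimes> h'" h h'] pc hkc by simp
      ultimately show "(h \<otimes> (inv h \<otimes> fst p), inv (inv h \<otimes> fst p) \<otimes> k) = p"
        using p by simp
    qed
    then show ?thesis by (simp add: bij_betw_same_card)
  qed
  have "card (H \<times> K) = (\<Sum>g\<in>H <#> K. card {p \<in> H \<times> K. ?f p = g})"
    unfolding HK card_eq_sum by (rule sum.image_gen[OF fin])
  then show ?thesis by (simp add: fibre card_cartesian_product)
qed

text \<open>An injective self-map of a finite set is onto, so stability under conjugation in one
  direction gives the other.\<close>

lemma conj_closed_if_finite:
  assumes "finite K" "K \<subseteq> carrier G" "x \<in> carrier G" and *: "\<And>h. h \<in> K \<Longrightarrow> inv x \<otimes> h \<otimes> x \<in> K"
    and "h \<in> K"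
  shows "x \<otimes> h \<otimes> inv x \<in> K"
proof -
  have "inj_on (\<lambda>h. inv x \<otimes> h \<otimes> x) K"
    using assms(2,3) by (auto intro!: inj_onI simp: subset_iff)
  then have "(\<lambda>h. inv x \<otimes> h \<otimes> x) ` K = K"
    using assms(1) * by (intro endo_inj_surj) auto
  then obtain k where k: "k \<in> K" "h = inv x \<otimes> k \<otimes> x" using assms(5) by blast
  have kc: "k \<in> carrier G" using k(1) assms(2) by blast
  have "x \<otimes> h \<otimes> inv x = (x \<otimes> inv x) \<otimes> k \<otimes> (x \<otimes> inv x)"
    unfolding k(2) using kc assms(3) by (simp only: m_assoc m_closed inv_closed)
  then show ?thesis using k(1) kc assms(3) by simp
qed

lemma normal_if_generators_normalize:
  assumes K: "subgroup K G" "finite K" and S: "S \<subseteq> carrier G" "carrier G = generate G S"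
    and *: "\<And>x h. \<lbrakk>x \<in> S; h \<in> K\<rbrakk> \<Longrightarrow> inv x \<otimes> h \<otimes> x \<in> K"
  shows "K \<lhd> G"
proof -
  interpret K: subgroup K G by (rule K)
  have "\<forall>h\<in>K. x \<otimes> h \<otimes> inv x \<in> K" if "x \<in> generate G S" for x
    using that
  proof (induction rule: generate.induct)
    case (incl x)
    then show ?case using conj_closed_if_finite[OF K(2) K.subset _ *] S(1) by blast
  next
    case (inv x)
    then show ?case using * S(1) by auto
  next
    case (eng x y)
    have c: "x \<in> carrier G" "y \<in> carrier G" using eng S by auto
    show ?case
    proof
      fix h assume h: "h \<in> K"
      have "x \<otimes> y \<otimes> h \<otimes> inv (x \<otimes> y) = x \<otimes> (y \<otimes> h \<otimes> inv y) \<otimes> inv x"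
        using c h by (simp add: m_assoc inv_mult_group)
      then show "x \<otimes> y \<otimes> h \<otimes> inv (x \<otimes> y) \<in> K" using eng h by auto
    qed
  qed auto
  then show ?thesis using K(1) S by (auto intro: normal_invI)
qed

end

lemma macdonald_hom:
  assumes "macdonald G A B \<alpha> \<beta>" "group H" "h \<in> hom G H"
  shows "macdonald H (h A) (h B) \<alpha> \<beta>" "macdonald.C H (h A) (h B) = h (macdonald.C G A B)"
proof -
  interpret M: macdonald G A B \<alpha> \<beta> by fact
  interpret H: group H by fact
  interpret h: group_hom G H h using assms by unfold_locales
  have c: "gcomm H (h x) (h y) = h (gcomm G x y)" if "x \<in> carrier G" "y \<in> carrier G" for x y
    using that by (simp add: gcomm_def)
  have cl: "gcomm G x y \<in> carrier G" if "x \<in> carrier G" "y \<in> carrier G" for x y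
    using that by (simp add: gcomm_def)
  show "macdonald H (h A) (h B) \<alpha> \<beta>"
  proof
    show "inv\<^bsub>H\<^esub> gcomm H (h A) (h B) \<otimes>\<^bsub>H\<^esub> h A \<otimes>\<^bsub>H\<^esub> gcomm H (h A) (h B) = h A [^]\<^bsub>H\<^esub> \<alpha>"
      using arg_cong[OF M.rel_A, of h] by (simp add: c cl h.hom_int_pow)
    show "inv\<^bsub>H\<^esub> gcomm H (h B) (h A) \<otimes>\<^bsub>H\<^esub> h B \<otimes>\<^bsub>H\<^esub> gcomm H (h B) (h A) = h B [^]\<^bsub>H\<^esub> \<beta>"
      using arg_cong[OF M.rel_B, of h] by (simp add: c cl h.hom_int_pow)
  qed auto
  then show "macdonald.C H (h A) (h B) = h (macdonald.C G A B)"
    by (simp add: macdonald.C_def[of H] M.C_def c)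
qed

text \<open>Parity and torsion are the only arithmetic assumptions, so the locale passes to
  quotients; \<open>normal_2_complement\<close> applies it to one.\<close>

locale macdonald_finite = macdonald +
  assumes odd_alpha: "odd \<alpha>" and odd_beta: "odd \<beta>"
    and finite_A: "\<exists>m>0. A [^] (m::nat) = \<one>"
    and finite_B: "\<exists>m>0. B [^] (m::nat) = \<one>"
    and finite_C: "\<exists>m>0. C [^] (m::nat) = \<one>"
    and generated: "carrier G = generate G {A, B}"
begin

definition K :: "nat \<Rightarrow> 'a set" where
  "K s = {B [^] x \<otimes> (C [^] y \<otimes> A [^] z) | (x::int) (y::nat) (z::int).
     2 ^ s dvd x \<and> 2 ^ s dvd y \<and> 2 ^ s dvd z}"

text \<open>Torsion allows negative exponents to be replaced by natural ones, and this can be done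
  without losing divisibility by 2^s.\<close>

lemma nat_exponent:
  assumes "g \<in> carrier G" "\<exists>m>0. g [^] (m::nat) = \<one>" "2 ^ s dvd (z::int)"
  obtains k :: nat where "2 ^ s dvd k" "g [^] z = g [^] int k"
proof -
  obtain m :: nat where m: "m > 0" "g [^] m = \<one>" using assms(2) by blast
  \<comment> \<open>Reduction modulo m alone would keep the power but destroy divisibility by 2^s;
    the modulus 2^s m keeps both.\<close>
  define k where "k = nat (z mod (2 ^ s * int m))"
  have k: "int k = z mod (2 ^ s * int m)" using m(1) by (simp add: k_def)
  have "2 ^ s dvd int k" unfolding k using assms(3) by (simp add: dvd_mod)
  then have "int (2 ^ s) dvd int k" by simp
  then have "2 ^ s dvd k" by (simp only: int_dvd_int_iff)
  moreover have "g [^] z = g [^] int k"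
  proof -
    have "int (ord g) dvd int m" using m assms(1) pow_eq_id[of g m] by simp
    also have "int m dvd z - int k" unfolding k
      by (metis dvd_mult_right dvd_triv_right mod_eq_dvd_iff mod_mod_trivial dvd_trans)
    finally show ?thesis using int_pow_eq[OF assms(1), of z "int k"] by (metis dvd_diff_commute)
  qed
  ultimately show ?thesis using that by blast
qed

lemma K_I: "\<lbrakk>2 ^ s dvd (x::int); 2 ^ s dvd (y::nat); 2 ^ s dvd (z::int)\<rbrakk> \<Longrightarrow>
    B [^] x \<otimes> (C [^] y \<otimes> A [^] z) \<in> K s"
  unfolding K_def by blast

lemma K_carrier: "K s \<subseteq> carrier G"
  by (auto simp: K_def)

lemma K_closed [simp]: "g \<in> K s \<Longrightarrow> g \<in> carrier G"
  using K_carrier by blast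

lemma K_mult_A:
  assumes "g \<in> K s" "2 ^ s dvd (w::int)"
  shows "g \<otimes> A [^] w \<in> K s"
proof -
  obtain x z :: int and y :: nat where g: "g = B [^] x \<otimes> (C [^] y \<otimes> A [^] z)" "2 ^ s dvd x" "2 ^ s dvd y" "2 ^ s dvd z"
    using assms(1) by (auto simp: K_def)
  have "g \<otimes> A [^] w = B [^] x \<otimes> (C [^] y \<otimes> A [^] (z + w))"
    unfolding g(1) by (simp add: collect)
  then show ?thesis using g assms(2) by (simp add: K_I)
qed

lemma K_mult_C:
  assumes "g \<in> K s" "2 ^ s dvd (w::nat)"
  shows "g \<otimes> C [^] w \<in> K s"
proof -
  obtain x z :: int and y :: nat where g: "g = B [^] x \<otimes> (C [^] y \<otimes> A [^] z)" "2 ^ s dvd x" "2 ^ s dvd y" "2 ^ s dvd z"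
    using assms(1) by (auto simp: K_def)
  have "g \<otimes> C [^] w = B [^] x \<otimes> (C [^] (y + w) \<otimes> A [^] (z * \<alpha> ^ w))"
    unfolding g(1) by (simp add: collect)
  then show ?thesis using g assms(2) by (simp add: K_I)
qed

lemma B_mult_K:
  assumes "g \<in> K s" "2 ^ s dvd (w::int)"
  shows "B [^] w \<otimes> g \<in> K s"
proof -
  obtain x z :: int and y :: nat where g: "g = B [^] x \<otimes> (C [^] y \<otimes> A [^] z)" "2 ^ s dvd x" "2 ^ s dvd y" "2 ^ s dvd z"
    using assms(1) by (auto simp: K_def)
  have "B [^] w \<otimes> g = B [^] (w + x) \<otimes> (C [^] y \<otimes> A [^] z)"
    unfolding g(1) by (simp add: collect)
  then show ?thesis using g assms(2) by (simp add: K_I)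
qed

text \<open>Pulling \<open>B\<close> to the front changes the exponent of \<open>B\<close> by
  \<beta>^y - 1 and adds \<open>z\<close> to that of \<open>C\<close>; that of \<open>A\<close>
  becomes \<alpha> \<open>gsum \<alpha> z\<close>. For odd \<alpha> and \<beta> all of these remain
  divisible by 2^s.\<close>

lemma K_conj_B:
  assumes "g \<in> K s"
  shows "\<exists>h\<in>K s. g \<otimes> B = B \<otimes> h"
proof -
  obtain x z' :: int and y :: nat where g: "g = B [^] x \<otimes> (C [^] y \<otimes> A [^] z')" "2 ^ s dvd x" "2 ^ s dvd y" "2 ^ s dvd z'"
    using assms(1) by (auto simp: K_def)
  obtain z where z: "2 ^ s dvd z" "A [^] z' = A [^] int z"
    using nat_exponent[OF A_closed finite_A g(4)] by blast
  have CB: "C [^] y \<otimes> (B \<otimes> t) = B [^] (\<beta> ^ y) \<otimes> (C [^] y \<otimes> t)" if "t \<in> carrier G" for t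
    using C_B_pow_left[of t y 1] that by simp
  let ?h = "B [^] (x + (\<beta> ^ y - 1)) \<otimes> (C [^] (y + z) \<otimes> A [^] (\<alpha> * gsum \<alpha> z))"
  have "g \<otimes> B = B [^] (x + \<beta> ^ y) \<otimes> (C [^] (y + z) \<otimes> A [^] (\<alpha> * gsum \<alpha> z))"
    unfolding g(1) z(2) by (simp add: m_assoc A_pow_B CB int_pow_add_left nat_pow_add_left)
  also have "\<dots> = B \<otimes> ?h"
    using int_pow_add_left[of B "C [^] (y + z) \<otimes> A [^] (\<alpha> * gsum \<alpha> z)" 1 "x + (\<beta> ^ y - 1)"] by simp
  finally have "g \<otimes> B = B \<otimes> ?h" .
  moreover have "?h \<in> K s"
    using g(2,3) z(1) two_power_dvd_gsum[OF odd_alpha z(1)] two_power_dvd_power_minus_one[OF odd_beta g(3)]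
    by (intro K_I) auto
  ultimately show ?thesis by blast
qed

lemma K_mult_B:
  assumes "g \<in> K s" "2 ^ s dvd (w::int)"
  shows "g \<otimes> B [^] w \<in> K s"
proof -
  obtain k where k: "2 ^ s dvd k" "B [^] w = B [^] int k"
    using nat_exponent[OF B_closed finite_B assms(2)] by blast
  have "\<exists>h\<in>K s. g \<otimes> B [^] j = B [^] j \<otimes> h" for j :: nat
  proof (induction j)
    case 0
    then show ?case using assms(1) by (intro bexI[of _ g]) auto
  next
    case (Suc j)
    then obtain h where h: "h \<in> K s" "g \<otimes> B [^] j = B [^] j \<otimes> h" by blast
    obtain h' where h': "h' \<in> K s" "h \<otimes> B = B \<otimes> h'" using K_conj_B[OF h(1)] by blast
    have c: "g \<in> carrier G" "h \<in> carrier G" "h' \<in> carrier G" using assms(1) h(1) h'(1) K_carrier by auto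
    have "g \<otimes> B [^] Suc j = (g \<otimes> B [^] j) \<otimes> B" using c by (simp add: m_assoc)
    also have "\<dots> = B [^] j \<otimes> (h \<otimes> B)" unfolding h(2) using c by (simp add: m_assoc)
    also have "\<dots> = B [^] Suc j \<otimes> h'" unfolding h'(2) using c by (simp add: m_assoc)
    finally show ?case using h'(1) by blast
  qed
  then obtain h where h: "h \<in> K s" "g \<otimes> B [^] int k = B [^] int k \<otimes> h" by (auto simp: int_pow_int)
  have "2 ^ s dvd int k" using k(1) by (metis int_dvd_int_iff of_nat_numeral of_nat_power)
  then show ?thesis unfolding k(2) h(2) by (intro B_mult_K h(1))
qed

lemma K_conj_A:
  assumes "g \<in> K s"
  shows "\<exists>h\<in>K s. g \<otimes> A = A \<otimes> h"
proof -
  obtain x' z :: int and y :: nat where g: "g = B [^] x' \<otimes> (C [^] y \<otimes> A [^] z)" "2 ^ s dvd x'" "2 ^ s dvd y" "2 ^ s dvd z"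
    using assms(1) by (auto simp: K_def)
  obtain x where x: "2 ^ s dvd x" "B [^] x' = B [^] int x"
    using nat_exponent[OF B_closed finite_B g(2)] by blast
  have x2: "2 ^ s dvd - int x" using x(1) by (metis dvd_minus_iff int_dvd_int_iff of_nat_numeral of_nat_power)
  obtain v where v: "2 ^ s dvd v" "C [^] (- int x) = C [^] int v"
    using nat_exponent[OF C_closed finite_C x2] by blast
  have iC: "inv C [^] x = C [^] v"
    using v(2) by (simp add: int_pow_neg_int nat_pow_inv int_pow_int)
  \<comment> \<open>A single \<open>A\<close> moved in front of \<open>C^y\<close> accounts for
    \<alpha>^y of the exponent z + 1; the remainder is 1 - \<alpha>^y + z, still divisible by
    2^s.\<close>
  have CA: "C [^] y \<otimes> A [^] (z + 1) = A \<otimes> (C [^] y \<otimes> A [^] (1 - \<alpha> ^ y + z))"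
    using A_C_pow_left[of "A [^] (1 - \<alpha> ^ y + z)" 1 y] by (simp add: int_pow_add add.commute)
  let ?h = "B [^] (\<beta> * gsum \<beta> x * \<beta> ^ v) \<otimes> (C [^] (v + y) \<otimes> A [^] (1 - \<alpha> ^ y + z))"
  have "g \<otimes> A = B [^] int x \<otimes> (C [^] y \<otimes> A [^] (z + 1))"
    unfolding g(1) x(2) using int_pow_add[of A z 1] by (simp add: m_assoc)
  also have "\<dots> = (B [^] int x \<otimes> A) \<otimes> (C [^] y \<otimes> A [^] (1 - \<alpha> ^ y + z))"
    unfolding CA by (simp add: m_assoc)
  also have "\<dots> = A \<otimes> ?h"
    unfolding B_pow_A iC by (simp add: collect)
  finally have "g \<otimes> A = A \<otimes> ?h" .
  moreover have "?h \<in> K s"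
    using g(3,4) v(1) two_power_dvd_gsum[OF odd_beta x(1)] two_power_dvd_power_minus_one[OF odd_alpha g(3)]
    by (intro K_I) (auto simp: dvd_diff_commute)
  ultimately show ?thesis by blast
qed

lemma one_K: "\<one> \<in> K s"
  using K_I[of s 0 0 0] by simp

lemma K_mult:
  assumes "g \<in> K s" "h \<in> K s"
  shows "g \<otimes> h \<in> K s"
proof -
  obtain x z :: int and y :: nat where h: "h = B [^] x \<otimes> (C [^] y \<otimes> A [^] z)" "2 ^ s dvd x" "2 ^ s dvd y" "2 ^ s dvd z"
    using assms(2) by (auto simp: K_def)
  have "g \<otimes> h = g \<otimes> B [^] x \<otimes> C [^] y \<otimes> A [^] z"
    using assms(1) unfolding h(1) by (simp add: m_assoc)
  then show ?thesis using assms(1) h by (simp add: K_mult_A K_mult_B K_mult_C)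
qed

lemma K_inv:
  assumes "g \<in> K s"
  shows "inv g \<in> K s"
proof -
  obtain x z :: int and y :: nat where g: "g = B [^] x \<otimes> (C [^] y \<otimes> A [^] z)" "2 ^ s dvd x" "2 ^ s dvd y" "2 ^ s dvd z"
    using assms by (auto simp: K_def)
  have y2: "2 ^ s dvd - int y" using g(3) by (metis dvd_minus_iff int_dvd_int_iff of_nat_numeral of_nat_power)
  obtain v where v: "2 ^ s dvd v" "C [^] (- int y) = C [^] int v"
    using nat_exponent[OF C_closed finite_C y2] by blast
  have iC: "inv (C [^] y) = C [^] v"
    using v(2) by (simp add: int_pow_neg_int int_pow_int)
  have "inv g = \<one> \<otimes> A [^] (- z) \<otimes> C [^] v \<otimes> B [^] (- x)"
    unfolding g(1) by (simp add: inv_mult_group iC int_pow_neg)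
  then show ?thesis
    using g v(1) K_mult_B[OF K_mult_C[OF K_mult_A[OF one_K, of s "- z"], of v], of "- x"] by simp
qed

lemma K_subgroup: "subgroup (K s) G"
  using K_carrier one_K by (intro subgroupI) (auto simp: K_mult K_inv)

lemma powers_subgroup:
  assumes "g \<in> carrier G"
  shows "generate G {g [^] (2 ^ s :: nat)} = {g [^] x | x::int. 2 ^ s dvd x}"
proof -
  have "(g [^] (2 ^ s :: nat)) [^] (k::int) = g [^] (2 ^ s * k)" for k
    using assms int_pow_pow[of g "2 ^ s" k] int_pow_int[of G g "2 ^ s"] by simp
  then show ?thesis using generate_pow[of "g [^] (2 ^ s :: nat)"] assms by (auto simp: dvd_def)
qed

lemma finite_generate_power:
  assumes "g \<in> carrier G" "\<exists>m>0. g [^] (m::nat) = \<one>"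
  shows "finite (generate G {g [^] (k::nat)})"
proof -
  have "ord (g [^] k) \<noteq> 0"
    using assms pow_eq_id[of "g [^] k"] by (metis nat_pow_closed nat_pow_one nat_pow_pow nat_pow_comm mult.commute dvd_0_left not_gr0 ord_eq_0)
  then show ?thesis
    using generate_pow_card[of "g [^] k"] assms(1) by (metis card.infinite nat_pow_closed)
qed

text \<open>\<open>K s\<close> is the product of the cyclic groups generated by the 2^s-th powers of
  \<open>B\<close>, \<open>C\<close> and \<open>A\<close>. The product formula is applied twice,
  which requires the product of the last two factors to be a subgroup; it is one because
  \<alpha>-powers let \<open>A\<close> pass \<open>C\<close>.\<close>

lemma K_finite: "finite (K s)"
  and card_K_dvd: "card (K s) dvd ord (B [^] (2 ^ s :: nat)) * (ord (C [^] (2 ^ s :: nat)) * ord (A [^] (2 ^ s :: nat)))"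
proof -
  let ?A = "generate G {A [^] (2 ^ s :: nat)}" and ?B = "generate G {B [^] (2 ^ s :: nat)}"
    and ?C = "generate G {C [^] (2 ^ s :: nat)}"
  have sub: "subgroup ?A G" "subgroup ?B G" "subgroup ?C G"
    by (auto intro!: generate_is_subgroup)
  have fin: "finite ?A" "finite ?B" "finite ?C"
    by (auto intro!: finite_generate_power finite_A finite_B finite_C)
  have C: "?C = {C [^] y | y::nat. 2 ^ s dvd y}"
  proof -
    have "(\<exists>x::int. g = C [^] x \<and> 2 ^ s dvd x) \<longleftrightarrow> (\<exists>y::nat. g = C [^] y \<and> 2 ^ s dvd y)" for g
      using nat_exponent[OF C_closed finite_C, of s]
      by (metis int_dvd_int_iff int_pow_int of_nat_numeral of_nat_power)
    then show ?thesis by (auto simp: powers_subgroup)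
  qed
  have CA: "?C <#> ?A = {C [^] y \<otimes> A [^] z | (y::nat) (z::int). 2 ^ s dvd y \<and> 2 ^ s dvd z}"
    unfolding C powers_subgroup[OF A_closed] set_mult_def by blast
  have subCA: "subgroup (?C <#> ?A) G"
  proof (rule subgroupI)
    show "?C <#> ?A \<subseteq> carrier G" unfolding CA by auto
    show "?C <#> ?A \<noteq> {}" unfolding CA by (auto intro: exI[of _ "0::nat"] exI[of _ "0::int"])
  next
    fix g assume "g \<in> ?C <#> ?A"
    then obtain y :: nat and z :: int where g: "g = C [^] y \<otimes> A [^] z" "2 ^ s dvd y" "2 ^ s dvd z" unfolding CA by blast
    have y2: "2 ^ s dvd - int y" using g(2) by (metis dvd_minus_iff int_dvd_int_iff of_nat_numeral of_nat_power)
    obtain v where v: "2 ^ s dvd v" "C [^] (- int y) = C [^] int v"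
      using nat_exponent[OF C_closed finite_C y2] by blast
    have iC: "inv (C [^] y) = C [^] v"
      using v(2) by (simp add: int_pow_neg_int int_pow_int)
    have "inv g = A [^] (- z) \<otimes> C [^] v"
      unfolding g(1) by (simp add: inv_mult_group iC int_pow_neg)
    also have "\<dots> = C [^] v \<otimes> A [^] (- z * \<alpha> ^ v)" by (rule A_C_pow)
    finally show "inv g \<in> ?C <#> ?A" unfolding CA using v(1) g(3) by fastforce
  next
    fix g h assume "g \<in> ?C <#> ?A" "h \<in> ?C <#> ?A"
    then obtain y y' :: nat and z z' :: int where gh: "g = C [^] y \<otimes> A [^] z" "2 ^ s dvd y" "2 ^ s dvd z"
      "h = C [^] y' \<otimes> A [^] z'" "2 ^ s dvd y'" "2 ^ s dvd z'" unfolding CA by blast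
    have "g \<otimes> h = C [^] (y + y') \<otimes> A [^] (z * \<alpha> ^ y' + z')"
      unfolding gh by (simp add: collect)
    moreover have "2 ^ s dvd y + y'" "2 ^ s dvd z * \<alpha> ^ y' + z'" using gh by auto
    ultimately show "g \<otimes> h \<in> ?C <#> ?A" unfolding CA by blast
  qed
  have K: "K s = ?B <#> (?C <#> ?A)"
  proof (intro equalityI subsetI)
    fix g assume "g \<in> K s"
    then obtain x z :: int and y :: nat where g: "g = B [^] x \<otimes> (C [^] y \<otimes> A [^] z)" "2 ^ s dvd x" "2 ^ s dvd y" "2 ^ s dvd z"
      by (auto simp: K_def)
    have "B [^] x \<in> ?B" using g(2) unfolding powers_subgroup[OF B_closed] by blast
    moreover have "C [^] y \<otimes> A [^] z \<in> ?C <#> ?A" using g(3,4) unfolding CA by blast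
    ultimately show "g \<in> ?B <#> (?C <#> ?A)" unfolding g(1) set_mult_def[of G ?B] by auto
  next
    fix g assume "g \<in> ?B <#> (?C <#> ?A)"
    then obtain b c where bc: "b \<in> ?B" "c \<in> ?C <#> ?A" "g = b \<otimes> c"
      unfolding set_mult_def[of G ?B] by auto
    obtain x :: int where x: "b = B [^] x" "2 ^ s dvd x" using bc(1) unfolding powers_subgroup[OF B_closed] by blast
    obtain y :: nat and z :: int where yz: "c = C [^] y \<otimes> A [^] z" "2 ^ s dvd y" "2 ^ s dvd z"
      using bc(2) unfolding CA by blast
    show "g \<in> K s" unfolding bc(3) x(1) yz(1) by (intro K_I x(2) yz(2,3))
  qed
  have finCA: "finite (?C <#> ?A)" using fin by (simp add: set_mult_def)
  then show "finite (K s)" unfolding K using fin by (simp add: set_mult_def)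
  have "card (K s) dvd card ?B * card (?C <#> ?A)"
    unfolding K using sub(2) subCA fin(2) finCA by (rule card_set_mult_dvd)
  also have "card ?B * card (?C <#> ?A) dvd card ?B * (card ?C * card ?A)"
    using card_set_mult_dvd[OF sub(3,1) fin(3,1)] by (rule mult_dvd_mono[OF dvd_refl])
  finally show "card (K s) dvd ord (B [^] (2 ^ s :: nat)) * (ord (C [^] (2 ^ s :: nat)) * ord (A [^] (2 ^ s :: nat)))"
    by (simp add: generate_pow_card)
qed

text \<open>With s = 0 the divisibility conditions are void, so finiteness of the group and the
  bound on its order are instances of the facts about \<open>K\<close>.\<close>

lemma K_0: "K 0 = carrier G"
proof
  have "A \<in> K 0" "B \<in> K 0"
    using K_I[of 0 0 0 1] K_I[of 0 1 0 0] by simp_all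
  then show "carrier G \<subseteq> K 0"
    unfolding generated by (intro generate_subgroup_incl K_subgroup) auto
qed (rule K_carrier)

lemma finite_carrier: "finite (carrier G)"
  using K_finite[of 0] by (simp add: K_0)

lemma order_dvd: "order G dvd ord B * (ord C * ord A)"
  using card_K_dvd[of 0] by (simp add: K_0 order_def)

lemma K_normal: "K s \<lhd> G"
proof (rule normal_if_generators_normalize[OF K_subgroup K_finite _ generated])
  fix x h assume x: "x \<in> {A, B}" and h: "h \<in> K s"
  then obtain k where k: "k \<in> K s" "h \<otimes> x = x \<otimes> k"
    using K_conj_A K_conj_B by blast
  have "inv x \<otimes> h \<otimes> x = inv x \<otimes> (x \<otimes> k)"
    using x h unfolding k(2)[symmetric] by (auto simp: m_assoc)
  also have "\<dots> = k" using x k(1) by (auto simp: m_assoc[symmetric])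
  finally show "inv x \<otimes> h \<otimes> x \<in> K s" using k(1) by simp
qed auto

text \<open>If 2^k is the 2-part of the order, then k < 2^k \<le> \<open>ord g\<close> \<le> s, so
  the 2^s-th power removes it entirely.\<close>

lemma odd_ord_power:
  assumes "g \<in> carrier G" "\<exists>m>0. g [^] (m::nat) = \<one>" "ord g \<le> s"
  shows "odd (ord (g [^] (2 ^ s :: nat)))"
proof -
  have "ord g \<noteq> 0" using assms ord_eq_0 by blast
  then obtain u where "ord g = 2 ^ multiplicity 2 (ord g) * u" "odd u"
    by (rule multiplicity_decompose'[of "ord g" "2::nat"]) auto
  then obtain k where u: "ord g = 2 ^ k * u" "odd u" by blast
  have "k < 2 ^ k" by simp
  also have "(2::nat) ^ k \<le> ord g" using u by (cases u) auto
  finally have "k \<le> s" using assms(3) by simp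
  then have "2 ^ k * u dvd 2 ^ s * u" by (simp add: le_imp_power_dvd)
  then have "(g [^] (2 ^ s :: nat)) [^] u = \<one>"
    using assms(1) u(1) by (simp add: nat_pow_pow pow_eq_id)
  then have "ord (g [^] (2 ^ s :: nat)) dvd u"
    using assms(1) by (simp add: pow_eq_id)
  then show ?thesis using u(2) dvd_trans by blast
qed

lemma normal_2_complement:
  "\<exists>N k. N \<lhd> G \<and> odd (card N) \<and> order (G Mod N) = 2 ^ k"
proof -
  \<comment> \<open>Any s at least as large as each of the three orders will do.\<close>
  define s where "s = ord A + ord B + ord C"
  let ?N = "K s" and ?Q = "G Mod K s"
  interpret N: normal ?N G by (rule K_normal)
  interpret Q: group ?Q by (rule N.factorgroup_is_group)
  define h where "h = (\<lambda>x. ?N #> x)"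
  have hom: "h \<in> hom G ?Q" unfolding h_def by (rule N.r_coset_hom_Mod)
  interpret h: group_hom G ?Q h using hom by unfold_locales
  have "card ?N dvd ord (B [^] (2 ^ s :: nat)) * (ord (C [^] (2 ^ s :: nat)) * ord (A [^] (2 ^ s :: nat)))"
    by (rule card_K_dvd)
  moreover have "odd (ord (B [^] (2 ^ s :: nat)) * (ord (C [^] (2 ^ s :: nat)) * ord (A [^] (2 ^ s :: nat))))"
    using odd_ord_power finite_A finite_B finite_C by (simp add: s_def)
  ultimately have odd: "odd (card ?N)" using dvd_trans by blast
  have macQ: "macdonald ?Q (h A) (h B) \<alpha> \<beta>" and CQ: "macdonald.C ?Q (h A) (h B) = h C"
    using macdonald_hom[OF macdonald_axioms Q.group_axioms hom] by auto
  have surj: "h ` carrier G = carrier ?Q" by (auto simp: h_def FactGroup_def RCOSETS_def)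
  \<comment> \<open>The quotient has three generators of 2-power order, so \<open>order_dvd\<close>,
    applied there, makes its order a divisor of a power of 2.\<close>
  interpret Q: macdonald_finite ?Q "h A" "h B" \<alpha> \<beta>
  proof (intro macdonald_finite.intro macdonald_finite_axioms.intro macQ odd_alpha odd_beta)
    show "\<exists>m>0. h A [^]\<^bsub>?Q\<^esub> (m::nat) = \<one>\<^bsub>?Q\<^esub>" "\<exists>m>0. h B [^]\<^bsub>?Q\<^esub> (m::nat) = \<one>\<^bsub>?Q\<^esub>"
      "\<exists>m>0. macdonald.C ?Q (h A) (h B) [^]\<^bsub>?Q\<^esub> (m::nat) = \<one>\<^bsub>?Q\<^esub>"
      using finite_A finite_B finite_C unfolding CQ by (metis A_closed B_closed C_closed h.hom_nat_pow h.hom_one)+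
    show "carrier ?Q = generate ?Q {h A, h B}"
      using h.generate_img[of "{A, B}"] generated surj by auto
  qed
  have ord2: "\<exists>k. Q.ord (h g) = 2 ^ k" if "g \<in> carrier G" "g [^] (2 ^ s :: nat) \<in> ?N" for g
  proof -
    have "h (g [^] (2 ^ s :: nat)) = \<one>\<^bsub>?Q\<^esub>"
      using that by (simp add: h_def N.rcos_const)
    then have "Q.ord (h g) dvd 2 ^ s"
      using that(1) by (simp add: h.hom_nat_pow Q.pow_eq_id[symmetric])
    then show ?thesis by (auto dest: divides_primepow_nat[THEN iffD1, rotated])
  qed
  have mem: "B [^] (2 ^ s :: nat) \<in> ?N" "A [^] (2 ^ s :: nat) \<in> ?N" "C [^] (2 ^ s :: nat) \<in> ?N"
    using K_I[of s "2 ^ s" 0 0] K_I[of s 0 0 "2 ^ s"] K_I[of s 0 "2 ^ s" 0]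
      int_pow_int[of G A "2 ^ s"] int_pow_int[of G B "2 ^ s"] by simp_all
  obtain i j k where "Q.ord (h B) = 2 ^ i" "Q.ord (h C) = 2 ^ j" "Q.ord (h A) = 2 ^ k"
    using ord2 mem by (metis A_closed B_closed C_closed)
  then have "order ?Q dvd 2 ^ (i + (j + k))"
    using Q.order_dvd unfolding CQ by (simp add: power_add)
  then obtain k where "order ?Q = 2 ^ k" by (auto dest: divides_primepow_nat[THEN iffD1, rotated])
  then show ?thesis using odd K_normal by blast
qed

end

section \<open>Relations in 2-groups\<close>

text \<open>The class equation: if the identity were the only central element, every other class
  would have even size and the order would be odd. A suitable power of a central element then has
  order 2.\<close>

lemma (in group) two_group_central_involution:
  assumes "order G = 2 ^ Suc k"
  obtains z where "z \<in> carrier G" "z \<noteq> \<one>" "z \<otimes> z = \<one>" "\<And>g. g \<in> carrier G \<Longrightarrow> g \<otimes> z = z \<otimes> g"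
proof -
  let ?c = "\<lambda>g. \<lambda>h\<in>carrier G. g \<otimes> h \<otimes> inv g"
  interpret conj: group_action G "carrier G" ?c by (rule action_by_conjugation)
  have fin: "finite (carrier G)" using assms by (metis card.infinite order_def power_not_zero zero_neq_numeral)
  have "\<exists>z\<in>carrier G. z \<noteq> \<one> \<and> (\<forall>g\<in>carrier G. g \<otimes> z = z \<otimes> g)"
  proof (rule ccontr)
    assume nex: "\<not> ?thesis"
    let ?O = "orbits G (carrier G) ?c"
    have one: "orbit G ?c \<one> = {\<one>}" by (auto simp: orbit_def intro: exI[of _ \<one>])
    then have oneO: "{\<one>} \<in> ?O" by (auto simp: orbits_def)
    have finO: "finite ?O" using fin by (simp add: orbits_def)
    have even: "even (card b)" if b: "b \<in> ?O - {{\<one>}}" for b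
    proof -
      obtain x where x: "x \<in> carrier G" "b = orbit G ?c x" using b by (auto simp: orbits_def)
      have "card b dvd 2 ^ Suc k"
        using conj.orbit_stabilizer_theorem[OF x(1)] unfolding x(2) assms by (rule dvdI[OF HOL.sym])
      then obtain j where j: "card b = 2 ^ j" using divides_primepow_nat[OF two_is_prime_nat] by blast
      have "card b \<noteq> 1"
      proof
        assume "card b = 1"
        then obtain y where y: "b = {y}" by (auto simp: card_1_singleton_iff)
        then have bx: "b = {x}" using conj.orbit_refl[OF x(1)] x(2) by auto
        have "g \<otimes> x = x \<otimes> g" if g: "g \<in> carrier G" for g
        proof -
          have "?c g x \<in> b" unfolding x(2) orbit_def using g by blast
          then have "g \<otimes> x \<otimes> inv g = x" using x(1) bx by simp
          then show ?thesis using inv_solve_right'[of x "g \<otimes> x" g] g x(1) by simp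
        qed
        then have "x = \<one>" using nex x(1) by blast
        then show False using b bx by simp
      qed
      then show ?thesis using j by (cases j) auto
    qed
    have "order G = (\<Sum>b\<in>?O. card b)"
      using conj.disjoint_sum[OF fin, of "\<lambda>_. 1::nat"] by (simp add: order_def)
    also have "\<dots> = 1 + (\<Sum>b\<in>?O - {{\<one>}}. card b)"
      by (subst sum.remove[OF finO oneO]) simp
    finally have "order G = 1 + (\<Sum>b\<in>?O - {{\<one>}}. card b)" .
    moreover have "even (\<Sum>b\<in>?O - {{\<one>}}. card b)" by (rule dvd_sum) (rule even)
    ultimately have "odd (order G)" by simp
    then show False using assms by simp
  qed
  then obtain y where y: "y \<in> carrier G" "y \<noteq> \<one>" "\<And>g. g \<in> carrier G \<Longrightarrow> g \<otimes> y = y \<otimes> g" by blast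
  have "ord y dvd 2 ^ Suc k" using ord_dvd_group_order[OF y(1)] assms by simp
  then obtain j where j: "ord y = 2 ^ j" using divides_primepow_nat[OF two_is_prime_nat] by blast
  have "j \<noteq> 0" using j ord_eq_1[OF y(1)] y(2) by (cases j) auto
  then obtain i where i: "j = Suc i" by (cases j) auto
  let ?z = "y [^] (2 ^ i :: nat)"
  show thesis
  proof (rule that)
    show "?z \<in> carrier G" using y(1) by simp
    show "?z \<noteq> \<one>" using y(1) by (simp add: pow_eq_id j i)
    have "?z \<otimes> ?z = y [^] (2 ^ Suc i :: nat)" using y(1) by (simp add: nat_pow_mult mult_2)
    then show "?z \<otimes> ?z = \<one>" using pow_ord_eq_1[OF y(1)] by (simp add: j i)
    show "g \<otimes> ?z = ?z \<otimes> g" if "g \<in> carrier G" for g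
      using int_pow_commute_gen[OF that y(1) y(1) y(3)[OF that], of "int (2 ^ i)"] by (simp only: int_pow_int)
  qed
qed

text \<open>Shows that the exponent of \<open>B\<close> in \<open>C_power_relation\<close> for i = 1
  vanishes modulo 2^(n+2). Only the terms linear in T matter, since T^2 and U T are 0 modulo
  N.\<close>

lemma two_power_dvd_exponent:
  fixes \<beta> t :: int
  assumes \<beta>: "\<beta> = 1 + 2 ^ n * t" and n: "n \<ge> 3" and b: "2 ^ (n + 2) dvd \<beta> - int b"
  shows "2 ^ (n + 2) dvd int b * \<beta> ^ b - \<beta> * gsum \<beta> b"
proof -
  \<comment> \<open>U is half of T and absorbs the denominator of the binomial coefficient k(k-1)/2
    in \<open>gsum\<close>. That N divides U T amounts to 2n - 1 \<ge> n + 2, that is n \<ge>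
    3.\<close>
  define N T U where "N = (2::int) ^ (n + 2)" and "T = 2 ^ n * t" and "U = 2 ^ (n - 1) * t"
  have TU: "T = 2 * U" using n by (simp add: T_def U_def power_eq_if)
  have "N dvd 2 ^ (n - 1 + n)" unfolding N_def using n by (intro le_imp_power_dvd) simp
  then have NUT: "N dvd U * T" unfolding T_def U_def by (simp add: power_add ac_simps dvd_mult2)
  then have NTT: "N dvd T * T" using dvd_mult[of N "U * T" 2] by (simp add: TU mult.assoc)
  have \<beta>T: "\<beta> = 1 + T" using \<beta> by (simp add: T_def)
  have pow: "N dvd \<beta> ^ j - (1 + int j * T)" for j
  proof (induction j)
    case (Suc j)
    have "\<beta> ^ Suc j - (1 + int (Suc j) * T) = (\<beta> ^ j - (1 + int j * T)) * \<beta> + int j * (T * T)"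
      by (simp add: \<beta>T algebra_simps)
    then show ?case using Suc NTT by simp
  qed simp
  have gs: "N dvd gsum \<beta> k - (int k + U * int k * (int k - 1))" for k
  proof (induction k)
    case (Suc k)
    have "gsum \<beta> (Suc k) - (int (Suc k) + U * int (Suc k) * (int (Suc k) - 1)) =
      (gsum \<beta> k - (int k + U * int k * (int k - 1))) + (\<beta> ^ k - (1 + int k * T))"
      by (simp add: gsum_Suc TU algebra_simps)
    then show ?case using dvd_add[OF Suc pow[of k]] by (simp only:)
  qed simp
  have b': "N dvd (1 + T) - int b" using b by (simp add: N_def \<beta>T)
  obtain m where m: "int b = 1 + T + N * m" using b' by (metis dvd_def diff_eq_eq add.commute dvd_diff_commute)
  obtain p where p: "\<beta> ^ b = 1 + int b * T + N * p" using pow[of b] by (metis dvd_def diff_eq_eq add.commute)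
  obtain q where q: "gsum \<beta> b = int b + U * int b * (int b - 1) + N * q"
    using gs[of b] by (metis dvd_def diff_eq_eq add.commute)
  have "int b * \<beta> ^ b - \<beta> * gsum \<beta> b =
      int b * (T * T) + N * (int b * (m * T + p)  - \<beta> * U * int b * m - \<beta> * q) - \<beta> * int b * (U * T)"
    unfolding p q by (simp add: \<beta>T m algebra_simps)
  also have "N dvd \<dots>" using NTT NUT by simp
  finally show ?thesis by (simp add: N_def)
qed

context macdonald
begin

text \<open>The step of the induction: the assumptions are what the desired relations in the
  quotient by a central involution leave behind, namely orders too large by a factor 2 and an error
  v in \<open>C^2 = A^2\<close>.\<close>

lemma relations_if_central:
  fixes n :: nat and t :: int
  assumes \<alpha>: "\<alpha> mod 4 = 3" and \<beta>: "\<beta> = 1 + 2 ^ n * t" "odd t" and n: "n \<ge> 3"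
    and A8: "A [^] (8::nat) = \<one>" and B2: "B [^] (2 ^ (n + 2) :: nat) = \<one>"
    and v: "v \<in> carrier G" "v \<otimes> v = \<one>" "v \<otimes> A = A \<otimes> v" "v \<otimes> B = B \<otimes> v"
    and C2: "C [^] (2::nat) = A [^] (2::nat) \<otimes> v"
  shows "A [^] (4::nat) = \<one>" "C [^] (2::nat) = A [^] (2::nat)" "B [^] (2 ^ (n + 1) :: nat) = \<one>"
proof -
  define k where "k = \<alpha> div 4"
  have k: "\<alpha> = 4 * k + 3" using \<alpha> unfolding k_def by presburger
  have vC: "v \<otimes> C = C \<otimes> v" using v by (intro commute_C) auto
  have C2i: "C [^] (2::nat) = A [^] (2::int) \<otimes> v" using C2 int_pow_int[of G A 2] by simp
  have A8i: "A [^] (8::int) = \<one>" using A8 int_pow_int[of G A 8] by simp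
  \<comment> \<open>\<open>C\<close> commutes with its square and with v, hence with
    \<open>A^2\<close>, which gives \<open>A^(2(\<alpha> - 1)) = 1\<close>. The exponent is 4 modulo
    8, and \<open>A^8\<close> is trivial.\<close>
  have "(C \<otimes> A [^] (2::int)) \<otimes> v = C \<otimes> C [^] (2::nat)"
    unfolding C2i using v(1) by (simp add: m_assoc)
  also have "\<dots> = C [^] (2::nat) \<otimes> C" by (simp add: numeral_2_eq_2 m_assoc)
  also have "\<dots> = (A [^] (2::int) \<otimes> C) \<otimes> v"
    unfolding C2i using vC v(1) by (simp add: m_assoc)
  also have "\<dots> = (C \<otimes> A [^] (2 * \<alpha>)) \<otimes> v"
    using A_C_pow[of 2 1] by simp
  finally have "A [^] (2::int) = A [^] (2 * \<alpha>)" using v(1) by simp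
  then have "A [^] (-2::int) \<otimes> A [^] (2::int) = A [^] (-2::int) \<otimes> A [^] (2 * \<alpha>)" by simp
  then have "A [^] (4 + 8 * k) = \<one>" by (simp add: int_pow_add k algebra_simps)
  then have "A [^] (4::int) \<otimes> (A [^] (8::int)) [^] k = \<one>"
    unfolding int_pow_pow[OF A_closed] int_pow_add[OF A_closed] .
  then have A4i: "A [^] (4::int) = \<one>" unfolding A8i by simp
  then show A4: "A [^] (4::nat) = \<one>" using int_pow_int[of G A 4] by simp
  have Amod: "A [^] (i::int) = A [^] (j::int)" if "4 dvd i - j" for i j
  proof -
    obtain l where "i = j + 4 * l" using \<open>4 dvd i - j\<close> by (metis dvd_def diff_eq_eq add.commute)
    then have "A [^] i = A [^] j \<otimes> (A [^] (4::int)) [^] l"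
      unfolding int_pow_pow[OF A_closed] int_pow_add[OF A_closed] by simp
    then show ?thesis unfolding A4i by simp
  qed
  define N where "N = (2::nat) ^ (n + 2)"
  have N: "int N = 2 ^ (n + 2)" "N > 0" by (simp_all add: N_def)
  have Bi: "B [^] int N = \<one>" using B2 by (simp only: int_pow_int N_def)
  have Bmod: "B [^] (i::int) = B [^] (j::int)" if "int N dvd i - j" for i j
  proof -
    obtain l where "i = j + int N * l" using \<open>int N dvd i - j\<close> by (metis dvd_def diff_eq_eq add.commute)
    then have "B [^] i = B [^] j \<otimes> (B [^] int N) [^] l"
      unfolding int_pow_pow[OF B_closed] int_pow_add[OF B_closed] by simp
    then show ?thesis unfolding Bi by simp
  qed
  \<comment> \<open>For i = 1 the relation is used with the residues of \<alpha> and \<beta>, so the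
    exponents are natural numbers: 3 modulo 4 and b modulo N.\<close>
  define b where "b = nat (\<beta> mod int N)"
  have b: "int b = \<beta> mod int N" using N(2) by (simp add: b_def)
  have b1: "int N dvd \<beta> - int b" unfolding b by (rule dvd_minus_mod)
  have b2: "B [^] int b = B [^] (\<beta> ^ 1)"
    using Bmod[OF b1] by simp
  have a2: "A [^] int 3 = A [^] (\<alpha> ^ 1)" by (rule Amod) (simp add: k)
  have f: "B [^] (int b * \<beta> ^ b - \<beta> * gsum \<beta> b) = \<one>"
    using two_power_dvd_exponent[OF \<beta>(1) n, of b] b1 Bmod[of _ 0] unfolding N(1) by simp
  have e: "A [^] (\<alpha> ^ (3 + 1) - \<alpha> * gsum \<alpha> 3) = A [^] (2::int)"
  proof (rule Amod)
    have *: "\<alpha> ^ (3 + 1) - \<alpha> * gsum \<alpha> 3 = \<alpha> ^ 4 - \<alpha> - \<alpha>\<^sup>2 - \<alpha> ^ 3"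
      by (simp add: gsum_def eval_nat_numeral algebra_simps)
    have "\<alpha> ^ 4 - \<alpha> - \<alpha>\<^sup>2 - \<alpha> ^ 3 - 2 = 4 * (64 * k ^ 4 + 176 * k ^ 3 + 176 * k\<^sup>2 + 74 * k + 10)"
      unfolding k by (simp add: eval_nat_numeral algebra_simps)
    then show "4 dvd \<alpha> ^ (3 + 1) - \<alpha> * gsum \<alpha> 3 - 2" unfolding * by (simp only: dvd_triv_left)
  qed
  have C4: "C [^] (4::nat) = \<one>"
  proof -
    have "C [^] (4::nat) = C [^] (2::nat) \<otimes> C [^] (2::nat)" by (simp add: nat_pow_mult)
    also have "\<dots> = (A [^] (2::int) \<otimes> v) \<otimes> (A [^] (2::int) \<otimes> v)" unfolding C2i ..
    also have "v \<otimes> A [^] (2::int) = A [^] (2::int) \<otimes> v"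
      using int_pow_commute_gen[OF v(1) A_closed A_closed v(3)] .
    then have "(A [^] (2::int) \<otimes> v) \<otimes> (A [^] (2::int) \<otimes> v) = (A [^] (2::int) \<otimes> A [^] (2::int)) \<otimes> (v \<otimes> v)"
      using v(1) by (simp add: m_assoc) (simp add: m_assoc[symmetric])
    also have "\<dots> = \<one>" using A4i by (simp add: int_pow_add v(2))
    finally show ?thesis .
  qed
  have "(4::int) dvd \<beta> - 1"
    unfolding \<beta>(1) using le_imp_power_dvd[of 2 n "2::int"] n by (simp add: dvd_mult2)
  moreover have "(4::int) dvd \<beta> - int b"
    using b1 dvd_trans[of "4::int" "2 ^ (n + 2)"] unfolding N(1) by (simp add: power_add)
  ultimately have "int b mod 4 = 1" by presburger
  then have "b mod 4 = 1" by presburger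
  then have "b = 4 * (b div 4) + 1" by presburger
  then obtain j where j: "b = 4 * j + 1" by blast
  have "C [^] (b + 1) = C [^] (2::nat) \<otimes> (C [^] (4::nat)) [^] j"
    unfolding j nat_pow_pow[OF C_closed] nat_pow_mult[OF C_closed] by (simp add: ac_simps)
  then have Cb: "C [^] (b + 1) = C [^] (2::nat)" unfolding C4 by simp
  \<comment> \<open>Here the \<open>B\<close> factor is trivial, b + 1 is 2 modulo 4 and the
    exponent of \<open>A\<close> is 2 modulo 4. So \<open>1 = C^2 A^2 = A^4 v = v\<close>.\<close>
  have "C [^] (3 + 1 :: nat) = \<one> \<otimes> (C [^] (2::nat) \<otimes> A [^] (2::int))"
    using C_power_relation[OF a2 b2] unfolding f e Cb .
  then have "\<one> = (A [^] (2::int) \<otimes> v) \<otimes> A [^] (2::int)"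
    using C4 v(1) unfolding C2i by simp
  also have "\<dots> = (A [^] (2::int) \<otimes> A [^] (2::int)) \<otimes> v"
    using int_pow_commute_gen[OF v(1) A_closed A_closed v(3), of 2] v(1) by (simp add: m_assoc)
  also have "\<dots> = v" using A4i v(1) by (simp add: int_pow_add)
  finally have v1: "v = \<one>" ..
  show C2A: "C [^] (2::nat) = A [^] (2::nat)" using C2 v1 by simp
  have C2Ai: "C [^] (2::nat) = A [^] (2::int)" using C2i v1 by simp
  \<comment> \<open>Now \<open>A^2\<close> commutes with \<open>B\<close>, since \<alpha> +
    \<alpha>^2 is divisible by 4; as \<open>C^2\<close> it also conjugates \<open>B\<close> to
    \<open>B^(\<beta>^2)\<close>.\<close>
  have "A [^] int 2 \<otimes> B = B \<otimes> (C [^] (2::nat) \<otimes> A [^] (\<alpha> * gsum \<alpha> 2))" by (rule A_pow_B)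
  moreover have "A [^] (\<alpha> * gsum \<alpha> 2) = A [^] (0::int)"
    by (rule Amod) (simp add: k gsum_def eval_nat_numeral algebra_simps)
  ultimately have "A [^] (2::int) \<otimes> B = B \<otimes> A [^] (2::int)" unfolding C2Ai by simp
  moreover have "A [^] (2::int) \<otimes> B = B [^] (\<beta>\<^sup>2) \<otimes> A [^] (2::int)"
    using C_B_pow[of 2 1] unfolding C2Ai by simp
  ultimately have "B [^] (\<beta>\<^sup>2) = B" by simp
  then have "B [^] (- 1 :: int) \<otimes> B [^] (\<beta>\<^sup>2) = B [^] (- 1 :: int) \<otimes> B [^] (1::int)" by simp
  then have B1: "B [^] (\<beta>\<^sup>2 - 1) = \<one>" unfolding int_pow_add[OF B_closed] by simp
  obtain w where w: "t = 2 * w + 1" using \<beta>(2) by (auto elim: oddE)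
  \<comment> \<open>The valuation of \<beta>^2 - 1 is exactly n + 1, which halves the assumed bound
    on the order of \<open>B\<close>.\<close>
  have "\<beta>\<^sup>2 - 1 = 2 ^ (n + 1) + 2 ^ (n + 2) * (w + 2 ^ (n - 2) * t\<^sup>2)"
  proof -
    obtain r where r: "n = r + 2" using n that[of "n - 2"] by simp
    then have "(2::int) ^ n = 4 * 2 ^ (n - 2)" by (simp add: power_add)
    then show ?thesis unfolding \<beta>(1) by (simp add: w power2_eq_square algebra_simps)
  qed
  then have "B [^] (\<beta>\<^sup>2 - 1) = B [^] (2 ^ (n + 1) :: int)"
    by (intro Bmod) (simp add: N)
  then show "B [^] (2 ^ (n + 1) :: nat) = \<one>"
    using B1 int_pow_int[of G B "2 ^ (n + 1)"] by simp
qed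

text \<open>The quotient by a central involution is realised on coset representatives, so that the induction
  on the order stays within one type.\<close>

lemma relations_step:
  fixes n :: nat and t :: int
  assumes \<alpha>\<beta>: "\<alpha> mod 4 = 3" "\<beta> = 1 + 2 ^ n * t" "odd t" "n \<ge> 3"
    and order: "order G = 2 ^ Suc k"
    and IH: "\<And>(H :: 'a monoid) A B. \<lbrakk>macdonald H A B \<alpha> \<beta>; order H = 2 ^ k\<rbrakk> \<Longrightarrow>
      A [^]\<^bsub>H\<^esub> (4::nat) = \<one>\<^bsub>H\<^esub> \<and>
      macdonald.C H A B [^]\<^bsub>H\<^esub> (2::nat) = A [^]\<^bsub>H\<^esub> (2::nat) \<and>
      B [^]\<^bsub>H\<^esub> (2 ^ (n + 1) :: nat) = \<one>\<^bsub>H\<^esub>"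
  shows "A [^] (4::nat) = \<one> \<and> C [^] (2::nat) = A [^] (2::nat) \<and> B [^] (2 ^ (n + 1) :: nat) = \<one>"
proof -
  obtain z where z: "z \<in> carrier G" "z \<noteq> \<one>" "z \<otimes> z = \<one>" "\<And>g. g \<in> carrier G \<Longrightarrow> g \<otimes> z = z \<otimes> g"
    using two_group_central_involution[OF order] by blast
  let ?Z = "{\<one>, z}"
  have invz: "inv z = z" using z(1,3) by (simp add: inv_equality)
  have subZ: "subgroup ?Z G" using z(1,3) invz by (intro subgroupI) auto
  have normZ: "?Z \<lhd> G"
  proof (rule normal_invI[OF subZ])
    fix x h assume x: "x \<in> carrier G" and h: "h \<in> ?Z"
    have "x \<otimes> z \<otimes> inv x = z" unfolding z(4)[OF x] using x z(1) by (simp add: m_assoc)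
    then show "x \<otimes> h \<otimes> inv x \<in> ?Z" using x h by auto
  qed
  define f where "f = (\<lambda>x. SOME y. y \<in> ?Z #> x)"
  have weak: "weak_group_morphism f ?Z G"
  proof (rule weak_group_morphismsI[OF normZ])
    fix a b assume ab: "a \<in> carrier G" "b \<in> carrier G"
    have fin: "f x \<in> ?Z #> x" if "x \<in> carrier G" for x
      unfolding f_def by (rule someI[of _ x]) (use rcos_self[OF that subZ] in auto)
    show "f a = f b \<longleftrightarrow> a \<otimes> inv b \<in> ?Z"
    proof
      assume "f a = f b"
      then have "?Z #> a = ?Z #> b"
        using repr_independence[OF fin[OF ab(1)] ab(1) subZ] repr_independence[OF fin[OF ab(2)] ab(2) subZ] by simp
      then have "a \<in> ?Z #> b" using rcos_self[OF ab(1) subZ] by simp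
      then obtain h where h: "h \<in> ?Z" "a = h \<otimes> b" unfolding r_coset_def by blast
      then have "a \<otimes> inv b = h" using ab z(1) by (auto simp: m_assoc)
      then show "a \<otimes> inv b \<in> ?Z" using h(1) by simp
    next
      assume *: "a \<otimes> inv b \<in> ?Z"
      have "a = a \<otimes> inv b \<otimes> b" using ab by (simp add: m_assoc)
      then have "a \<in> ?Z #> b" using * unfolding r_coset_def by blast
      then have "?Z #> a = ?Z #> b" using repr_independence[OF _ ab(2) subZ] by simp
      then show "f a = f b" by (simp add: f_def)
    qed
  qed
  let ?H = "image_group f G"
  interpret H: group ?H by (rule image_group_is_group[OF weak])
  have hom: "f \<in> hom G ?H" by (rule weak_group_morphism_is_hom[OF weak])
  interpret f: group_hom G ?H f using hom by unfold_locales
  have ker: "kernel G ?H f = ?Z" by (rule weak_group_morphism_ker[OF weak])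
  have mem: "g \<in> ?Z" if "g \<in> carrier G" "f g = \<one>\<^bsub>?H\<^esub>" for g
    using that ker by (auto simp: kernel_def)
  have "order (G Mod ?Z) = order ?H"
    using weak_group_morphism_is_iso[OF weak] by (auto simp: order_def iso_def bij_betw_same_card)
  moreover have "order (G Mod ?Z) * card ?Z = order G"
    using lagrange[OF subZ] by (simp add: order_def FactGroup_def)
  moreover have "card ?Z = 2" using z(2) by simp
  ultimately have "order ?H = 2 ^ k" using order by simp
  moreover have mac: "macdonald ?H (f A) (f B) \<alpha> \<beta>" and CH: "macdonald.C ?H (f A) (f B) = f C"
    using macdonald_hom[OF macdonald_axioms H.group_axioms hom] by auto
  ultimately have rels: "f A [^]\<^bsub>?H\<^esub> (4::nat) = \<one>\<^bsub>?H\<^esub>"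
    "f C [^]\<^bsub>?H\<^esub> (2::nat) = f A [^]\<^bsub>?H\<^esub> (2::nat)"
    "f B [^]\<^bsub>?H\<^esub> (2 ^ (n + 1) :: nat) = \<one>\<^bsub>?H\<^esub>"
    using IH[OF mac] unfolding CH by auto
  have sq: "g \<otimes> g = \<one>" if "g \<in> ?Z" for g using that z(3) by auto
  have a4: "A [^] (4::nat) \<in> ?Z" by (rule mem) (use rels in \<open>auto simp: f.hom_nat_pow\<close>)
  have b2: "B [^] (2 ^ (n + 1) :: nat) \<in> ?Z" by (rule mem) (use rels in \<open>auto simp: f.hom_nat_pow\<close>)
  let ?v = "inv (A [^] (2::nat)) \<otimes> C [^] (2::nat)"
  have v: "?v \<in> ?Z" by (rule mem) (use rels in \<open>auto simp: f.hom_nat_pow\<close>)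
  \<comment> \<open>Relations of the quotient hold up to an element of \<open>?Z\<close>, whose
    square is trivial; \<open>?v\<close> measures the failure of \<open>C^2 = A^2\<close>.\<close>
  have A8: "A [^] (8::nat) = \<one>" using sq[OF a4] by (simp add: nat_pow_mult)
  have B2: "B [^] (2 ^ (n + 2) :: nat) = \<one>" using sq[OF b2] by (simp add: nat_pow_mult mult_2)
  have C2: "C [^] (2::nat) = A [^] (2::nat) \<otimes> ?v"
    using inv_solve_left[of ?v "A [^] (2::nat)" "C [^] (2::nat)"] by simp
  have vA: "?v \<otimes> A = A \<otimes> ?v" using v z(4)[of A] by auto
  have vB: "?v \<otimes> B = B \<otimes> ?v" using v z(4)[of B] by auto
  show ?thesis
    using relations_if_central[OF \<alpha>\<beta> A8 B2 _ sq[OF v] vA vB C2] by simp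
qed

end

text \<open>Induction on k with the group and the pair arbitrary. Since the pair need not generate,
  nothing about generators has to be carried to the quotient.\<close>

lemma two_group_relations:
  fixes G :: "'a monoid" and n :: nat and t \<alpha> \<beta> :: int
  assumes "\<alpha> mod 4 = 3" "\<beta> = 1 + 2 ^ n * t" "odd t" "n \<ge> 3"
    and "macdonald G A B \<alpha> \<beta>" "order G = 2 ^ k"
  shows "A [^]\<^bsub>G\<^esub> (4::nat) = \<one>\<^bsub>G\<^esub> \<and>
    macdonald.C G A B [^]\<^bsub>G\<^esub> (2::nat) = A [^]\<^bsub>G\<^esub> (2::nat) \<and>
    B [^]\<^bsub>G\<^esub> (2 ^ (n + 1) :: nat) = \<one>\<^bsub>G\<^esub>"
  using assms(5,6)
proof (induction k arbitrary: G A B)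
  case 0
  interpret macdonald G A B \<alpha> \<beta> by fact
  have "carrier G = {\<one>\<^bsub>G\<^esub>}" using 0(2) by (metis order_one_triv_iff power_0)
  then have "g = \<one>\<^bsub>G\<^esub>" if "g \<in> carrier G" for g using that by blast
  then show ?case by (metis A_closed B_closed C_closed nat_pow_closed one_closed)
next
  case (Suc k)
  show ?case by (rule macdonald.relations_step[OF Suc.prems(1) assms(1-4) Suc.prems(2) Suc.IH])
qed

section \<open>Orders and nilpotency class\<close>

context group
begin

lemma commute_generate:
  assumes g: "g \<in> carrier G" and S: "S \<subseteq> carrier G" and comm: "\<And>s. s \<in> S \<Longrightarrow> g \<otimes> s = s \<otimes> g"
    and y: "y \<in> generate G S"
  shows "g \<otimes> y = y \<otimes> g"
  using y
proof (induction rule: generate.induct)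
  case (inv s)
  have s: "s \<in> carrier G" using inv S by blast
  have "inv s \<otimes> (g \<otimes> s) = g" unfolding comm[OF inv] using s g by (simp add: m_assoc[symmetric])
  then have "inv s \<otimes> g \<otimes> s = g" using s g by (simp add: m_assoc)
  then show ?case using inv_solve_right'[of "inv s \<otimes> g" g s] s g by simp
next
  case (eng x y)
  have c: "x \<in> carrier G" "y \<in> carrier G" using eng(1,2) generate_in_carrier[OF S] by auto
  have "g \<otimes> (x \<otimes> y) = (g \<otimes> x) \<otimes> y" using c g by (simp add: m_assoc)
  also have "\<dots> = x \<otimes> (g \<otimes> y)" unfolding eng(3) using c g by (simp add: m_assoc)
  also have "\<dots> = (x \<otimes> y) \<otimes> g" unfolding eng(4) using c g by (simp add: m_assoc)
  finally show ?case .
qed (use g comm in auto)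

lemma gcomm_closed: "x \<in> carrier G \<Longrightarrow> y \<in> carrier G \<Longrightarrow> gcomm G x y \<in> carrier G"
  by (simp add: gcomm_def)

lemma gcomm_eq_one_iff:
  assumes "x \<in> carrier G" "y \<in> carrier G"
  shows "gcomm G x y = \<one> \<longleftrightarrow> x \<otimes> y = y \<otimes> x"
proof -
  have "gcomm G x y = inv (y \<otimes> x) \<otimes> (x \<otimes> y)"
    using assms by (simp add: gcomm_def inv_mult_group m_assoc)
  then show ?thesis using inv_solve_left'[of \<one> "y \<otimes> x" "x \<otimes> y"] assms by simp
qed

text \<open>Modulo \<open>N\<close> a commutator is trivial exactly when its entries commute, and
  commuting extends from generators to generated elements, once in each entry.\<close>

lemma gcomm_generate_in_normal:
  assumes N: "N \<lhd> G" and R: "R \<subseteq> carrier G" and S: "S \<subseteq> carrier G" "carrier G = generate G S"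
    and comm: "\<And>r s. r \<in> R \<Longrightarrow> s \<in> S \<Longrightarrow> gcomm G r s \<in> N"
    and x: "x \<in> generate G R" and y: "y \<in> carrier G"
  shows "gcomm G x y \<in> N"
proof -
  interpret N: normal N G by fact
  let ?Q = "G Mod N"
  interpret Q: group ?Q by (rule N.factorgroup_is_group)
  define h where "h = (\<lambda>x. N #> x)"
  have hom: "h \<in> hom G ?Q" unfolding h_def by (rule N.r_coset_hom_Mod)
  interpret h: group_hom G ?Q h using hom by unfold_locales
  have mem: "gcomm G a b \<in> N \<longleftrightarrow> h a \<otimes>\<^bsub>?Q\<^esub> h b = h b \<otimes>\<^bsub>?Q\<^esub> h a"
    if ab: "a \<in> carrier G" "b \<in> carrier G" for a b
  proof -
    have "gcomm G a b \<in> N \<longleftrightarrow> h (gcomm G a b) = \<one>\<^bsub>?Q\<^esub>"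
      using gcomm_closed[OF ab] N.rcos_const coset_join1[OF _ gcomm_closed[OF ab] N.subgroup_axioms]
      by (auto simp: h_def)
    also have "h (gcomm G a b) = gcomm ?Q (h a) (h b)" using ab by (simp add: gcomm_def)
    finally show ?thesis using Q.gcomm_eq_one_iff[of "h a" "h b"] ab by simp
  qed
  have 1: "h r \<otimes>\<^bsub>?Q\<^esub> h y = h y \<otimes>\<^bsub>?Q\<^esub> h r" if r: "r \<in> R" for r
  proof (rule Q.commute_generate[where S = "h ` S"])
    show "h y \<in> generate ?Q (h ` S)" using y S h.generate_img[of S] by auto
    show "\<And>s. s \<in> h ` S \<Longrightarrow> h r \<otimes>\<^bsub>?Q\<^esub> s = s \<otimes>\<^bsub>?Q\<^esub> h r"
      using comm[OF r] mem r R S(1) by blast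
  qed (use r R S(1) in auto)
  have "h y \<otimes>\<^bsub>?Q\<^esub> h x = h x \<otimes>\<^bsub>?Q\<^esub> h y"
  proof (rule Q.commute_generate[where S = "h ` R"])
    show "h x \<in> generate ?Q (h ` R)" using x R h.generate_img[of R] by auto
    show "\<And>s. s \<in> h ` R \<Longrightarrow> h y \<otimes>\<^bsub>?Q\<^esub> s = s \<otimes>\<^bsub>?Q\<^esub> h y" using 1 by auto
  qed (use y R in auto)
  then show ?thesis using mem y x generate_in_carrier[OF R] by auto
qed

text \<open>A conjugate of h is h times the commutator of h with the inverse of x.\<close>

lemma normal_if_gcomm_closed:
  assumes T: "subgroup T G" and "\<And>x y. x \<in> T \<Longrightarrow> y \<in> carrier G \<Longrightarrow> gcomm G x y \<in> T"
  shows "T \<lhd> G"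
proof (rule normal_invI[OF T])
  fix x h assume xh: "x \<in> carrier G" "h \<in> T"
  have hc: "h \<in> carrier G" using subgroup.mem_carrier[OF T xh(2)] .
  have "h \<otimes> gcomm G h (inv x) = x \<otimes> h \<otimes> inv x"
    using xh(1) hc by (simp add: gcomm_def m_assoc) (simp add: m_assoc[symmetric])
  then show "x \<otimes> h \<otimes> inv x \<in> T"
    using subgroup.m_closed[OF T xh(2) assms(2)[OF xh(2), of "inv x"]] xh(1) by simp
qed

lemma lcs_Suc_subset:
  assumes "subgroup T G" "\<And>x y. x \<in> lcs G k \<Longrightarrow> y \<in> carrier G \<Longrightarrow> gcomm G x y \<in> T"
  shows "lcs G (Suc k) \<subseteq> T"
  unfolding lcs.simps by (rule generate_subgroup_incl[OF _ assms(1)]) (use assms(2) in auto)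

lemma gcomm_in_lcs_Suc: "x \<in> lcs G k \<Longrightarrow> y \<in> carrier G \<Longrightarrow> gcomm G x y \<in> lcs G (Suc k)"
  unfolding lcs.simps by (rule generate.incl) blast

end

text \<open>The exact 2-adic valuation: each doubling of the length multiplies the sum by 1 +
  \<beta>^(2^m), which is 2 modulo 4.\<close>

lemma gsum_two_power:
  assumes "4 dvd \<beta> - 1"
  shows "\<exists>u. odd u \<and> gsum \<beta> (2 ^ m) = 2 ^ m * u"
proof (induction m)
  case 0
  then show ?case by (auto simp: gsum_def)
next
  case (Suc m)
  then obtain u where u: "odd u" "gsum \<beta> (2 ^ m) = 2 ^ m * u" by blast
  have "\<beta> - 1 dvd \<beta> ^ (2 ^ m) - 1" by (rule dvdI) (rule gsum_mult[symmetric])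
  then obtain j where "\<beta> ^ (2 ^ m) - 1 = 4 * j" using assms dvd_trans by blast
  then obtain w where w: "1 + \<beta> ^ (2 ^ m) = 2 * w" "odd w"
    using that[of "1 + 2 * j"] by simp
  have "gsum \<beta> (2 ^ Suc m) = gsum \<beta> (2 ^ m) * (1 + \<beta> ^ (2 ^ m))"
    using gsum_add[of \<beta> "2 ^ m" "2 ^ m"] by (simp add: mult_2 algebra_simps)
  then have "gsum \<beta> (2 ^ Suc m) = 2 ^ Suc m * (u * w)" by (simp add: u w)
  then show ?case using u(1) w(2) by auto
qed

section \<open>Normal forms and central series of the 2-group\<close>

locale macdonald_two = macdonald_finite +
  fixes n :: nat and t :: int
  assumes alpha: "\<alpha> mod 4 = 3" and beta: "\<beta> = 1 + 2 ^ n * t" and odd_t: "odd t" and n_ge: "n \<ge> 3"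
    and A4: "A [^] (4::nat) = \<one>" and C2: "C [^] (2::nat) = A [^] (2::nat)"
    and B1: "B [^] (2 ^ (n + 1) :: nat) = \<one>"
begin

lemma A_pow_mod: "4 dvd i - j \<Longrightarrow> A [^] (i::int) = A [^] (j::int)"
proof -
  assume "4 dvd i - j"
  moreover have "int (ord A) dvd int 4" using A4 pow_eq_id[of A 4] by (simp only: A_closed int_dvd_int_iff)
  ultimately show ?thesis using int_pow_eq[of A i j] by (metis A_closed dvd_diff_commute dvd_trans of_nat_numeral)
qed

lemma B_pow_mod: "2 ^ (n + 1) dvd i - j \<Longrightarrow> B [^] (i::int) = B [^] (j::int)"
proof -
  assume "2 ^ (n + 1) dvd i - j"
  then have "int (2 ^ (n + 1)) dvd i - j" by simp
  moreover have "int (ord B) dvd int (2 ^ (n + 1))" using B1 pow_eq_id[of B "2 ^ (n + 1)"] by (simp only: B_closed int_dvd_int_iff)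
  ultimately show ?thesis using int_pow_eq[of B i j] by (metis B_closed dvd_diff_commute dvd_trans)
qed

definition nf :: "nat \<times> nat \<times> nat \<Rightarrow> 'a" where
  "nf = (\<lambda>(x, y, z). B [^] x \<otimes> (C [^] y \<otimes> A [^] z))"

text \<open>\<open>C\<close> gets only two exponents because \<open>C^2\<close> is absorbed by
  \<open>A\<close>; this makes 2^(n+1) times 2 times 4 forms.\<close>

definition nf_dom :: "(nat \<times> nat \<times> nat) set" where
  "nf_dom = {..<2 ^ (n + 1)} \<times> {..<2} \<times> {..<4}"

lemma card_nf_dom: "card nf_dom = 2 ^ (n + 4)"
  by (simp add: nf_dom_def card_cartesian_product power_add)

lemma carrier_nf: "carrier G = nf ` nf_dom"
proof
  show "nf ` nf_dom \<subseteq> carrier G" by (auto simp: nf_def)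
  show "carrier G \<subseteq> nf ` nf_dom"
  proof
    fix g assume "g \<in> carrier G"
    then have "g \<in> K 0" by (simp add: K_0)
    then obtain x z :: int and y :: nat where g: "g = B [^] x \<otimes> (C [^] y \<otimes> A [^] z)"
      by (auto simp: K_def)
    define x' where "x' = nat (x mod 2 ^ (n + 1))"
    define q r where "q = y div 2" and "r = y mod 2"
    define z' where "z' = nat ((int (2 * q) + z) mod 4)"
    have x': "B [^] x = B [^] x'"
    proof -
      have "int x' = x mod 2 ^ (n + 1)" by (simp add: x'_def)
      then have "2 ^ (n + 1) dvd x - int x'" by (simp only: dvd_minus_mod)
      from B_pow_mod[OF this] show ?thesis by (simp add: int_pow_int)
    qed
    \<comment> \<open>The even part of the exponent of \<open>C\<close> is transferred to
      \<open>A\<close>.\<close>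
    have "y = r + 2 * q" by (simp add: q_def r_def)
    then have "C [^] y = C [^] r \<otimes> (C [^] (2::nat)) [^] q"
      by (simp add: nat_pow_pow nat_pow_mult)
    then have "C [^] y = C [^] r \<otimes> A [^] int (2 * q)"
      unfolding C2 by (simp add: nat_pow_pow int_pow_int del: of_nat_mult)
    then have "C [^] y \<otimes> A [^] z = C [^] r \<otimes> A [^] (int (2 * q) + z)"
      by (simp add: m_assoc int_pow_add del: of_nat_mult)
    also have "A [^] (int (2 * q) + z) = A [^] z'"
    proof -
      have "int z' = (int (2 * q) + z) mod 4" unfolding z'_def by simp
      then have "4 dvd (int (2 * q) + z) - int z'" by (simp only: dvd_minus_mod)
      from A_pow_mod[OF this] show ?thesis by (simp add: int_pow_int)
    qed
    finally have "g = nf (x', r, z')" unfolding g x' nf_def by simp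
    moreover have "(x', r, z') \<in> nf_dom"
      unfolding nf_dom_def x'_def r_def z'_def by (auto simp: nat_less_iff)
    ultimately show "g \<in> nf ` nf_dom" by blast
  qed
qed

lemma order_le: "order G \<le> 2 ^ (n + 4)"
  unfolding order_def carrier_nf using card_image_le[of nf_dom nf] card_nf_dom by (simp add: nf_dom_def)

text \<open>Crossing \<open>B^(2^n)\<close> with \<open>A\<close> creates \<open>C^(-2^n)\<close>,
  trivial since 4 divides 2^n, and a power of \<open>B\<close> whose exponent is 2^n times an odd
  number, hence 2^n modulo 2^(n+1).\<close>

lemma Z_commute_A: "B [^] (2 ^ n :: int) \<otimes> A = A \<otimes> B [^] (2 ^ n :: int)"
proof -
  have d4: "(4::int) dvd 2 ^ n" using le_imp_power_dvd[of 2 n "2::int"] n_ge by simp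
  then have "4 dvd \<beta> - 1" unfolding beta by simp
  then obtain u where u: "odd u" "gsum \<beta> (2 ^ n) = 2 ^ n * u" using gsum_two_power by blast
  have C4: "C [^] (4::nat) = \<one>"
    using nat_pow_pow[of C 2 2] nat_pow_pow[of A 2 2] A4 by (simp add: C2)
  have "(4::nat) dvd 2 ^ n" using le_imp_power_dvd[of 2 n "2::nat"] n_ge by simp
  then obtain j where j: "(2::nat) ^ n = 4 * j" by blast
  have "inv C [^] (2 ^ n :: nat) = inv ((C [^] (4::nat)) [^] j)"
    unfolding nat_pow_pow[OF C_closed] by (simp add: j nat_pow_inv)
  then have iC: "inv C [^] (2 ^ n :: nat) = \<one>" unfolding C4 by simp
  have "odd \<beta>" by (rule odd_beta)
  then obtain w where w: "\<beta> * u = 2 * w + 1" using u(1) by (metis oddE even_mult_iff)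
  have "B [^] (\<beta> * gsum \<beta> (2 ^ n)) = B [^] (2 ^ n :: int)"
  proof (rule B_pow_mod)
    have "\<beta> * gsum \<beta> (2 ^ n) - 2 ^ n = 2 ^ n * (\<beta> * u - 1)" unfolding u(2) by (simp add: algebra_simps)
    also have "\<dots> = 2 ^ (n + 1) * w" unfolding w by simp
    finally show "2 ^ (n + 1) dvd \<beta> * gsum \<beta> (2 ^ n) - 2 ^ n" by simp
  qed
  then show ?thesis using B_pow_A[of "2 ^ n"] iC by simp
qed

lemma A2_commute_B: "A [^] (2::int) \<otimes> B = B \<otimes> A [^] (2::int)"
proof -
  have "4 dvd \<alpha> * gsum \<alpha> 2 - 0"
  proof -
    have "4 dvd \<alpha> + 1" using alpha by presburger
    moreover have "\<alpha> * gsum \<alpha> 2 = \<alpha> * (\<alpha> + 1)" by (simp add: gsum_def eval_nat_numeral)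
    ultimately show ?thesis by (metis diff_zero dvd_mult)
  qed
  from A_pow_mod[OF this] have "A [^] (\<alpha> * gsum \<alpha> 2) = \<one>" by simp
  then show ?thesis using A_pow_B[of 2] C2 int_pow_int[of G A 2] by simp
qed

lemma gcomm_C_A: "gcomm G C A = A [^] (2::int)"
proof -
  have "A [^] (-1::int) \<otimes> C [^] (1::nat) = C [^] (1::nat) \<otimes> A [^] (- 1 * \<alpha> ^ 1)" by (rule A_C_pow)
  then have iA: "inv A \<otimes> C = C \<otimes> A [^] (- \<alpha>)" by (simp add: int_pow_neg)
  have "gcomm G C A = inv C \<otimes> ((inv A \<otimes> C) \<otimes> A)" by (simp add: gcomm_def m_assoc)
  also have "\<dots> = A [^] (- \<alpha>) \<otimes> A"
    unfolding iA by (simp add: m_assoc[symmetric])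
  also have "\<dots> = A [^] (- \<alpha> + 1)" using int_pow_add[of A "- \<alpha>" 1] by simp
  also have "\<dots> = A [^] (2::int)"
  proof (rule A_pow_mod)
    show "4 dvd - \<alpha> + 1 - 2" using alpha by presburger
  qed
  finally show ?thesis .
qed

text \<open>\<beta> - 1 is 2^n modulo 2^(n+1) because t is odd, and the resulting power of
  \<open>B\<close> commutes with \<open>C\<close>.\<close>

lemma gcomm_C_B: "gcomm G C B = B [^] (2 ^ n :: int)"
proof -
  let ?Z = "B [^] (2 ^ n :: int)"
  have ZB: "?Z \<otimes> B = B \<otimes> ?Z"
    using int_pow_add[of B "2 ^ n" 1] int_pow_add[of B 1 "2 ^ n"] by (simp add: add.commute)
  have ZC: "?Z \<otimes> C = C \<otimes> ?Z" using Z_commute_A ZB by (intro commute_C) auto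
  obtain w where w: "t = 2 * w + 1" using odd_t by (auto elim: oddE)
  have "B [^] \<beta> = B [^] (1 + 2 ^ n :: int)"
    by (rule B_pow_mod) (simp add: beta w algebra_simps)
  then have "C \<otimes> B = (B \<otimes> ?Z) \<otimes> C"
    using C_B int_pow_add[of B 1 "2 ^ n"] by simp
  also have "\<dots> = (B \<otimes> C) \<otimes> ?Z" using ZC by (simp add: m_assoc)
  finally have "?Z = inv (B \<otimes> C) \<otimes> (C \<otimes> B)"
    using inv_solve_left[of ?Z "B \<otimes> C" "C \<otimes> B"] by simp
  then show ?thesis by (simp add: gcomm_def inv_mult_group m_assoc)
qed

text \<open>The upper bound uses the chain \<open>?T\<close>, \<open>?Y\<close>, 1, where
  \<open>?Y\<close> is central; the index of \<open>lcs\<close> is one less than the usual one. The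
  two memberships exhibit the elements that keep the series from ending earlier:
  \<open>C = [A,B]\<close>, and \<open>A^2 = [C,A]\<close>.\<close>

lemma lcs_bounds:
  shows "lcs G 3 = {\<one>}" "C \<in> lcs G 1" "A [^] (2::int) \<in> lcs G 2"
proof -
  let ?Z = "B [^] (2 ^ n :: int)" and ?D = "A [^] (2::int)"
  let ?Y = "generate G {?D, ?Z}" and ?T = "generate G {C, ?D, ?Z}"
  have AB: "{A, B} \<subseteq> carrier G" by simp
  have ZB: "?Z \<otimes> B = B \<otimes> ?Z"
    using int_pow_add[of B "2 ^ n" 1] int_pow_add[of B 1 "2 ^ n"] by (simp add: add.commute)
  have A2A: "?D \<otimes> A = A \<otimes> ?D"
    using int_pow_add[of A 2 1] int_pow_add[of A 1 2] by (simp add: add.commute)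
  have one: "{\<one>} \<lhd> G" by (rule one_is_normal)
  have sub: "subgroup ?Y G" "subgroup ?T G" by (auto intro!: generate_is_subgroup)
  have gens: "gcomm G ?D A = \<one>" "gcomm G ?D B = \<one>" "gcomm G ?Z A = \<one>" "gcomm G ?Z B = \<one>"
    using A2A A2_commute_B Z_commute_A ZB by (simp_all add: gcomm_eq_one_iff)
  have 0: "gcomm G x y = \<one>" if "x \<in> ?Y" "y \<in> carrier G" for x y
    using gcomm_generate_in_normal[OF one _ AB generated _ that] gens by fastforce
  have normZ0: "?Y \<lhd> G"
    by (rule normal_if_gcomm_closed[OF sub(1)]) (use 0 sub(1) in \<open>auto simp: subgroup.one_closed\<close>)
  have incl: "?D \<in> ?Y" "?Z \<in> ?Y" by (auto intro: generate.incl)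
  have 1: "gcomm G x y \<in> ?Y" if "x \<in> ?T" "y \<in> carrier G" for x y
  proof (rule gcomm_generate_in_normal[OF normZ0 _ AB generated _ that])
    fix r s assume "r \<in> {C, ?D, ?Z}" "s \<in> {A, B}"
    then show "gcomm G r s \<in> ?Y"
      using incl gens gcomm_C_A gcomm_C_B subgroup.one_closed[OF sub(1)] by auto
  qed auto
  have Z0T: "?Y \<subseteq> ?T" by (rule mono_generate) auto
  have normT: "?T \<lhd> G"
    by (rule normal_if_gcomm_closed[OF sub(2)]) (use 1 Z0T in blast)
  have CT: "C \<in> ?T" by (auto intro: generate.incl)
  have 2: "gcomm G x y \<in> ?T" if "x \<in> carrier G" "y \<in> carrier G" for x y
  proof (rule gcomm_generate_in_normal[OF normT AB AB generated])
    show "x \<in> generate G {A, B}" using that(1) generated by simp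
    fix r s assume "r \<in> {A, B}" "s \<in> {A, B}"
    then show "gcomm G r s \<in> ?T"
      using CT subgroup.one_closed[OF sub(2)] subgroup.m_inv_closed[OF sub(2) CT] gcomm_swap
      by (auto simp: gcomm_eq_one_iff C_def[symmetric] gcomm_eq_one_iff[THEN iffD2])
  qed (rule that(2))
  have l1: "lcs G (Suc 0) \<subseteq> ?T" by (rule lcs_Suc_subset[OF sub(2)]) (use 2 in auto)
  have l2: "lcs G (Suc (Suc 0)) \<subseteq> ?Y" by (rule lcs_Suc_subset[OF sub(1)]) (use 1 l1 in blast)
  have "lcs G (Suc (Suc (Suc 0))) \<subseteq> {\<one>}"
    by (rule lcs_Suc_subset[OF triv_subgroup]) (use 0 l2 in blast)
  moreover have "\<one> \<in> lcs G (Suc (Suc (Suc 0)))" by (simp only: lcs.simps generate.one)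
  ultimately show "lcs G 3 = {\<one>}" by (auto simp only: numeral_3_eq_3)
  have c1: "C \<in> lcs G (Suc 0)" unfolding C_def by (rule gcomm_in_lcs_Suc) auto
  then show "C \<in> lcs G 1" by (simp only: One_nat_def)
  show "?D \<in> lcs G 2" using gcomm_in_lcs_Suc[OF c1 A_closed] unfolding gcomm_C_A by (simp only: numeral_2_eq_2)
qed

lemma orders_and_class:
  assumes "order G = 2 ^ (n + 4)"
  shows "ord A = 4" "ord C = 4" "ord B = 2 ^ (n + 1)" "nilpotent_grp G" "nil_class G = 3"
proof -
  \<comment> \<open>A surjection between finite sets of equal size is injective, so only the zero
    exponents give the identity.\<close>
  have inj: "inj_on nf nf_dom"
    using assms unfolding order_def carrier_nf
    by (intro eq_card_imp_inj_on) (simp_all only: card_nf_dom, simp add: nf_dom_def)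
  have eq0: "p = (0, 0, 0)" if "p \<in> nf_dom" "nf p = \<one>" for p
  proof -
    have "nf (0, 0, 0) = \<one>" by (simp add: nf_def)
    moreover have "(0, 0, 0) \<in> nf_dom" by (simp add: nf_dom_def)
    ultimately show ?thesis using inj_onD[OF inj, of p "(0, 0, 0)"] that by simp
  qed
  have Apow: "k = 0" if "k < 4" "A [^] (k::nat) = \<one>" for k
    using eq0[of "(0, 0, k)"] that by (simp add: nf_def nf_dom_def)
  have Bpow: "k = 0" if "k < 2 ^ (n + 1)" "B [^] (k::nat) = \<one>" for k
    using eq0[of "(k, 0, 0)"] that by (simp add: nf_def nf_dom_def)
  have "ord A dvd 4" using A4 by (simp add: pow_eq_id)
  then have "ord A \<le> 4" "ord A \<noteq> 0" by (auto dest: dvd_imp_le intro: Nat.gr0I)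
  then show "ord A = 4" using Apow[of "ord A"] by force
  have "ord B dvd 2 ^ (n + 1)" using B1 pow_eq_id[OF B_closed] by blast
  then have "ord B \<le> 2 ^ (n + 1)" "ord B \<noteq> 0" by (auto dest: dvd_imp_le intro: Nat.gr0I)
  then show "ord B = 2 ^ (n + 1)" using Bpow[of "ord B"] by (metis B_closed le_neq_implies_less pow_ord_eq_1)
  have A2: "A [^] (2::nat) \<noteq> \<one>" using Apow[of 2] by auto
  have "C [^] (4::nat) = \<one>"
    using nat_pow_pow[of C 2 2] nat_pow_pow[of A 2 2] A4 by (simp add: C2)
  then have "ord C dvd 2 ^ 2" by (simp add: pow_eq_id)
  then obtain i where i: "i \<le> 2" "ord C = 2 ^ i" using divides_primepow_nat[OF two_is_prime_nat] by blast
  \<comment> \<open>The order of \<open>C\<close> comes from \<open>C^2 = A^2\<close> being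
    non-trivial, not from the normal forms of its powers.\<close>
  have "\<not> ord C dvd 2 ^ 1" using A2 C2 pow_eq_id[of C 2] by simp
  then have "\<not> i \<le> 1" using i(2) le_imp_power_dvd by metis
  then have "i = 2" using i(1) by simp
  then show "ord C = 4" using i(2) by simp
  show "nilpotent_grp G" unfolding nilpotent_grp_def using lcs_bounds(1) by blast
  have A2i: "A [^] (2::int) \<noteq> \<one>" using A2 int_pow_int[of G A 2] by simp
  have A1: "A \<noteq> \<one>" using A2 by auto
  have C1: "C \<noteq> \<one>" using A2 C2 by auto
  show "nil_class G = 3" unfolding nil_class_def
  proof (rule Least_equality[where P = "\<lambda>c. lcs G c = {\<one>}", OF lcs_bounds(1)])
    fix c assume c: "lcs G c = {\<one>}"
    show "3 \<le> c"
    proof (rule ccontr)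
      assume "\<not> 3 \<le> c"
      then consider "c = 0" | "c = 1" | "c = 2" by linarith
      then show False
      proof cases
        case 1
        then have "A \<in> lcs G c" using A_closed by (simp only: lcs.simps)
        then show False using A1 unfolding c by blast
      next
        case 2
        then show False using lcs_bounds(2) C1 c by blast
      next
        case 3
        then show False using lcs_bounds(3) A2i c by blast
      qed
    qed
  qed
qed

end

section \<open>Presented groups\<close>

lemma word_eqv_context: "word_eqv R u v \<Longrightarrow> word_eqv R (x @ u @ y) (x @ v @ y)"
proof (induction rule: word_eqv.induct)
  case (refl w)
  then show ?case by (rule word_eqv.refl)
next
  case (sym u v)
  then show ?case using word_eqv.sym by blast
next
  case (trans u v w)
  then show ?case using word_eqv.trans by blast
next
  case (cancel u g e v)
  then show ?case using word_eqv.cancel[of R "x @ u" g e "v @ y"] by simp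
next
  case (relator r u v)
  then show ?case using word_eqv.relator[of r R "x @ u" "v @ y"] by simp
qed

lemma word_eqv_append:
  assumes "word_eqv R u u'" "word_eqv R v v'"
  shows "word_eqv R (u @ v) (u' @ v')"
  using word_eqv_context[OF assms(1), of "[]" v] word_eqv_context[OF assms(2), of u' "[]"] word_eqv.trans
  by auto

lemma wclass_eq_iff: "wclass R u = wclass R v \<longleftrightarrow> word_eqv R u v"
  unfolding wclass_def by (auto intro: word_eqv.refl word_eqv.sym word_eqv.trans)

text \<open>Multiplication of classes is concatenation of words; the closure under equivalence in
  \<open>pres_mult\<close> makes the result a full class.\<close>

lemma pres_mult_wclass: "pres_mult R (wclass R u) (wclass R v) = wclass R (u @ v)"
proof -
  have "z \<in> pres_mult R (wclass R u) (wclass R v) \<longleftrightarrow> z \<in> wclass R (u @ v)" for z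
    unfolding pres_mult_def wclass_def
    by (auto intro: word_eqv.refl word_eqv.trans word_eqv_append)
  then show ?thesis by blast
qed

lemma word_eqv_inv_word: "word_eqv R (inv_word w @ w) []"
proof (induction w)
  case Nil
  then show ?case by (simp add: inv_word_def word_eqv.refl)
next
  case (Cons l w)
  obtain g e where l: "l = (g, e)" by (cases l)
  have "inv_word (l # w) @ l # w = inv_word w @ [(g, \<not> e), (g, \<not> \<not> e)] @ w"
    by (simp add: inv_word_def l)
  then show ?case using word_eqv.cancel[of R "inv_word w" g "\<not> e" w] Cons word_eqv.trans by metis
qed

lemma pres_group_simps [simp]:
  "carrier (pres_group R) = range (wclass R)"
  "monoid.mult (pres_group R) = pres_mult R"
  "one (pres_group R) = wclass R []"
  by (simp_all add: pres_group_def)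

lemma group_pres_group: "group (pres_group R)"
proof (rule groupI)
  fix x assume "x \<in> carrier (pres_group R)"
  then obtain w where w: "x = wclass R w" by auto
  then have "wclass R (inv_word w) \<otimes>\<^bsub>pres_group R\<^esub> x = \<one>\<^bsub>pres_group R\<^esub>"
    by (simp add: pres_mult_wclass wclass_eq_iff word_eqv_inv_word)
  then show "\<exists>y\<in>carrier (pres_group R). y \<otimes>\<^bsub>pres_group R\<^esub> x = \<one>\<^bsub>pres_group R\<^esub>" by auto
qed (auto simp: pres_mult_wclass)

section \<open>Evaluation of words and the universal property\<close>

context group
begin

fun wev :: "'a \<Rightarrow> 'a \<Rightarrow> word \<Rightarrow> 'a" where
  "wev a b [] = \<one>"
| "wev a b ((g, e) # w) =
    (if e then inv (if g then b else a) else (if g then b else a)) \<otimes> wev a b w"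

lemma wev_closed [simp]: "a \<in> carrier G \<Longrightarrow> b \<in> carrier G \<Longrightarrow> wev a b w \<in> carrier G"
  by (induction w) auto

lemma wev_append:
  "a \<in> carrier G \<Longrightarrow> b \<in> carrier G \<Longrightarrow> wev a b (u @ v) = wev a b u \<otimes> wev a b v"
  by (induction u) (auto simp: m_assoc)

lemma wev_inv_word:
  assumes "a \<in> carrier G" "b \<in> carrier G"
  shows "wev a b (inv_word w) = inv (wev a b w)"
proof (induction w)
  case (Cons l w)
  obtain g e where l: "l = (g, e)" by (cases l)
  have "inv_word (l # w) = inv_word w @ [(g, \<not> e)]" by (simp add: inv_word_def l)
  then show ?case using assms Cons by (simp add: wev_append l inv_mult_group)
qed (simp add: inv_word_def)

lemma wev_replicate:
  assumes "a \<in> carrier G" "b \<in> carrier G"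
  shows "wev a b (concat (replicate k w)) = wev a b w [^] k"
proof (induction k)
  case (Suc k)
  then show ?case using assms nat_pow_Suc2[of "wev a b w" k] by (simp add: wev_append)
qed simp

lemma wev_wpow:
  assumes "a \<in> carrier G" "b \<in> carrier G"
  shows "wev a b (wpow w k) = wev a b w [^] k"
proof (cases k rule: int_cases)
  case (nonneg j)
  have "wpow w (int j) = concat (replicate j w)" by (simp add: wpow_def)
  then show ?thesis using wev_replicate[OF assms] unfolding nonneg by (simp only: int_pow_int)
next
  case (neg j)
  have "nat (- (- int (Suc j))) = Suc j" by simp
  then have "wpow w (- int (Suc j)) = concat (replicate (Suc j) (inv_word w))"
    by (simp only: wpow_def) simp
  then have "wev a b (wpow w (- int (Suc j))) = inv (wev a b w) [^] Suc j"
    by (simp only: wev_replicate[OF assms] wev_inv_word[OF assms])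
  then show ?thesis
    unfolding neg using assms by (simp only: int_pow_neg_int nat_pow_inv wev_closed)
qed

text \<open>Evaluation is constant on classes once all relators evaluate to the identity; this is
  what makes \<open>pres_group_hom\<close> well defined.\<close>

lemma wev_word_eqv:
  assumes ab: "a \<in> carrier G" "b \<in> carrier G" and R: "\<And>r. r \<in> R \<Longrightarrow> wev a b r = \<one>"
    and "word_eqv R u v"
  shows "wev a b u = wev a b v"
  using assms(4)
proof (induction rule: word_eqv.induct)
  case (cancel u g e v)
  have "wev a b [(g, e), (g, \<not> e)] = \<one>" using ab by simp
  then show ?case using ab wev_append[OF ab] by (metis l_one wev_closed)
next
  case (relator r u v)
  then show ?case using ab R by (simp add: wev_append)
qed auto

text \<open>The bridge between the relators as words and the locale, used in both directions: for
  the presented group itself and for its homomorphisms to other groups.\<close>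

lemma wev_relG_iff:
  assumes ab: "a \<in> carrier G" "b \<in> carrier G"
  shows "(\<forall>r\<in>relG \<alpha> \<beta>. wev a b r = \<one>) \<longleftrightarrow> macdonald G a b \<alpha> \<beta>"
proof -
  have A: "wev a b wA = a" and B: "wev a b wB = b" using ab by (simp_all add: wA_def wB_def)
  have comm: "wev a b (wcomm u v) = gcomm G (wev a b u) (wev a b v)" for u v
    using ab by (simp add: wcomm_def gcomm_def wev_append wev_inv_word m_assoc)
  have conj: "wev a b (wconj u v) = inv (wev a b v) \<otimes> wev a b u \<otimes> wev a b v" for u v
    using ab by (simp add: wconj_def wev_append wev_inv_word m_assoc)
  have eq: "x \<otimes> inv y = \<one> \<longleftrightarrow> x = y" if "x \<in> carrier G" "y \<in> carrier G" for x y
    using that inv_solve_right'[of \<one> x y] by simp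
  have cl: "gcomm G a b \<in> carrier G" "gcomm G b a \<in> carrier G" using ab by (simp_all add: gcomm_def)
  show ?thesis
    unfolding relG_def macdonald_def macdonald_axioms_def using ab cl group_axioms
    by (simp add: wev_append wev_inv_word wev_wpow conj comm A B eq)
qed

end

text \<open>Evaluating at the generating classes is the quotient map from words, which yields both
  generation and the relations in the presented group.\<close>

lemma wev_pres_group:
  "group.wev (pres_group R) (wclass R wA) (wclass R wB) w = wclass R w"
proof -
  interpret group "pres_group R" by (rule group_pres_group)
  have inv: "inv\<^bsub>pres_group R\<^esub> (wclass R [(g, False)]) = wclass R [(g, True)]" for g
  proof (rule inv_equality)
    show "wclass R [(g, True)] \<otimes>\<^bsub>pres_group R\<^esub> wclass R [(g, False)] = \<one>\<^bsub>pres_group R\<^esub>"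
      using word_eqv.cancel[of R "[]" g True "[]"] by (simp add: pres_mult_wclass wclass_eq_iff)
  qed auto
  show ?thesis
  proof (induction w)
    case (Cons l w)
    obtain g e where l: "l = (g, e)" by (cases l)
    show ?case using Cons by (cases g; cases e) (simp_all add: l wA_def wB_def inv pres_mult_wclass)
  qed simp
qed

lemma pres_group_generated:
  "carrier (pres_group R) = generate (pres_group R) {wclass R wA, wclass R wB}"
proof -
  interpret group "pres_group R" by (rule group_pres_group)
  let ?S = "{wclass R wA, wclass R wB}"
  have S: "?S \<subseteq> carrier (pres_group R)" by auto
  have sub: "subgroup (generate (pres_group R) ?S) (pres_group R)"
    by (rule generate_is_subgroup[OF S])
  have gens: "wclass R wA \<in> generate (pres_group R) ?S" "wclass R wB \<in> generate (pres_group R) ?S"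
    by (auto intro: generate.incl)
  have "wev (wclass R wA) (wclass R wB) w \<in> generate (pres_group R) ?S" for w
  proof (induction w)
    case Nil
    then show ?case using subgroup.one_closed[OF sub] by (simp only: wev.simps)
  next
    case (Cons l w)
    obtain g e where l: "l = (g, e)" by (cases l)
    show ?case unfolding l wev.simps
      using gens subgroup.m_inv_closed[OF sub] by (intro subgroup.m_closed[OF sub Cons[unfolded l]] subgroup.m_closed[OF sub _ Cons]) (auto split: if_splits)
  qed
  then show ?thesis using wev_pres_group[of R] generate_in_carrier[OF S] by auto
qed

lemma pres_group_hom:
  assumes "group H" "a \<in> carrier H" "b \<in> carrier H" "\<And>r. r \<in> R \<Longrightarrow> group.wev H a b r = \<one>\<^bsub>H\<^esub>"
  obtains \<phi> where "\<phi> \<in> hom (pres_group R) H" "\<And>w. \<phi> (wclass R w) = group.wev H a b w"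
proof
  interpret H: group H by fact
  \<comment> \<open>A homomorphism on classes, defined through a chosen representative; the value is
    independent of the choice by \<open>wev_word_eqv\<close>.\<close>
  let ?\<phi> = "\<lambda>S. H.wev a b (SOME w. w \<in> S)"
  show *: "?\<phi> (wclass R w) = H.wev a b w" for w
  proof -
    have "(SOME v. v \<in> wclass R w) \<in> wclass R w"
      by (rule someI[of _ w]) (simp add: wclass_def word_eqv.refl)
    then have "word_eqv R w (SOME v. v \<in> wclass R w)" by (simp add: wclass_def)
    then show ?thesis using H.wev_word_eqv[OF assms(2-4)] by metis
  qed
  show "?\<phi> \<in> hom (pres_group R) H"
    unfolding hom_def by (auto simp: * pres_mult_wclass H.wev_append assms(2,3))
qed

lemma group_Gab: "group (Gab \<alpha> \<beta>)"
  by (simp add: Gab_def group_pres_group)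

lemma macdonald_Gab: "macdonald (Gab \<alpha> \<beta>) (elA \<alpha> \<beta>) (elB \<alpha> \<beta>) \<alpha> \<beta>"
proof -
  interpret group "Gab \<alpha> \<beta>" by (rule group_Gab)
  have cl: "elA \<alpha> \<beta> \<in> carrier (Gab \<alpha> \<beta>)" "elB \<alpha> \<beta> \<in> carrier (Gab \<alpha> \<beta>)"
    by (auto simp: Gab_def elA_def elB_def)
  have "wev (elA \<alpha> \<beta>) (elB \<alpha> \<beta>) r = \<one>\<^bsub>Gab \<alpha> \<beta>\<^esub>" if "r \<in> relG \<alpha> \<beta>" for r
    using word_eqv.relator[OF that, of "[]" "[]"]
    by (simp add: Gab_def elA_def elB_def wev_pres_group wclass_eq_iff)
  then show ?thesis using wev_relG_iff[OF cl] by blast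
qed

lemma elC_eq: "elC \<alpha> \<beta> = macdonald.C (Gab \<alpha> \<beta>) (elA \<alpha> \<beta>) (elB \<alpha> \<beta>)"
proof -
  interpret M: macdonald "Gab \<alpha> \<beta>" "elA \<alpha> \<beta>" "elB \<alpha> \<beta>" \<alpha> \<beta> by (rule macdonald_Gab)
  let ?w = "M.wev (elA \<alpha> \<beta>) (elB \<alpha> \<beta>)"
  have w: "?w v = wclass (relG \<alpha> \<beta>) v" for v
    by (simp add: Gab_def elA_def elB_def wev_pres_group)
  have "elC \<alpha> \<beta> = ?w (wcomm wA wB)" by (simp add: w elC_def)
  also have "\<dots> = gcomm (Gab \<alpha> \<beta>) (?w wA) (?w wB)"
    by (simp only: wcomm_def gcomm_def M.wev_append[OF M.A_closed M.B_closed] M.wev_inv_word[OF M.A_closed M.B_closed]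
        M.m_assoc M.wev_closed M.A_closed M.B_closed M.inv_closed M.m_closed)
  also have "\<dots> = M.C" unfolding w M.C_def by (simp add: elA_def elB_def)
  finally show ?thesis .
qed

lemma Gab_generated: "carrier (Gab \<alpha> \<beta>) = generate (Gab \<alpha> \<beta>) {elA \<alpha> \<beta>, elB \<alpha> \<beta>}"
  unfolding Gab_def elA_def elB_def by (rule pres_group_generated)

lemma Gab_hom:
  assumes "macdonald H a b \<alpha> \<beta>"
  obtains \<phi> where "\<phi> \<in> hom (Gab \<alpha> \<beta>) H" "\<phi> (elA \<alpha> \<beta>) = a" "\<phi> (elB \<alpha> \<beta>) = b"
proof -
  interpret H: macdonald H a b \<alpha> \<beta> by fact
  obtain \<phi> where \<phi>: "\<phi> \<in> hom (Gab \<alpha> \<beta>) H" "\<And>w. \<phi> (wclass (relG \<alpha> \<beta>) w) = H.wev a b w"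
    using pres_group_hom[OF H.group_axioms H.A_closed H.B_closed, of "relG \<alpha> \<beta>"]
      H.wev_relG_iff[OF H.A_closed H.B_closed] assms unfolding Gab_def by metis
  show thesis
    by (rule that[OF \<phi>(1)]) (simp_all add: elA_def elB_def \<phi>(2) wA_def wB_def)
qed

text \<open>The first equation forces the given third element to be the commutator, so the relations
  can be checked as equations of products, without computing inverses.\<close>

lemma (in group) macdonaldI:
  assumes cl: "A \<in> carrier G" "B \<in> carrier G" "C \<in> carrier G"
    and AB: "A \<otimes> B = B \<otimes> (A \<otimes> C)" and AC: "A \<otimes> C = C \<otimes> A [^] (\<alpha>::int)" and CB: "C \<otimes> B = B [^] (\<beta>::int) \<otimes> C"
  shows "macdonald G A B \<alpha> \<beta>" "macdonald.C G A B = C"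
proof -
  have c: "gcomm G A B = C"
  proof -
    have "gcomm G A B = inv (B \<otimes> A) \<otimes> (A \<otimes> B)"
      using cl by (simp add: gcomm_def inv_mult_group m_assoc)
    also have "A \<otimes> B = (B \<otimes> A) \<otimes> C" using AB cl by (simp add: m_assoc)
    also have "inv (B \<otimes> A) \<otimes> ((B \<otimes> A) \<otimes> C) = C"
      using inv_solve_left'[of C "B \<otimes> A" "(B \<otimes> A) \<otimes> C"] cl by simp
    finally show ?thesis .
  qed
  have c': "gcomm G B A = inv C"
    unfolding c[symmetric] using cl by (simp add: gcomm_def inv_mult_group m_assoc)
  show mac: "macdonald G A B \<alpha> \<beta>"
  proof
    show "inv gcomm G A B \<otimes> A \<otimes> gcomm G A B = A [^] \<alpha>"
      unfolding c using inv_solve_left'[of "A [^] \<alpha>" C "A \<otimes> C"] cl AC by (simp add: m_assoc)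
    show "inv gcomm G B A \<otimes> B \<otimes> gcomm G B A = B [^] \<beta>"
      unfolding c' using inv_solve_right'[of "B [^] \<beta>" "C \<otimes> B" C] cl CB by simp
  qed (use cl in auto)
  show "macdonald.C G A B = C" by (simp add: macdonald.C_def[OF mac] c)
qed

section \<open>A permutation model\<close>

text \<open>The pair \<open>(x, (i, j))\<close> stands for \<open>b\<^sup>x a\<^sup>i c\<^sup>j\<close>, where \<open>a\<close> and \<open>c\<close> generate a quaternion
  group and \<open>b\<close> has order \<open>2m\<close> with \<open>m\<close> divisible by 4; the maps below are left multiplications.
  Conjugation by \<open>b\<close> sends \<open>a\<close> to \<open>ac\<close> and \<open>c\<close> to \<open>cb\<^sup>m\<close>, and \<open>b\<^sup>m\<close> is central.\<close>

definition quat_a :: "nat \<times> nat \<Rightarrow> nat \<times> nat" where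
  "quat_a = (\<lambda>(i, j). ((i + 1) mod 4, j))"

text \<open>Encodes \<open>c a^i = a^(-i) c\<close> and \<open>c^2 = a^2\<close>. The constants 4
  and 6 stand for 0 and 2 modulo 4, enlarged so that subtraction of natural numbers does not
  truncate.\<close>

definition quat_c :: "nat \<times> nat \<Rightarrow> nat \<times> nat" where
  "quat_c = (\<lambda>(i, j). if j = 0 then ((4 - i) mod 4, 1) else ((6 - i) mod 4, 0))"

definition quat :: "(nat \<times> nat) set" where
  "quat = {..<4} \<times> {..<2}"

lemma quat_cases:
  assumes "q \<in> quat"
  obtains "q = (0, 0)" | "q = (1, 0)" | "q = (2, 0)" | "q = (3, 0)"
    | "q = (0, 1)" | "q = (1, 1)" | "q = (2, 1)" | "q = (3, 1)"
proof -
  obtain i j where q: "q = (i, j)" "i < 4" "j < 2" using assms by (auto simp: quat_def)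
  have "i = 0 \<or> i = 1 \<or> i = 2 \<or> i = 3" "j = 0 \<or> j = 1" using q by auto
  then show thesis using that q(1) by auto
qed

lemma quat_rules [simp]:
  assumes "q \<in> quat"
  shows "quat_a q \<in> quat" "quat_c q \<in> quat"
    and "quat_a (quat_a (quat_a (quat_a q))) = q"
    and "quat_c (quat_c q) = quat_a (quat_a q)"
    and "quat_c (quat_a q) = quat_a (quat_a (quat_a (quat_c q)))"
  using assms by (cases rule: quat_cases; simp add: quat_a_def quat_c_def quat_def)+

section \<open>Left multiplications on the points\<close>

locale two_model =
  fixes m :: nat
  assumes m_pos: "m > 0" and m_four: "4 dvd m"
begin

definition shift :: "nat \<Rightarrow> nat \<Rightarrow> nat" where
  "shift k x = (x + k) mod (2 * m)"

lemma shift_less: "shift k x < 2 * m"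
  using m_pos by (simp add: shift_def)

lemma shift_shift: "shift k (shift l x) = shift (k + l) x"
  by (simp add: shift_def mod_add_left_eq add.assoc add.commute add.left_commute mod_simps)

lemma shift_full: "x < 2 * m \<Longrightarrow> shift (m + m) x = x" "shift (Suc (m + m)) x = shift (Suc 0) x"
proof -
  have "x + Suc (m + m) = (x + Suc 0) + 2 * m" by simp
  then show "shift (Suc (m + m)) x = shift (Suc 0) x" unfolding shift_def by (simp only: mod_add_self2)
qed (simp add: shift_def mult_2[symmetric])

lemma shift_mod_4: "shift k x mod 4 = (x + k) mod 4"
proof -
  have "4 dvd 2 * m" using m_four by simp
  then show ?thesis by (simp add: shift_def mod_mod_cancel)
qed

lemma shift_1_mod_4: "shift (Suc 0) x mod 4 = Suc x mod 4"
  by (simp add: shift_mod_4)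

lemma shift_m_mod_4: "shift m x mod 4 = x mod 4"
  using m_four by (simp add: shift_mod_4) presburger

definition Pts :: "(nat \<times> nat \<times> nat) set" where
  "Pts = {..<2 * m} \<times> quat"

lemma card_Pts: "card Pts = 16 * m"
  by (simp add: Pts_def quat_def card_cartesian_product)

text \<open>Left multiplication by a moves past b^x as the conjugate of a under b^x. These
  conjugates have period 4 in x: a, ac, a^3 b^m, a^3 c b^m. As 4 divides m, the shift by m preserves
  x modulo 4.\<close>

definition pa :: "nat \<times> nat \<times> nat \<Rightarrow> nat \<times> nat \<times> nat" where
  "pa = (\<lambda>(x, q). let r = (if x mod 4 = 1 \<or> x mod 4 = 3 then quat_c q else q) in
     if x mod 4 = 0 \<or> x mod 4 = 1 then (x, quat_a r) else (shift m x, quat_a (quat_a (quat_a r))))"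

definition pb :: "nat \<times> nat \<times> nat \<Rightarrow> nat \<times> nat \<times> nat" where
  "pb = (\<lambda>(x, q). (shift 1 x, q))"

text \<open>The conjugate of c under b^x is c b^(mx), so only odd x produce a shift by m. The parity
  is written modulo 4 to fit the case distinction \<open>Pts_cases\<close>.\<close>

definition pc :: "nat \<times> nat \<times> nat \<Rightarrow> nat \<times> nat \<times> nat" where
  "pc = (\<lambda>(x, q). (if x mod 4 = 1 \<or> x mod 4 = 3 then shift m x else x, quat_c q))"

lemma Pts_cases:
  assumes "p \<in> Pts"
  obtains x q where "p = (x, q)" "x < 2 * m" "q \<in> quat" "x mod 4 = 0"
    | x q where "p = (x, q)" "x < 2 * m" "q \<in> quat" "x mod 4 = 1"
    | x q where "p = (x, q)" "x < 2 * m" "q \<in> quat" "x mod 4 = 2"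
    | x q where "p = (x, q)" "x < 2 * m" "q \<in> quat" "x mod 4 = 3"
proof -
  obtain x q where p: "p = (x, q)" "x < 2 * m" "q \<in> quat" using assms by (auto simp: Pts_def)
  have "x mod 4 = 0 \<or> x mod 4 = 1 \<or> x mod 4 = 2 \<or> x mod 4 = 3" by presburger
  then show thesis using that(1)[OF p] that(2)[OF p] that(3)[OF p] that(4)[OF p] by (elim disjE)
qed

lemma Suc_mod_4:
  "x mod 4 = 0 \<Longrightarrow> Suc x mod 4 = 1" "x mod 4 = 1 \<Longrightarrow> Suc x mod 4 = 2"
  "x mod 4 = 2 \<Longrightarrow> Suc x mod 4 = 3" "x mod 4 = 3 \<Longrightarrow> Suc x mod 4 = 0" for x :: nat
  by presburger+

lemma perm_closed: "p \<in> Pts \<Longrightarrow> pa p \<in> Pts" "p \<in> Pts \<Longrightarrow> pb p \<in> Pts" "p \<in> Pts \<Longrightarrow> pc p \<in> Pts"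
  by (auto simp: Pts_def pa_def pb_def pc_def Let_def shift_less)

lemma pb_pow: "p \<in> Pts \<Longrightarrow> (pb ^^ k) p = (shift k (fst p), snd p)"
proof (induction k)
  case 0
  then show ?case by (auto simp: Pts_def shift_def)
next
  case (Suc k)
  then show ?case by (simp add: pb_def shift_shift)
qed

lemma pa_pow_4: "p \<in> Pts \<Longrightarrow> pa (pa (pa (pa p))) = p"
  by (cases rule: Pts_cases, assumption)
    (simp_all add: pa_def shift_m_mod_4 shift_shift shift_full)

lemma pa_funpow: "p \<in> Pts \<Longrightarrow> (pa ^^ 4) p = p" "(pa ^^ 3) p = pa (pa (pa p))"
  using pa_pow_4 by (simp_all add: numeral_eq_Suc)

lemma pc_pow_4: "p \<in> Pts \<Longrightarrow> pc (pc (pc (pc p))) = p"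
  by (cases rule: Pts_cases, assumption)
    (simp_all add: pc_def shift_m_mod_4 shift_shift shift_full)

lemma pa_pb: "p \<in> Pts \<Longrightarrow> pa (pb p) = pb (pa (pc p))"
  by (cases rule: Pts_cases, assumption)
    (simp_all add: pa_def pb_def pc_def shift_m_mod_4 shift_1_mod_4 Suc_mod_4 shift_shift shift_full add.commute)

lemma pa_pc: "p \<in> Pts \<Longrightarrow> pa (pc p) = pc (pa (pa (pa p)))"
  by (cases rule: Pts_cases, assumption)
    (simp_all add: pa_def pc_def shift_m_mod_4 shift_shift shift_full)

lemma pc_pb: "p \<in> Pts \<Longrightarrow> pc (pb p) = (pb ^^ (1 + m)) (pc p)"
  by (simp only: pb_pow perm_closed) (cases rule: Pts_cases, assumption,
    simp_all add: pb_def pc_def shift_m_mod_4 shift_1_mod_4 Suc_mod_4 shift_shift shift_full add.assoc add.commute)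

text \<open>When the (k+1)-st iterate is the identity, the k-th iterate is the inverse; no formula
  for inverse permutations is required.\<close>

lemma Bij_perm:
  assumes "\<And>p. p \<in> Pts \<Longrightarrow> f p \<in> Pts" "\<And>p. p \<in> Pts \<Longrightarrow> (f ^^ Suc k) p = p"
  shows "restrict f Pts \<in> Bij Pts"
proof -
  have cl: "(f ^^ j) p \<in> Pts" if "p \<in> Pts" for p j using that assms(1) by (induction j) auto
  have "bij_betw f Pts Pts"
  proof (rule bij_betwI[where g = "f ^^ k"])
    show "f \<in> Pts \<rightarrow> Pts" "f ^^ k \<in> Pts \<rightarrow> Pts" using assms(1) cl by auto
    fix p assume p: "p \<in> Pts"
    show "(f ^^ k) (f p) = p" using assms(2)[OF p] by (simp only: funpow_Suc_right o_apply)
    show "f ((f ^^ k) p) = p" using assms(2)[OF p] by simp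
  qed
  then show ?thesis by (simp add: Bij_def)
qed

text \<open>Elements of \<open>Bij\<close> have to be extensional, hence the restriction to
  \<open>Pts\<close>.\<close>

definition "PA = restrict pa Pts"
definition "PB = restrict pb Pts"
definition "PC = restrict pc Pts"

lemma perms_closed: "PA \<in> Bij Pts" "PB \<in> Bij Pts" "PC \<in> Bij Pts"
proof -
  show "PA \<in> Bij Pts" unfolding PA_def
    by (rule Bij_perm[where k = 3]) (simp_all add: perm_closed pa_pow_4 eval_nat_numeral)
  show "PC \<in> Bij Pts" unfolding PC_def
    by (rule Bij_perm[where k = 3]) (simp_all add: perm_closed pc_pow_4 eval_nat_numeral)
  have "Suc (2 * m - 1) = m + m" using m_pos by simp
  then have "(pb ^^ Suc (2 * m - 1)) p = p" if "p \<in> Pts" for p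
    using that by (simp only: pb_pow) (auto simp: Pts_def shift_full)
  then show "PB \<in> Bij Pts" unfolding PB_def
    by (intro Bij_perm[where k = "2 * m - 1"]) (simp_all only: perm_closed)
qed

lemma mult_apply:
  "\<lbrakk>f \<in> Bij Pts; g \<in> Bij Pts; p \<in> Pts\<rbrakk> \<Longrightarrow> (f \<otimes>\<^bsub>BijGroup Pts\<^esub> g) p = f (g p)"
  by (simp add: BijGroup_def compose_def)

lemma Bij_apply: "f \<in> Bij Pts \<Longrightarrow> p \<in> Pts \<Longrightarrow> f p \<in> Pts"
  using Bij_imp_funcset by blast

lemma Bij_eqI: "\<lbrakk>f \<in> Bij Pts; g \<in> Bij Pts; \<And>p. p \<in> Pts \<Longrightarrow> f p = g p\<rbrakk> \<Longrightarrow> f = g"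
  by (rule extensionalityI[of _ Pts]) (auto simp: Bij_def)

lemma pow_apply:
  assumes "f \<in> Bij Pts" "p \<in> Pts"
  shows "(f [^]\<^bsub>BijGroup Pts\<^esub> (k::nat)) p = (f ^^ k) p"
  using assms(2)
proof (induction k arbitrary: p)
  case 0
  then show ?case by (simp add: BijGroup_def)
next
  case (Suc k)
  interpret group "BijGroup Pts" by (rule group_BijGroup)
  have c: "carrier (BijGroup Pts) = Bij Pts" by (simp add: BijGroup_def)
  have "f [^]\<^bsub>BijGroup Pts\<^esub> k \<in> Bij Pts" using nat_pow_closed[of f k] assms(1) unfolding c by blast
  then show ?case using Suc assms(1) Bij_apply[OF assms(1) Suc.prems]
    by (simp add: mult_apply funpow_swap1)
qed

lemma restrict_funpow:
  assumes "\<And>p. p \<in> Pts \<Longrightarrow> f p \<in> Pts" "p \<in> Pts"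
  shows "(restrict f Pts ^^ k) p = (f ^^ k) p"
proof (induction k)
  case (Suc k)
  have "(f ^^ k) p \<in> Pts" using assms by (induction k) auto
  then show ?case using Suc by simp
qed simp

text \<open>The permutations satisfy \<open>PA^4 = 1\<close> and \<open>PB^(2m) = 1\<close>, so
  \<alpha> may be replaced by 3 and \<beta> by 1 + m; the relations then reduce to
  \<open>pa_pb\<close>, \<open>pa_pc\<close> and \<open>pc_pb\<close>, point by point.\<close>

lemma macdonald_model:
  fixes \<alpha> \<beta> :: int
  assumes \<alpha>: "\<alpha> mod 4 = 3" and \<beta>: "2 * int m dvd \<beta> - (1 + int m)"
  shows "macdonald (BijGroup Pts) PA PB \<alpha> \<beta>" "macdonald.C (BijGroup Pts) PA PB = PC"
proof -
  interpret S: group "BijGroup Pts" by (rule group_BijGroup)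
  let ?S = "BijGroup Pts"
  have c: "carrier ?S = Bij Pts" by (simp add: BijGroup_def)
  have pc': "f \<in> Bij Pts \<Longrightarrow> g \<in> Bij Pts \<Longrightarrow> f \<otimes>\<^bsub>?S\<^esub> g \<in> Bij Pts" for f g
    using S.m_closed[of f g] unfolding c .
  have pw: "f \<in> Bij Pts \<Longrightarrow> f [^]\<^bsub>?S\<^esub> (k::nat) \<in> Bij Pts" for f k
    using S.nat_pow_closed[of f k] unfolding c .
  have PAk: "(PA [^]\<^bsub>?S\<^esub> (k::nat)) p = (pa ^^ k) p" and PBk: "(PB [^]\<^bsub>?S\<^esub> (k::nat)) p = (pb ^^ k) p"
    if "p \<in> Pts" for k p
    using that perms_closed by (simp_all add: pow_apply PA_def PB_def restrict_funpow perm_closed)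
  have one: "\<one>\<^bsub>?S\<^esub> \<in> Bij Pts" using S.one_closed unfolding c .
  have one_apply: "\<one>\<^bsub>?S\<^esub> p = p" if "p \<in> Pts" for p using that by (simp add: BijGroup_def)
  have A4: "PA [^]\<^bsub>?S\<^esub> (4::nat) = \<one>\<^bsub>?S\<^esub>"
    by (rule Bij_eqI) (simp_all add: pw perms_closed one PAk one_apply pa_funpow)
  have B1: "PB [^]\<^bsub>?S\<^esub> (2 * m :: nat) = \<one>\<^bsub>?S\<^esub>"
  proof (rule Bij_eqI)
    fix p assume p: "p \<in> Pts"
    then show "(PB [^]\<^bsub>?S\<^esub> (2 * m :: nat)) p = \<one>\<^bsub>?S\<^esub> p"
      by (simp only: PBk pb_pow one_apply) (auto simp: Pts_def shift_full mult_2)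
  qed (simp_all add: pw perms_closed one)
  have "int (S.ord PA) dvd int 4" using A4 S.pow_eq_id[of PA 4] perms_closed unfolding c by (simp only: int_dvd_int_iff)
  moreover have "int 4 dvd \<alpha> - int 3" using \<alpha> by presburger
  ultimately have Aa: "PA [^]\<^bsub>?S\<^esub> \<alpha> = PA [^]\<^bsub>?S\<^esub> (3::nat)"
    using S.int_pow_eq[of PA \<alpha> "int 3"] perms_closed unfolding c int_pow_int by (metis dvd_diff_commute dvd_trans)
  have "int (S.ord PB) dvd int (2 * m)" using B1 S.pow_eq_id[of PB "2 * m"] perms_closed unfolding c by (simp only: int_dvd_int_iff)
  moreover have "int (2 * m) dvd \<beta> - int (1 + m)" using \<beta> by simp
  ultimately have Bb: "PB [^]\<^bsub>?S\<^esub> \<beta> = PB [^]\<^bsub>?S\<^esub> (1 + m)"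
    using S.int_pow_eq[of PB \<beta> "int (1 + m)"] perms_closed unfolding c int_pow_int by (metis dvd_diff_commute dvd_trans)
  have ap: "PA p = pa p" "PB p = pb p" "PC p = pc p" if "p \<in> Pts" for p
    using that by (simp_all add: PA_def PB_def PC_def)
  note closed = perms_closed pc' pw perm_closed
  have 1: "PA \<otimes>\<^bsub>?S\<^esub> PB = PB \<otimes>\<^bsub>?S\<^esub> (PA \<otimes>\<^bsub>?S\<^esub> PC)"
    by (rule Bij_eqI) (simp_all add: closed mult_apply ap pa_pb)
  have 2: "PA \<otimes>\<^bsub>?S\<^esub> PC = PC \<otimes>\<^bsub>?S\<^esub> PA [^]\<^bsub>?S\<^esub> \<alpha>"
    unfolding Aa by (rule Bij_eqI) (simp_all add: closed mult_apply ap PAk pa_pc pa_funpow)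
  have 3: "PC \<otimes>\<^bsub>?S\<^esub> PB = PB [^]\<^bsub>?S\<^esub> \<beta> \<otimes>\<^bsub>?S\<^esub> PC"
    unfolding Bb by (rule Bij_eqI) (simp_all only: closed mult_apply ap PBk pc_pb)
  show "macdonald ?S PA PB \<alpha> \<beta>" "macdonald.C ?S PA PB = PC"
    using S.macdonaldI[OF _ _ _ 1 2 3] perms_closed unfolding c by auto
qed

lemma pa_pow_base: "j < 2 \<Longrightarrow> i < 4 \<Longrightarrow> (pa ^^ i) (0, 0, j) = (0, i, j)"
  by (induction i) (auto simp: pa_def quat_a_def)

text \<open>The action through \<phi> is transitive on the 16m points, and an orbit length divides
  the order of the group.\<close>

lemma order_dvd:
  assumes "macdonald G A B \<alpha> \<beta>" "\<phi> \<in> hom G (BijGroup Pts)" "\<phi> A = PA" "\<phi> B = PB"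
    and \<alpha>: "\<alpha> mod 4 = 3" and \<beta>: "2 * int m dvd \<beta> - (1 + int m)"
  shows "16 * m dvd order G"
proof -
  interpret M: macdonald G A B \<alpha> \<beta> by fact
  interpret S: group "BijGroup Pts" by (rule group_BijGroup)
  interpret h: group_hom G "BijGroup Pts" \<phi> using assms(2) by unfold_locales
  interpret act: group_action G Pts \<phi> by (simp add: group_action_def h.group_hom_axioms)
  have \<phi>C: "\<phi> M.C = PC"
    using macdonald_hom(2)[OF assms(1) S.group_axioms assms(2)] macdonald_model(2)[OF \<alpha> \<beta>] by (simp add: assms(3,4))
  have c: "carrier (BijGroup Pts) = Bij Pts" by (simp add: BijGroup_def)
  have \<phi>Bij: "\<phi> g \<in> Bij Pts" if "g \<in> carrier G" for g using h.hom_closed[OF that] unfolding c .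
  have base: "(0, 0, 0) \<in> Pts" using m_pos by (simp add: Pts_def quat_def)
  have "Pts \<subseteq> orbit G \<phi> (0, 0, 0)"
  proof
    fix p assume "p \<in> Pts"
    then obtain x i j where p: "p = (x, i, j)" "x < 2 * m" "i < 4" "j < 2" by (auto simp: Pts_def quat_def)
    \<comment> \<open>A point (x, (i, j)) stands for b^x a^i c^j, so this element carries the base
      point, the identity, to it.\<close>
    let ?g = "B [^]\<^bsub>G\<^esub> x \<otimes>\<^bsub>G\<^esub> (A [^]\<^bsub>G\<^esub> i \<otimes>\<^bsub>G\<^esub> M.C [^]\<^bsub>G\<^esub> j)"
    have P0: "(0, 0, j) \<in> Pts" "(0, i, j) \<in> Pts" using p m_pos by (auto simp: Pts_def quat_def)
    have "(pc ^^ j) (0, 0, 0) = (0, 0, j)"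
      using p(4) by (cases "j = 0") (auto simp: pc_def quat_c_def less_2_cases_iff)
    then have Cj: "(PC [^]\<^bsub>BijGroup Pts\<^esub> j) (0, 0, 0) = (0, 0, j)"
      using perms_closed base by (simp add: pow_apply PC_def restrict_funpow perm_closed)
    have Ai: "(PA [^]\<^bsub>BijGroup Pts\<^esub> i) (0, 0, j) = (0, i, j)"
      using perms_closed P0 p by (simp add: pow_apply PA_def restrict_funpow perm_closed pa_pow_base)
    have Bx: "(PB [^]\<^bsub>BijGroup Pts\<^esub> x) (0, i, j) = (x, i, j)"
      using perms_closed P0 p by (simp add: pow_apply PB_def restrict_funpow perm_closed pb_pow shift_def)
    have pw: "f \<in> Bij Pts \<Longrightarrow> f [^]\<^bsub>BijGroup Pts\<^esub> (k::nat) \<in> Bij Pts" for f k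
      using S.nat_pow_closed[of f k] unfolding c .
    have mu: "f \<in> Bij Pts \<Longrightarrow> g \<in> Bij Pts \<Longrightarrow> f \<otimes>\<^bsub>BijGroup Pts\<^esub> g \<in> Bij Pts" for f g
      using S.m_closed[of f g] unfolding c .
    have "\<phi> ?g (0, 0, 0) = p"
      by (simp add: h.hom_nat_pow assms(3,4) \<phi>C mult_apply pw mu perms_closed base Cj Ai Bx p(1))
    then show "p \<in> orbit G \<phi> (0, 0, 0)" unfolding orbit_def by (intro CollectI exI[of _ ?g]) auto
  qed
  moreover have "orbit G \<phi> (0, 0, 0) \<subseteq> Pts"
    unfolding orbit_def using \<phi>Bij base Bij_apply by blast
  ultimately have "card (orbit G \<phi> (0, 0, 0)) = 16 * m" using card_Pts by simp
  then show ?thesis using act.orbit_stabilizer_theorem[OF base] by (metis dvd_triv_left)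
qed

end

section \<open>The Sylow 2-subgroup\<close>

context group
begin

lemma pow_card_subgroup:
  assumes "subgroup P G" "x \<in> P"
  shows "x [^] card P = \<one>"
proof -
  interpret P: group "G\<lparr>carrier := P\<rparr>" by (rule subgroup_imp_group[OF assms(1)])
  show ?thesis
    using P.pow_order_eq_1[of x] assms(2) by (simp add: order_def nat_pow_consistent[symmetric])
qed

lemma ord_subgroup:
  assumes "subgroup P G" "x \<in> P"
  shows "group.ord (G\<lparr>carrier := P\<rparr>) x = ord x"
proof -
  interpret P: group "G\<lparr>carrier := P\<rparr>" by (rule subgroup_imp_group[OF assms(1)])
  have x: "x \<in> carrier G" using subgroup.mem_carrier[OF assms] .
  have "x [^] k = \<one> \<longleftrightarrow> P.ord x dvd k" for k :: nat
    using P.pow_eq_id[of x k] assms(2) by (simp add: nat_pow_consistent[symmetric])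
  then show ?thesis using ord_unique[OF x, of "P.ord x"] by simp
qed

text \<open>By coprimality \<open>P\<close> meets \<open>N\<close> trivially, so \<open>P\<close>
  embeds into the quotient and, by counting, fills it. The projection is the quotient map followed
  by the inverse of this bijection.\<close>

lemma projection_if_normal_complement:
  assumes fin: "finite (carrier G)" and N: "N \<lhd> G" and P: "subgroup P G"
    and coprime: "coprime (card P) (card N)" and card: "order (G Mod N) = card P"
  shows "\<exists>\<pi>. \<pi> \<in> hom G (G\<lparr>carrier := P\<rparr>) \<and> (\<forall>x\<in>P. \<pi> x = x)"
proof -
  interpret N: normal N G by fact
  interpret Q: group "G Mod N" by (rule N.factorgroup_is_group)
  define h where "h = (\<lambda>x. N #> x)"
  have hom: "h \<in> hom G (G Mod N)" unfolding h_def by (rule N.r_coset_hom_Mod)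
  interpret h: group_hom G "G Mod N" h using hom by unfold_locales
  have Pc: "x \<in> carrier G" if "x \<in> P" for x using subgroup.mem_carrier[OF P that] .
  have trivial: "x = \<one>" if "x \<in> P" "x \<in> N" for x
  proof -
    have "ord x dvd card P" "ord x dvd card N"
      using pow_card_subgroup[OF P that(1)] pow_card_subgroup[OF N.subgroup_axioms that(2)] Pc[OF that(1)]
      by (simp_all add: pow_eq_id)
    then have "ord x = 1" using coprime by (metis coprime_common_divisor_nat)
    then show ?thesis using ord_eq_1[OF Pc[OF that(1)]] by simp
  qed
  have inj: "inj_on h P"
  proof (rule inj_onI)
    fix x y assume xy: "x \<in> P" "y \<in> P" "h x = h y"
    have "h (x \<otimes> inv y) = h y \<otimes>\<^bsub>G Mod N\<^esub> inv\<^bsub>G Mod N\<^esub> h y"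
      using xy Pc by (simp only: h.hom_mult h.hom_inv inv_closed)
    also have "\<dots> = \<one>\<^bsub>G Mod N\<^esub>" by (rule Q.r_inv[OF h.hom_closed[OF Pc[OF xy(2)]]])
    finally have "h (x \<otimes> inv y) = \<one>\<^bsub>G Mod N\<^esub>" .
    then have "x \<otimes> inv y \<in> N"
      using coset_join1[of N "x \<otimes> inv y"] xy Pc N.subgroup_axioms by (simp add: h_def)
    moreover have "x \<otimes> inv y \<in> P"
      using xy subgroup.m_closed[OF P] subgroup.m_inv_closed[OF P] by blast
    ultimately have "x \<otimes> inv y = \<one>" by (intro trivial)
    then show "x = y" using inv_solve_right'[of \<one> x y] xy Pc by simp
  qed
  have finQ: "finite (carrier (G Mod N))" using fin by (auto simp: FactGroup_def RCOSETS_def)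
  have "h ` P \<subseteq> carrier (G Mod N)" using Pc by auto
  then have img: "h ` P = carrier (G Mod N)"
    using card_image[OF inj] card finQ by (intro card_subset_eq) (simp_all add: order_def)
  define \<pi> where "\<pi> g = inv_into P h (h g)" for g
  have \<pi>P: "\<pi> g \<in> P" "h (\<pi> g) = h g" if "g \<in> carrier G" for g
  proof -
    have "h g \<in> h ` P" using h.hom_closed[OF that] img by simp
    then show "\<pi> g \<in> P" "h (\<pi> g) = h g" unfolding \<pi>_def by (rule inv_into_into, rule f_inv_into_f)
  qed
  have "\<pi> \<in> hom G (G\<lparr>carrier := P\<rparr>)"
  proof (rule homI)
    show "\<pi> g \<in> carrier (G\<lparr>carrier := P\<rparr>)" if "g \<in> carrier G" for g using \<pi>P(1)[OF that] by simp
    fix x y assume xy: "x \<in> carrier G" "y \<in> carrier G"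
    have "h (\<pi> (x \<otimes> y)) = h (\<pi> x \<otimes> \<pi> y)" using xy \<pi>P Pc by simp
    then have "\<pi> (x \<otimes> y) = \<pi> x \<otimes> \<pi> y"
      using inj_onD[OF inj] xy \<pi>P(1) subgroup.m_closed[OF P] by simp
    then show "\<pi> (x \<otimes> y) = \<pi> x \<otimes>\<^bsub>G\<lparr>carrier := P\<rparr>\<^esub> \<pi> y" by simp
  qed
  moreover have "\<forall>x\<in>P. \<pi> x = x" using inj by (simp add: \<pi>_def)
  ultimately show ?thesis by blast
qed

end

theorem theorem12p2:
  fixes \<alpha> \<beta> :: int and n :: nat
  assumes "\<alpha> \<noteq> 1" and "\<beta> \<noteq> 1"
    and "multiplicity (2::int) (\<alpha> - 1) = 1"
    and "n = multiplicity (2::int) (\<beta> - 1)" and "n > 2"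
  shows "group (Gab \<alpha> \<beta>) \<and> finite (carrier (Gab \<alpha> \<beta>))
    \<and> (\<exists>P \<pi>. sylow2_proj (Gab \<alpha> \<beta>) P \<pi>)
    \<and> (\<forall>P \<pi>. sylow2_proj (Gab \<alpha> \<beta>) P \<pi> \<longrightarrow>
          card P = 2 ^ (n + 4)
        \<and> nilpotent_grp ((Gab \<alpha> \<beta>)\<lparr>carrier := P\<rparr>)
        \<and> nil_class ((Gab \<alpha> \<beta>)\<lparr>carrier := P\<rparr>) = 3
        \<and> group.ord (Gab \<alpha> \<beta>) (\<pi> (elA \<alpha> \<beta>)) = 4
        \<and> group.ord (Gab \<alpha> \<beta>) (\<pi> (elC \<alpha> \<beta>)) = 4
        \<and> group.ord (Gab \<alpha> \<beta>) (\<pi> (elB \<alpha> \<beta>)) = 2 ^ (n + 1))"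
proof -
  let ?G = "Gab \<alpha> \<beta>" and ?A = "elA \<alpha> \<beta>" and ?B = "elB \<alpha> \<beta>"
  obtain s where s: "\<alpha> - 1 = 2 ^ multiplicity (2::int) (\<alpha> - 1) * s" "odd s"
    using multiplicity_decompose'[of "\<alpha> - 1" "2::int"] assms(1) by auto
  have s2: "\<alpha> - 1 = 2 * s" using s(1) unfolding assms(3) by simp
  \<comment> \<open>Valuation 1 means that \<alpha> - 1 is twice an odd number; on elements of order
    dividing 4, the exponent \<alpha> therefore acts as inversion.\<close>
  have \<alpha>4: "\<alpha> mod 4 = 3" using s2 s(2) by presburger
  obtain t where t: "\<beta> - 1 = 2 ^ multiplicity (2::int) (\<beta> - 1) * t" "odd t"
    using multiplicity_decompose'[of "\<beta> - 1" "2::int"] assms(2) by auto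
  have \<beta>t: "\<beta> = 1 + 2 ^ n * t" using t(1) unfolding assms(4)[symmetric] by simp
  have n3: "n \<ge> 3" using assms(5) by simp
  have "(2::int) ^ 3 dvd 2 ^ n * t" using n3 by (simp add: le_imp_power_dvd dvd_mult2 del: power_numeral)
  then have \<beta>8: "8 dvd \<beta> - 1" using \<beta>t by simp
  have odd: "odd \<alpha>" "odd \<beta>" using \<alpha>4 \<beta>8 by presburger+
  have \<beta>1: "\<bar>\<beta>\<bar> > 1" using \<beta>8 assms(2) by presburger
  interpret M: macdonald ?G ?A ?B \<alpha> \<beta> by (rule macdonald_Gab)
  have C: "elC \<alpha> \<beta> = M.C" by (rule elC_eq)
  interpret M: macdonald_finite ?G ?A ?B \<alpha> \<beta>
    using M.finite_orders[OF odd assms(1) \<beta>1] odd Gab_generated by unfold_locales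
  have fin: "finite (carrier ?G)" by (rule M.finite_carrier)
  define e where "e = multiplicity (2::nat) (order ?G)"
  have ord0: "order ?G \<noteq> 0" using fin M.order_gt_0_iff_finite by simp
  have ex: "\<exists>P \<pi>. sylow2_proj ?G P \<pi>"
  proof -
    obtain N k where N: "N \<lhd> ?G" "odd (card N)" "order (?G Mod N) = 2 ^ k"
      using M.normal_2_complement by blast
    have ordk: "order ?G = 2 ^ k * card N"
      using M.lagrange[of N] N(1,3) by (simp add: order_def FactGroup_def normal_def)
    \<comment> \<open>The odd part of the order is exactly the order of the normal complement, so
      its index is the order of a Sylow 2-subgroup.\<close>
    have "multiplicity (2::nat) (2 ^ k * card N) = k"
      using N(2) by (intro multiplicity_eqI) (auto simp: mult.commute)
    then have ek: "e = k" by (simp add: e_def ordk)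
    obtain P where P: "subgroup P ?G" "card P = 2 ^ k"
      using sylow_thm[OF two_is_prime_nat M.group_axioms ordk fin] by blast
    have "coprime (card P) (card N)" unfolding P(2) using N(2) by simp
    then obtain \<pi> where "\<pi> \<in> hom ?G (?G\<lparr>carrier := P\<rparr>)" "\<forall>x\<in>P. \<pi> x = x"
      using M.projection_if_normal_complement[OF fin N(1) P(1)] N(3) P(2) by metis
    then show ?thesis
      unfolding sylow2_proj_def using P ek unfolding e_def by blast
  qed
  have "2 ^ (n + 4) dvd order ?G"
  proof -
    \<comment> \<open>With m = 2^n the element b of the model has order 2^(n+1), and there are 16
      times 2^n points.\<close>
    interpret model: two_model "2 ^ n"
      using le_imp_power_dvd[of 2 n "2::nat"] n3 by unfold_locales simp_all
    obtain w where w: "t = 2 * w + 1" using t(2) by (auto elim: oddE)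
    \<comment> \<open>\<beta> - (1 + 2^n) is 2^n (t - 1), and t is odd.\<close>
    have \<beta>m: "2 * int (2 ^ n) dvd \<beta> - (1 + int (2 ^ n))"
      unfolding \<beta>t by (simp add: w algebra_simps)
    obtain \<phi> where "\<phi> \<in> hom ?G (BijGroup model.Pts)" "\<phi> ?A = model.PA" "\<phi> ?B = model.PB"
      using Gab_hom[OF model.macdonald_model(1)[OF \<alpha>4 \<beta>m]] by blast
    then have "16 * 2 ^ n dvd order ?G"
      using model.order_dvd[OF M.macdonald_axioms _ _ _ \<alpha>4 \<beta>m] by blast
    then show ?thesis by (simp add: power_add mult.commute)
  qed
  then have ge: "n + 4 \<le> e"
    unfolding e_def using ord0 by (intro multiplicity_geI) auto
  have "card P = 2 ^ (n + 4) \<and> nilpotent_grp (?G\<lparr>carrier := P\<rparr>) \<and> nil_class (?G\<lparr>carrier := P\<rparr>) = 3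
      \<and> group.ord ?G (\<pi> ?A) = 4 \<and> group.ord ?G (\<pi> (elC \<alpha> \<beta>)) = 4 \<and> group.ord ?G (\<pi> ?B) = 2 ^ (n + 1)"
    if proj: "sylow2_proj ?G P \<pi>" for P \<pi>
  proof -
    let ?H = "?G\<lparr>carrier := P\<rparr>"
    have P: "subgroup P ?G" and cardP: "card P = 2 ^ e" and hom: "\<pi> \<in> hom ?G ?H" and id: "\<And>x. x \<in> P \<Longrightarrow> \<pi> x = x"
      using proj by (auto simp: sylow2_proj_def e_def)
    interpret H: group ?H by (rule M.subgroup_imp_group[OF P])
    interpret h: group_hom ?G ?H \<pi> using hom by unfold_locales
    have mac: "macdonald ?H (\<pi> ?A) (\<pi> ?B) \<alpha> \<beta>" and CH: "macdonald.C ?H (\<pi> ?A) (\<pi> ?B) = \<pi> M.C"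
      using macdonald_hom[OF M.macdonald_axioms H.group_axioms hom] by auto
    \<comment> \<open>As \<pi> fixes \<open>P\<close> pointwise it is onto, so the images of the
      generators generate \<open>P\<close>.\<close>
    have surj: "\<pi> ` carrier ?G = P"
    proof
      show "\<pi> ` carrier ?G \<subseteq> P" using h.hom_closed by auto
      show "P \<subseteq> \<pi> ` carrier ?G" using id subgroup.mem_carrier[OF P] by (metis image_eqI subsetI)
    qed
    have ordH: "order ?H = 2 ^ e" by (simp add: order_def cardP)
    have rels: "\<pi> ?A [^]\<^bsub>?H\<^esub> (4::nat) = \<one>\<^bsub>?H\<^esub>"
      "macdonald.C ?H (\<pi> ?A) (\<pi> ?B) [^]\<^bsub>?H\<^esub> (2::nat) = \<pi> ?A [^]\<^bsub>?H\<^esub> (2::nat)"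
      "\<pi> ?B [^]\<^bsub>?H\<^esub> (2 ^ (n + 1) :: nat) = \<one>\<^bsub>?H\<^esub>"
      using two_group_relations[OF \<alpha>4 \<beta>t t(2) n3 mac ordH] by blast+
    have gen: "carrier ?H = generate ?H {\<pi> ?A, \<pi> ?B}"
      using h.generate_img[of "{?A, ?B}"] M.generated surj by auto
    have hpow: "\<exists>m>0. \<pi> g [^]\<^bsub>?H\<^esub> (m::nat) = \<one>\<^bsub>?H\<^esub>"
      if "g \<in> carrier ?G" "\<exists>m>0. g [^]\<^bsub>?G\<^esub> (m::nat) = \<one>\<^bsub>?G\<^esub>" for g
      using that h.hom_nat_pow h.hom_one by metis
    interpret T: macdonald_two ?H "\<pi> ?A" "\<pi> ?B" \<alpha> \<beta> n t
    proof (intro macdonald_two.intro macdonald_finite.intro macdonald_finite_axioms.intro macdonald_two_axioms.intro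
        mac odd gen \<alpha>4 \<beta>t t(2) n3 rels)
      show "\<exists>m>0. \<pi> ?A [^]\<^bsub>?H\<^esub> (m::nat) = \<one>\<^bsub>?H\<^esub>" "\<exists>m>0. \<pi> ?B [^]\<^bsub>?H\<^esub> (m::nat) = \<one>\<^bsub>?H\<^esub>"
        "\<exists>m>0. macdonald.C ?H (\<pi> ?A) (\<pi> ?B) [^]\<^bsub>?H\<^esub> (m::nat) = \<one>\<^bsub>?H\<^esub>"
        unfolding CH using M.finite_A M.finite_B M.finite_C by (intro hpow; simp)+
    qed
    \<comment> \<open>The count of normal forms in \<open>P\<close> meets the lower bound on e that
      came from the permutation model.\<close>
    have "(2::nat) ^ e \<le> 2 ^ (n + 4)" using T.order_le unfolding ordH .
    then have "e \<le> n + 4" by simp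
    then have e: "e = n + 4" using ge by simp
    have mem: "\<pi> g \<in> P" if "g \<in> carrier ?G" for g using h.hom_closed[OF that] by simp
    have ords: "group.ord ?G (\<pi> g) = H.ord (\<pi> g)" if "g \<in> carrier ?G" for g
      using M.ord_subgroup[OF P mem[OF that]] by simp
    show ?thesis
      using T.orders_and_class[OF ordH[unfolded e]] cardP e unfolding C CH
      by (simp add: ords)
  qed
  then show ?thesis using group_Gab fin ex by blast
qed

end
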